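(* Let $d\ge1$ and $0\le k\le d$, and assume $[d]!\ne0$. Let $W=\mathbb V^{\otimes d}\otimes_{\mathscr H_d}\mathscr H_{d+k}\subset\widetilde T_d(\mathbb V)$, with $\mathscr H_{d+k}$ acting on $W$ by right multiplication (identified with its image in $\mathrm{End}_{\mathbb C(q)}(W)$). Let $\mathcal A_d^k\subset\mathrm{End}_{\mathbb C(q)}(W)$ be the $\mathbb C(q)$-span of all operators $L(w_d)\cdots L(w_1)L(\sigma)L(v_1^\ast)\cdots L(v_d^\ast)$ (restricted to $W$) with $w_1,\dots,w_d\in\mathbb V$, $\sigma\in\mathscr H_{d+k}$, $v_1^\ast,\dots,v_d^\ast\in\mathbb V^\ast$. Then $$\mathcal A_d^k=\mathrm{End}_{\mathscr H_{d+k}}(W)\qquad\text{and}\qquad\mathrm{End}_{\mathcal A_d^k}(W)=\mathscr H_{d+k}.$$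
   Context: $q$ is an indeterminate, $m,n\ge1$, $[m+n]=\{1,\dots,m+n\}$; $[a]=\frac{q^a-q^{-a}}{q-q^{-1}}$, $[d]!=[1]\cdots[d]$. The Hecke algebra $\mathscr H_d$ is the $\mathbb C(q)$-algebra generated by $T_1,\dots,T_{d-1}$ with relations $(T_i-q)(T_i+q^{-1})=0$, $T_iT_{i+1}T_i=T_{i+1}T_iT_{i+1}$, $T_iT_j=T_jT_i$ ($|i-j|>1$); $T_w=T_{i_1}\cdots T_{i_k}$ for a reduced expression $w=s_{i_1}\cdots s_{i_k}\in\mathfrak S_d$; $\mathscr H_\infty$ is the inductive limit of $\mathscr H_0\subset\mathscr H_1\subset\cdots$, and $T\mapsto T^{\uparrow k}$ is the algebra endomorphism with $T_i^{\uparrow k}=T_{i+k}$. Parity: $\hat i=0$ if $i\le m$, $\hat i=1$ if $i>m$; $q_i=q^{(-1)^{\hat i}}$. $\gamma(i,j)=1$ if $i>j$ and $-1$ if $i\le j$. $\mathbb V$ is the $\mathbb C(q)$-vector space with basis $e_1,\dots,e_{m+n}$, $e_i$ of parity $\hat i$; $e_1^\ast,\dots,e_{m+n}^\ast$ is the dual basis. For $I=(i_d,\dots,i_1)\in[m+n]^d$, $e_I=e_{i_d}\otimes\cdots\otimes e_{i_1}$, written $e_{i_d}\cdots e_{i_1}$; $I.s_k$ is $I$ with the entries $i_k,i_{k+1}$ swapped. The right $\mathscr H_d$-action on $\mathbb V^{\otimes d}$: $e_I.T_k=(-1)^{\hat i_k\hat i_{k+1}}e_{I.s_k}$ if $i_k>i_{k+1}$;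 $=(-1)^{\hat i_k}q_{i_k}e_I$ if $i_k=i_{k+1}$; $=(-1)^{\hat i_k\hat i_{k+1}}e_{I.s_k}+(q-q^{-1})e_I$ if $i_k<i_{k+1}$. Set $\widetilde T_d(\mathbb V)=\mathbb V^{\otimes d}\otimes_{\mathscr H_d}\mathscr H_\infty$, $\widetilde T(\mathbb V)=\bigoplus_{d\ge0}\widetilde T_d(\mathbb V)$, with product $(e_{j_k}\cdots e_{j_1}\otimes T_\tau)\cdot(e_{i_d}\cdots e_{i_1}\otimes T_\sigma)=e_{j_k}\cdots e_{j_1}e_{i_d}\cdots e_{i_1}\otimes T_\tau^{\uparrow d}T_\sigma$. For $\varphi\in\widetilde T(\mathbb V)$, $L(\varphi)$ is left multiplication by $\varphi$; $L(v)$ for $v\in\mathbb V$ uses $v\otimes1\in\widetilde T_1(\mathbb V)$ and $L(\sigma)$ for $\sigma\in\mathscr H_\infty$ uses $1\otimes\sigma\in\widetilde T_0(\mathbb V)$. For $j\in[m+n]$, $f_j(e_r)=q_j^{-\delta_{jr}}e_r$ and $g_j(e_r)=e_r\otimes T_1^{-\gamma(j,r)}\in\widetilde T_1(\mathbb V)$, and $L(e_j^\ast)=0$ on $\widetilde T_0(\mathbb V)$, $$L(e_j^\ast)(e_{i_d}\cdots e_{i_1}\otimes T_\sigma)=\sum_{k=1}^d(-1)^{\hat j(\hat i_d+\cdots+\hat i_{k+1})}\langle e_j^\ast,e_{i_k}\rangle\,g_j(e_{i_d})\cdots g_j(e_{i_{k+1}})f_j(e_{i_{k-1}})\cdots f_j(e_{i_1})\cdot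 T_\sigma$$ (product in $\widetilde T(\mathbb V)$); $L(v^\ast)$ is extended linearly in $v^\ast\in\mathbb V^\ast$. For a subset $A\subset\mathrm{End}_{\mathbb C(q)}(W)$, $\mathrm{End}_A(W)$ denotes its commutant. *)

theory Defs
  imports "HOL-Computational_Algebra.Fraction_Field" "HOL-Computational_Algebra.Polynomial"
    "HOL-Library.Function_Algebras"
begin

type_synonym K = "complex poly fract"

definition qq :: K where "qq = Fraction_Field.Fract [:0, 1:] 1"

definition qint :: "nat \<Rightarrow> K" where
  "qint a = (qq ^ a - inverse qq ^ a) / (qq - inverse qq)"

definition qfact :: "nat \<Rightarrow> K" where
  "qfact d = (\<Prod>a\<in>{1..d}. qint a)"

definition bas :: "'a \<Rightarrow> 'a \<Rightarrow> K" where
  "bas a = (\<lambda>b. if b = a then 1 else 0)"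

definition smul :: "K \<Rightarrow> ('a \<Rightarrow> K) \<Rightarrow> 'a \<Rightarrow> K" where
  "smul c f = (\<lambda>b. c * f b)"

definition fsupp :: "('a \<Rightarrow> K) \<Rightarrow> bool" where
  "fsupp f \<longleftrightarrow> finite {a. f a \<noteq> 0}"

definition lext :: "('a \<Rightarrow> 'b \<Rightarrow> K) \<Rightarrow> ('a \<Rightarrow> K) \<Rightarrow> 'b \<Rightarrow> K" where
  "lext f x = (\<lambda>b. \<Sum>a\<in>{a. x a \<noteq> 0}. x a * f a b)"

definition kspan :: "('a \<Rightarrow> K) set \<Rightarrow> ('a \<Rightarrow> K) set" where
  "kspan S = {f. \<exists>F c. finite F \<and> F \<subseteq> S \<and> f = (\<Sum>g\<in>F. smul (c g) g)}"

definition fperm :: "(nat \<Rightarrow> nat) \<Rightarrow> bool" where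
  "fperm w \<longleftrightarrow> bij w \<and> w 0 = 0 \<and> finite {i. w i \<noteq> i}"

definition sp :: "nat \<Rightarrow> nat \<Rightarrow> nat" where
  "sp i = (\<lambda>x. if x = i then Suc i else if x = Suc i then i else x)"

definition plen :: "(nat \<Rightarrow> nat) \<Rightarrow> nat" where
  "plen w = card {(a, b). 0 < a \<and> a < b \<and> w b < w a}"

definition wordperm :: "nat list \<Rightarrow> nat \<Rightarrow> nat" where
  "wordperm is = foldr (\<lambda>i f. sp i \<circ> f) is id"

definition rword :: "(nat \<Rightarrow> nat) \<Rightarrow> nat list" where
  "rword w = (SOME is. (\<forall>i\<in>set is. 1 \<le> i) \<and> wordperm is = w \<and> length is = plen w)"

type_synonym hk = "(nat \<Rightarrow> nat) \<Rightarrow> K"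

text \<open>right multiplication by T_i on the basis T_w of the Hecke algebra\<close>
definition hRb :: "nat \<Rightarrow> (nat \<Rightarrow> nat) \<Rightarrow> hk" where
  "hRb i w = (if w i < w (Suc i) then bas (w \<circ> sp i)
              else bas (w \<circ> sp i) + smul (qq - inverse qq) (bas w))"

definition hT :: "(nat \<Rightarrow> nat) \<Rightarrow> hk \<Rightarrow> hk" where
  "hT w x = fold (\<lambda>i y. lext (hRb i) y) (rword w) x"

definition Hmul :: "hk \<Rightarrow> hk \<Rightarrow> hk" where
  "Hmul x y = lext (\<lambda>w. hT w x) y"

definition shiftp :: "nat \<Rightarrow> (nat \<Rightarrow> nat) \<Rightarrow> nat \<Rightarrow> nat" where
  "shiftp k w = (\<lambda>x. if x \<le> k then x else w (x - k) + k)"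

definition hshift :: "nat \<Rightarrow> hk \<Rightarrow> hk" where
  "hshift k h = lext (\<lambda>w. bas (shiftp k w)) h"

definition Hinf :: "hk set" where
  "Hinf = {h. fsupp h \<and> (\<forall>w. h w \<noteq> 0 \<longrightarrow> fperm w)}"

definition Hsub :: "nat \<Rightarrow> hk set" where
  "Hsub e = {h. fsupp h \<and> (\<forall>w. h w \<noteq> 0 \<longrightarrow> fperm w \<and> (\<forall>x>e. w x = x))}"

text \<open>A word I = (i_d,...,i_1) is the list xs with xs!(k-1) = i_k.\<close>

definition qi :: "nat \<Rightarrow> nat \<Rightarrow> K" where
  "qi m i = (if i \<le> m then qq else inverse qq)"

definition vRb :: "nat \<Rightarrow> nat \<Rightarrow> nat list \<Rightarrow> nat list \<Rightarrow> K" where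
  "vRb m k xs =
    (let a = xs ! (k - 1); b = xs ! k; sw = xs[k - 1 := b, k := a];
         sg = (if m < a \<and> m < b then -1 else 1) in
     if b < a then smul sg (bas sw)
     else if a = b then smul ((if m < a then -1 else 1) * qi m a) (bas xs)
     else smul sg (bas sw) + smul (qq - inverse qq) (bas xs))"

definition vT :: "nat \<Rightarrow> (nat \<Rightarrow> nat) \<Rightarrow> (nat list \<Rightarrow> K) \<Rightarrow> nat list \<Rightarrow> K" where
  "vT m w v = fold (\<lambda>i y. lext (vRb m i) y) (rword w) v"

definition vact :: "nat \<Rightarrow> (nat list \<Rightarrow> K) \<Rightarrow> hk \<Rightarrow> nat list \<Rightarrow> K" where
  "vact m v h = lext (\<lambda>w. vT m w v) h"

definition Vten :: "nat \<Rightarrow> nat \<Rightarrow> nat \<Rightarrow> (nat list \<Rightarrow> K) set" where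
  "Vten m n e = {v. fsupp v \<and> (\<forall>I. v I \<noteq> 0 \<longrightarrow> length I = e \<and> set I \<subseteq> {1..m+n})}"

definition Vvec :: "nat \<Rightarrow> nat \<Rightarrow> (nat \<Rightarrow> K) set" where
  "Vvec m n = {v. \<forall>i. v i \<noteq> 0 \<longrightarrow> i \<in> {1..m+n}}"

section \<open>The algebra T~(V) = (+)_d V^(x)d (x)_{H_d} H_infinity\<close>

type_synonym bk = "nat list \<times> (nat \<Rightarrow> nat) \<Rightarrow> K"

definition tens :: "(nat list \<Rightarrow> K) \<Rightarrow> hk \<Rightarrow> bk" where
  "tens v x = (\<lambda>(I, w). v I * x w)"

text \<open>V^(x)e (x)_C(q) H_infinity, all degrees\<close>
definition Bsp :: "nat \<Rightarrow> nat \<Rightarrow> bk set" where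
  "Bsp m n = {f. fsupp f \<and> (\<forall>I w. f (I, w) \<noteq> 0 \<longrightarrow> set I \<subseteq> {1..m+n} \<and> fperm w)}"

text \<open>the (homogeneous) relations defining the tensor products over H_e\<close>
definition Nall :: "nat \<Rightarrow> nat \<Rightarrow> bk set" where
  "Nall m n = kspan {tens (vact m v h) x - tens v (Hmul h x) | e v h x.
                       v \<in> Vten m n e \<and> h \<in> Hsub e \<and> x \<in> Hinf}"

definition cos :: "nat \<Rightarrow> nat \<Rightarrow> bk \<Rightarrow> bk set" where
  "cos m n f = {f + g | g. g \<in> Nall m n}"

definition rep :: "bk set \<Rightarrow> bk" where
  "rep a = (SOME f. f \<in> a)"

definition Tt :: "nat \<Rightarrow> nat \<Rightarrow> bk set set" where
  "Tt m n = cos m n ` Bsp m n"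

definition qadd :: "nat \<Rightarrow> nat \<Rightarrow> bk set \<Rightarrow> bk set \<Rightarrow> bk set" where
  "qadd m n a b = cos m n (rep a + rep b)"

definition qsmul :: "nat \<Rightarrow> nat \<Rightarrow> K \<Rightarrow> bk set \<Rightarrow> bk set" where
  "qsmul m n c a = cos m n (smul c (rep a))"

definition qzero :: "nat \<Rightarrow> nat \<Rightarrow> bk set" where
  "qzero m n = cos m n 0"

text \<open>product (e_J (x) T_t)(e_I (x) T_s) = e_J e_I (x) T_t^{shift |I|} T_s on representatives\<close>
definition tprodb :: "nat list \<times> (nat \<Rightarrow> nat) \<Rightarrow> nat list \<times> (nat \<Rightarrow> nat) \<Rightarrow> bk" where
  "tprodb p r = (case p of (J, t) \<Rightarrow> case r of (I, s) \<Rightarrow>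
      tens (bas (I @ J)) (Hmul (hshift (length I) (bas t)) (bas s)))"

definition tprod :: "bk \<Rightarrow> bk \<Rightarrow> bk" where
  "tprod a b = lext (\<lambda>p. lext (\<lambda>r. tprodb p r) b) a"

definition Lv :: "nat \<Rightarrow> nat \<Rightarrow> (nat \<Rightarrow> K) \<Rightarrow> bk set \<Rightarrow> bk set" where
  "Lv m n v x = cos m n (tprod (tens (\<lambda>I. case I of [r] \<Rightarrow> v r | _ \<Rightarrow> 0) (bas id)) (rep x))"

definition Ls :: "nat \<Rightarrow> nat \<Rightarrow> hk \<Rightarrow> bk set \<Rightarrow> bk set" where
  "Ls m n s x = cos m n (tprod (tens (bas []) s) (rep x))"

definition Rop :: "nat \<Rightarrow> nat \<Rightarrow> hk \<Rightarrow> bk set \<Rightarrow> bk set" where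
  "Rop m n h x = cos m n (tprod (rep x) (tens (bas []) h))"

definition fj :: "nat \<Rightarrow> nat \<Rightarrow> nat \<Rightarrow> bk" where
  "fj m j r = smul (if j = r then inverse (qi m j) else 1) (bas ([r], id))"

definition gj :: "nat \<Rightarrow> nat \<Rightarrow> bk" where
  "gj j r = tens (bas [r])
     (if r < j then bas (sp 1) - smul (qq - inverse qq) (bas id) else bas (sp 1))"

definition Ldb :: "nat \<Rightarrow> nat \<Rightarrow> nat list \<times> (nat \<Rightarrow> nat) \<Rightarrow> bk" where
  "Ldb m j p = (case p of (xs, s) \<Rightarrow>
     (\<Sum>k\<in>{1..length xs}.
        if xs ! (k - 1) = j then
          smul (if m < j \<and> odd (card {l. k < l \<and> l \<le> length xs \<and> m < xs ! (l - 1)}) then -1 else 1)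
           (foldr tprod
              (map (\<lambda>l. gj j (xs ! (l - 1))) (rev [Suc k..<Suc (length xs)])
               @ map (\<lambda>l. fj m j (xs ! (l - 1))) (rev [1..<k]))
              (bas ([], s)))
        else 0))"

text \<open>L(v^*), v^* = sum_j v^*_j e_j^*\<close>
definition Ld :: "nat \<Rightarrow> nat \<Rightarrow> (nat \<Rightarrow> K) \<Rightarrow> bk set \<Rightarrow> bk set" where
  "Ld m n vs x = cos m n (\<Sum>j\<in>{1..m+n}. smul (vs j) (lext (Ldb m j) (rep x)))"

definition Wsp :: "nat \<Rightarrow> nat \<Rightarrow> nat \<Rightarrow> nat \<Rightarrow> bk set set" where
  "Wsp m n d k = cos m n ` {f \<in> Bsp m n. \<forall>I w. f (I, w) \<noteq> 0 \<longrightarrow>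
       length I = d \<and> (\<forall>x>d+k. w x = x)}"

definition Agen :: "nat \<Rightarrow> nat \<Rightarrow> nat \<Rightarrow> nat \<Rightarrow> (bk set \<Rightarrow> bk set) set" where
  "Agen m n d k = {(\<lambda>x. fold (\<lambda>w y. Lv m n w y) ws (Ls m n s (foldr (\<lambda>v y. Ld m n v y) vs x)))
      | ws s vs. length ws = d \<and> set ws \<subseteq> Vvec m n \<and> s \<in> Hsub (d + k)
              \<and> length vs = d \<and> set vs \<subseteq> Vvec m n}"

definition Aspan :: "nat \<Rightarrow> nat \<Rightarrow> nat \<Rightarrow> nat \<Rightarrow> (bk set \<Rightarrow> bk set) set" where
  "Aspan m n d k = {\<psi>. \<exists>os cs. set os \<subseteq> Agen m n d k \<and> length cs = length os \<and>
      \<psi> = (\<lambda>x. foldr (\<lambda>(c, op) acc. qadd m n (qsmul m n c (op x)) acc) (zip cs os) (qzero m n))}"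

definition linW :: "nat \<Rightarrow> nat \<Rightarrow> nat \<Rightarrow> nat \<Rightarrow> (bk set \<Rightarrow> bk set) \<Rightarrow> bool" where
  "linW m n d k \<phi> \<longleftrightarrow> \<phi> ` Wsp m n d k \<subseteq> Wsp m n d k \<and>
     (\<forall>a\<in>Wsp m n d k. \<forall>b\<in>Wsp m n d k. \<phi> (qadd m n a b) = qadd m n (\<phi> a) (\<phi> b)) \<and>
     (\<forall>c. \<forall>a\<in>Wsp m n d k. \<phi> (qsmul m n c a) = qsmul m n c (\<phi> a))"

definition EndH :: "nat \<Rightarrow> nat \<Rightarrow> nat \<Rightarrow> nat \<Rightarrow> (bk set \<Rightarrow> bk set) \<Rightarrow> bool" where
  "EndH m n d k \<phi> \<longleftrightarrow> linW m n d k \<phi> \<and>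
     (\<forall>h\<in>Hsub (d + k). \<forall>x\<in>Wsp m n d k. \<phi> (Rop m n h x) = Rop m n h (\<phi> x))"

definition EndA :: "nat \<Rightarrow> nat \<Rightarrow> nat \<Rightarrow> nat \<Rightarrow> (bk set \<Rightarrow> bk set) \<Rightarrow> bool" where
  "EndA m n d k \<phi> \<longleftrightarrow> linW m n d k \<phi> \<and>
     (\<forall>\<psi>\<in>Aspan m n d k. \<forall>x\<in>Wsp m n d k. \<phi> (\<psi> x) = \<psi> (\<phi> x))"

end

theory Submission
  imports Defs "HOL-Library.FuncSet"
begin

text \<open>The maps \<open>E_P\<close> obtained by composing the operators dual to the letters of a word \<open>P\<close> of length \<open>d\<close>
  send \<open>V^d\<close> to \<open>H_d\<close>, linearly over \<open>H_d\<close>. The coefficient of \<open>E_P(e_I)\<close> at the longest element is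
  nonzero exactly when \<open>I\<close> is the reverse of \<open>P\<close>, and an \<open>H_d\<close>-linear map to \<open>H_d\<close> is determined by its
  coefficient there; so the \<open>E_P\<close> span all such maps. The generators act by self-adjoint operators for
  the standard hermitian form over \<open>C(q)\<close> with \<open>q\<close> real, which is definite. The positive definite frame
  operator \<open>v \<mapsto> \<Sum>\<^sub>J\<^sub>,\<^sub>w \<langle>v, e_J T_w\<rangle> e_J T_w\<close> is \<open>H_d\<close>-linear and invertible, which yields a dual basis
  identity \<open>f = \<Sum>\<^sub>J\<^sub>,\<^sub>P a\<^sub>J\<^sub>P e_J \<otimes> E_P(f)\<close> on \<open>W\<close>: every endomorphism of \<open>W\<close> over the Hecke algebra is
  then a combination of the operators \<open>x \<mapsto> w E_P(x)\<close>, which lie in the operator algebra.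
  Conversely the elements \<open>y E_P(x)\<close> span an ideal of the Hecke algebra with a left unit \<open>e\<close>, the orthogonal
  projection of 1, and \<open>e\<close> acts as the identity on \<open>W\<close>. If \<open>e = \<Sum> c_i y_i E_{P_i}(x_i)\<close>, then an operator
  \<open>\<phi>\<close> that commutes with the algebra is right multiplication by \<open>\<Sum> c_i y_i E_{P_i}(\<phi> x_i)\<close>.\<close>

section \<open>Finitely supported functions\<close>

text \<open>The tensor product over H_d is a quotient by \<open>Nall\<close>, so an operator exists
  on it only if its lift to representatives preserves the relations. For the dual operators this is
  the hard point: when T_p crosses two letters that both survive, their factors g_j must satisfy
  braid identities containing inverses. The convention for \<gamma> produces exactly the sign
  patterns for which such identities hold, and the scalar q_j^{-1} of f_j is what makes equal
  letters match. Tensor space is in general not free over H_d, so it has no basis over H_d to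
  compute with. The dual basis identity and the left unit of the ideal take the place of
  projectivity and semisimplicity; both are obtained by orthogonal projection. The longest element
  enters by counting: removing the first of l letters brings l - 1 generators, removing any other
  letter brings fewer. Only if the first letter is removed each time does the number of generators
  reach 0 + 1 + ... + (d - 1), the length of the longest element.\<close>

definition FS :: "'a set \<Rightarrow> ('a \<Rightarrow> K) set" where
  "FS A = {x. fsupp x \<and> (\<forall>a. x a \<noteq> 0 \<longrightarrow> a \<in> A)}"

text \<open>Nothing is demanded outside \<open>FS A\<close>: maps such as \<open>lext\<close> are
  additive only on finite supports, while every map here is a total function.\<close>

definition lin :: "'a set \<Rightarrow> 'b set \<Rightarrow> (('a \<Rightarrow> K) \<Rightarrow> 'b \<Rightarrow> K) \<Rightarrow> bool" where
  "lin A B F \<longleftrightarrow> (\<forall>x\<in>FS A. F x \<in> FS B) \<and> (\<forall>x\<in>FS A. \<forall>y\<in>FS A. F (x + y) = F x + F y)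
     \<and> (\<forall>c. \<forall>x\<in>FS A. F (smul c x) = smul c (F x))"

lemmas pointwise = zero_fun_apply plus_fun_apply minus_apply uminus_apply

declare pointwise [simp del]

interpretation kv: vector_space "smul :: K \<Rightarrow> ('a \<Rightarrow> K) \<Rightarrow> 'a \<Rightarrow> K"
  by unfold_locales (auto simp: smul_def algebra_simps fun_eq_iff pointwise)

lemma kspan_eq_span: "kspan S = kv.span S"
  unfolding kspan_def kv.span_explicit by blast

lemma smul_zero [simp]: "smul c 0 = 0" "smul 0 x = 0" "smul 1 x = x"
  by (auto simp: smul_def fun_eq_iff pointwise)

lemma smul_smul [simp]: "smul a (smul b x) = smul (a * b) x"
  by (auto simp: smul_def fun_eq_iff pointwise)

lemma smul_add: "smul c (x + y) = smul c x + smul c y"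
  and smul_diff: "smul c (x - y) = smul c x - smul c y"
  by (auto simp: smul_def fun_eq_iff pointwise algebra_simps)

lemma smul_sum: "smul c (\<Sum>i\<in>S. f i) = (\<Sum>i\<in>S. smul c (f i))"
  by (rule kv.scale_sum_right)

lemma smul_minus1: "smul (-1) x = - x"
  by (auto simp: smul_def fun_eq_iff pointwise)

lemma sum_fun_apply: "(\<Sum>i\<in>S. f i) a = (\<Sum>i\<in>S. f i a)"
  by (induction S rule: infinite_finite_induct) (auto simp: pointwise)

lemma FS_zero [simp]: "0 \<in> FS A"
  by (auto simp: FS_def fsupp_def pointwise)

lemma FS_add [simp]: "x \<in> FS A \<Longrightarrow> y \<in> FS A \<Longrightarrow> x + y \<in> FS A"
proof -
  assume a: "x \<in> FS A" "y \<in> FS A"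
  then have "finite ({a. x a \<noteq> 0} \<union> {a. y a \<noteq> 0})" by (auto simp: FS_def fsupp_def)
  then have "finite {a. (x + y) a \<noteq> 0}"
    by (rule rev_finite_subset) (auto simp: pointwise)
  moreover have "a \<in> A" if "(x + y) a \<noteq> 0" for a
    using a that by (cases "x a = 0") (auto simp: FS_def pointwise)
  ultimately show ?thesis by (auto simp: FS_def fsupp_def)
qed

lemma FS_smul [simp]: "x \<in> FS A \<Longrightarrow> smul c x \<in> FS A"
  by (auto simp: FS_def fsupp_def smul_def intro: rev_finite_subset)

lemma FS_uminus [simp]: "x \<in> FS A \<Longrightarrow> - x \<in> FS A"
  by (auto simp: FS_def fsupp_def pointwise)

lemma FS_diff [simp]: "x \<in> FS A \<Longrightarrow> y \<in> FS A \<Longrightarrow> x - y \<in> FS A"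
  using FS_add[of x A "- y"] by (simp add: FS_uminus)

lemma FS_sum [simp]: "(\<And>i. i \<in> S \<Longrightarrow> f i \<in> FS A) \<Longrightarrow> (\<Sum>i\<in>S. f i) \<in> FS A"
  by (induction S rule: infinite_finite_induct) auto

lemma FS_bas [simp]: "bas a \<in> FS A \<longleftrightarrow> a \<in> A"
  by (auto simp: FS_def fsupp_def bas_def)

lemma FS_mono: "x \<in> FS A \<Longrightarrow> A \<subseteq> B \<Longrightarrow> x \<in> FS B"
  by (auto simp: FS_def)

lemma FS_finite: "x \<in> FS A \<Longrightarrow> finite {a. x a \<noteq> 0}"
  by (auto simp: FS_def fsupp_def)

lemma FS_outside: "x \<in> FS A \<Longrightarrow> a \<notin> A \<Longrightarrow> x a = 0"
  by (auto simp: FS_def)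

lemma FS_expand: "x \<in> FS A \<Longrightarrow> x = (\<Sum>a\<in>{a. x a \<noteq> 0}. smul (x a) (bas a))"
  by (auto simp: FS_def fsupp_def fun_eq_iff pointwise sum_fun_apply smul_def bas_def if_distrib
      cong: if_cong)

lemma FS_expand_on:
  assumes "x \<in> FS A" "finite A"
  shows "x = (\<Sum>a\<in>A. smul (x a) (bas a))"
proof -
  have "(\<Sum>a\<in>A. smul (x a) (bas a)) = (\<Sum>a\<in>{a. x a \<noteq> 0}. smul (x a) (bas a))"
    by (rule sum.mono_neutral_right) (use assms in \<open>auto simp: FS_def\<close>)
  then show ?thesis using FS_expand[OF assms(1)] by simp
qed

lemma FS_induct [consumes 1, case_names zero step]:
  assumes x: "x \<in> FS A" and z: "P 0"
    and s: "\<And>c a y. a \<in> A \<Longrightarrow> y \<in> FS A \<Longrightarrow> P y \<Longrightarrow> P (smul c (bas a) + y)"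
  shows "P x"
proof -
  have "P (\<Sum>a\<in>S. smul (x a) (bas a)) \<and> (\<Sum>a\<in>S. smul (x a) (bas a)) \<in> FS A"
    if "finite S" "S \<subseteq> {a. x a \<noteq> 0}" for S
    using that
  proof (induction S rule: finite_induct)
    case empty then show ?case using z by simp
  next
    case (insert a S)
    moreover have "a \<in> A" using insert x by (auto simp: FS_def)
    ultimately show ?case using s[of a "\<Sum>a\<in>S. smul (x a) (bas a)" "x a"]
      by simp
  qed
  from this[of "{a. x a \<noteq> 0}"] show ?thesis
    using FS_expand[OF x] FS_finite[OF x] by simp
qed

lemma kspan_sub_FS: "S \<subseteq> FS A \<Longrightarrow> kspan S \<subseteq> FS A"
  unfolding kspan_def by (auto intro!: FS_sum)

lemma linD:
  assumes "lin A B F"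
  shows "x \<in> FS A \<Longrightarrow> F x \<in> FS B" and "x \<in> FS A \<Longrightarrow> y \<in> FS A \<Longrightarrow> F (x + y) = F x + F y"
    and "x \<in> FS A \<Longrightarrow> F (smul c x) = smul c (F x)"
  using assms by (auto simp: lin_def)

lemma lin_zero: "lin A B F \<Longrightarrow> F 0 = 0"
  using linD(3)[of A B F 0 0] by simp

lemma lin_diff: "lin A B F \<Longrightarrow> x \<in> FS A \<Longrightarrow> y \<in> FS A \<Longrightarrow> F (x - y) = F x - F y"
  using linD(2)[of A B F x "smul (-1) y"] linD(3)[of A B F y "-1"] by (simp add: smul_minus1)

lemma lin_sum: "lin A B F \<Longrightarrow> (\<And>i. i \<in> S \<Longrightarrow> f i \<in> FS A) \<Longrightarrow> F (\<Sum>i\<in>S. f i) = (\<Sum>i\<in>S. F (f i))"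
  by (induction S rule: infinite_finite_induct) (auto simp: lin_zero linD)

lemma lin_mono: "lin A B F \<Longrightarrow> A' \<subseteq> A \<Longrightarrow> B \<subseteq> B' \<Longrightarrow> lin A' B' F"
  unfolding lin_def by (meson FS_mono)

lemma lin_comp: "lin A B G \<Longrightarrow> lin B C F \<Longrightarrow> lin A C (\<lambda>x. F (G x))"
  unfolding lin_def by auto

lemma lin_id: "A \<subseteq> B \<Longrightarrow> lin A B (\<lambda>x. x)"
  unfolding lin_def by (auto intro: FS_mono)

lemma lin_0: "lin A B (\<lambda>x. 0)"
  unfolding lin_def by auto

lemma lin_add: "lin A B F \<Longrightarrow> lin A B G \<Longrightarrow> lin A B (\<lambda>x. F x + G x)"
  unfolding lin_def by (auto simp: smul_add)

lemma lin_smul: "lin A B F \<Longrightarrow> lin A B (\<lambda>x. smul c (F x))"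
  unfolding lin_def by (auto simp: smul_add mult.commute)

lemma lin_minus: "lin A B F \<Longrightarrow> lin A B G \<Longrightarrow> lin A B (\<lambda>x. F x - G x)"
  unfolding lin_def by (auto simp: smul_diff)

lemma lin_setsum: "(\<And>i. i \<in> S \<Longrightarrow> lin A B (F i)) \<Longrightarrow> lin A B (\<lambda>x. \<Sum>i\<in>S. F i x)"
  unfolding lin_def by (auto simp: smul_sum sum.distrib)

text \<open>The codomains may differ, so that two formulas for the same map can be compared when
  they are known to land in different spaces.\<close>

lemma lin_eqI:
  assumes "lin A B F" "lin A B' G" "\<And>a. a \<in> A \<Longrightarrow> F (bas a) = G (bas a)" "x \<in> FS A"
  shows "F x = G x"
  using assms(4)
proof (induction rule: FS_induct)
  case zero
  show ?case using lin_zero[OF assms(1)] lin_zero[OF assms(2)] by simp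
next
  case (step c a y)
  have "bas a \<in> FS A" using step by simp
  then show ?case using step assms(3)[of a] linD(2,3)[OF assms(1)] linD(2,3)[OF assms(2)]
    by simp
qed

lemma lext_alt: "lext f x = (\<Sum>a\<in>{a. x a \<noteq> 0}. smul (x a) (f a))"
  by (auto simp: lext_def fun_eq_iff pointwise sum_fun_apply smul_def)

lemma lext_alt_on: "finite S \<Longrightarrow> {a. x a \<noteq> 0} \<subseteq> S \<Longrightarrow> lext f x = (\<Sum>a\<in>S. smul (x a) (f a))"
  unfolding lext_alt by (rule sum.mono_neutral_left) auto

lemma lext_bas [simp]: "lext f (bas a) = f a"
proof -
  have "{b. bas a b \<noteq> 0} = {a}" by (auto simp: bas_def)
  then show ?thesis unfolding lext_alt by (simp add: bas_def)
qed

lemma lext_add: "x \<in> FS A \<Longrightarrow> y \<in> FS A \<Longrightarrow> lext f (x + y) = lext f x + lext f y"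
proof -
  assume a: "x \<in> FS A" "y \<in> FS A"
  let ?S = "{a. x a \<noteq> 0} \<union> {a. y a \<noteq> 0}"
  have fin: "finite ?S" using a by (auto intro: FS_finite)
  have "{a. (x + y) a \<noteq> 0} \<subseteq> ?S" by (auto simp: pointwise)
  then have "lext f (x + y) = (\<Sum>a\<in>?S. smul ((x + y) a) (f a))"
    using fin lext_alt_on by blast
  also have "\<dots> = (\<Sum>a\<in>?S. smul (x a) (f a)) + (\<Sum>a\<in>?S. smul (y a) (f a))"
    unfolding sum.distrib[symmetric] by (rule sum.cong) (auto simp: kv.scale_left_distrib pointwise)
  also have "\<dots> = lext f x + lext f y"
    using fin lext_alt_on[of ?S x f] lext_alt_on[of ?S y f] by auto
  finally show ?thesis .
qed

lemma lext_smul: "lext f (smul c x) = smul c (lext f x)"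
proof (cases "c = 0")
  case False
  then have "{a. smul c x a \<noteq> 0} = {a. x a \<noteq> 0}" by (auto simp: smul_def)
  then show ?thesis unfolding lext_alt by (simp add: smul_sum) (simp add: smul_def)
qed (simp add: lext_alt pointwise)

lemma lext_FS: "x \<in> FS A \<Longrightarrow> (\<And>a. a \<in> A \<Longrightarrow> f a \<in> FS B) \<Longrightarrow> lext f x \<in> FS B"
  unfolding lext_alt by (rule FS_sum) (auto simp: FS_def[of A])

lemma lin_lext: "(\<And>a. a \<in> A \<Longrightarrow> f a \<in> FS B) \<Longrightarrow> lin A B (lext f)"
  unfolding lin_def by (auto simp: lext_add lext_smul lext_FS)

lemma lext_zero [simp]: "lext f 0 = 0"
  by (simp add: lext_alt pointwise)

lemma lext_cong: "x \<in> FS A \<Longrightarrow> (\<And>a. a \<in> A \<Longrightarrow> f a = g a) \<Longrightarrow> lext f x = lext g x"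
  unfolding lext_alt by (rule sum.cong) (auto simp: FS_def)

lemma lin_as_lext: "lin A B F \<Longrightarrow> x \<in> FS A \<Longrightarrow> F x = lext (\<lambda>a. F (bas a)) x"
  by (rule lin_eqI[where A=A and B=B and B'=B]) (auto intro!: lin_lext elim: linD(1))

lemma lin_lext_param:
  assumes "y \<in> FS C" "\<And>w. w \<in> C \<Longrightarrow> lin A B (\<lambda>x. f w x)"
  shows "lin A B (\<lambda>x. lext (\<lambda>w. f w x) y)"
  unfolding lext_alt by (rule lin_setsum, rule lin_smul) (use assms in \<open>auto simp: FS_def\<close>)

section \<open>A positive definite hermitian form\<close>

abbreviation pcnj :: "complex poly \<Rightarrow> complex poly" where
  "pcnj \<equiv> map_poly cnj"

lemma pcnj_add: "pcnj (p + r) = pcnj p + pcnj r"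
  by (rule poly_eqI) (simp add: coeff_map_poly)

lemma pcnj_mult: "pcnj (p * r) = pcnj p * pcnj r"
  by (rule poly_eqI) (simp add: coeff_map_poly coeff_mult)

lemma pcnj_pcnj [simp]: "pcnj (pcnj p) = p"
  by (rule poly_eqI) (simp add: coeff_map_poly)

lemma pcnj_eq_0 [simp]: "pcnj p = 0 \<longleftrightarrow> p = 0"
  by (metis pcnj_pcnj map_poly_0)

text \<open>The involution of C(q) that conjugates coefficients and fixes q. At a real value of q it
  becomes complex conjugation of the value; this is the sense in which q is real.\<close>

lift_definition conjK :: "K \<Rightarrow> K" is "\<lambda>(a, b). (pcnj a, pcnj b)"
  by (auto simp flip: pcnj_mult)

lemma conjK_Fract: "conjK (Fraction_Field.Fract a b) = Fraction_Field.Fract (pcnj a) (pcnj b)"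
  by transfer auto

lemma conjK_add [simp]: "conjK (x + y) = conjK x + conjK y"
  by (cases x; cases y) (simp add: conjK_Fract pcnj_add pcnj_mult)

lemma conjK_mult [simp]: "conjK (x * y) = conjK x * conjK y"
  by (cases x; cases y) (simp add: conjK_Fract pcnj_mult)

lemma conjK_0 [simp]: "conjK 0 = 0"
  by (simp add: Zero_fract_def conjK_Fract)

lemma conjK_1 [simp]: "conjK 1 = 1"
  by (simp add: One_fract_def conjK_Fract)

lemma conjK_conjK [simp]: "conjK (conjK x) = x"
  by (cases x) (simp add: conjK_Fract)

lemma conjK_uminus [simp]: "conjK (- x) = - conjK x"
  using conjK_add[of x "-x"] by (simp add: add_eq_0_iff)

lemma conjK_diff [simp]: "conjK (x - y) = conjK x - conjK y"
  using conjK_add[of x "-y"] by simp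

lemma conjK_eq_0 [simp]: "conjK x = 0 \<longleftrightarrow> x = 0"
  by (metis conjK_conjK conjK_0)

lemma conjK_inverse [simp]: "conjK (inverse x) = inverse (conjK x)"
proof (cases "x = 0")
  case False
  then have "conjK x * conjK (inverse x) = 1" using conjK_mult[of x "inverse x"] by simp
  then show ?thesis by (metis inverse_unique)
qed simp

lemma conjK_sum: "conjK (\<Sum>i\<in>S. f i) = (\<Sum>i\<in>S. conjK (f i))"
  by (induction S rule: infinite_finite_induct) auto

lemma conjK_qq [simp]: "conjK qq = qq"
  unfolding qq_def by (simp add: conjK_Fract map_poly_pCons)

lemma qq_nz [simp]: "qq \<noteq> 0"
  unfolding qq_def Zero_fract_def by (simp add: eq_fract)

lemma poly_zero_on_reals:
  fixes p :: "complex poly"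
  assumes "\<And>t::real. poly p (of_real t) = 0"
  shows "p = 0"
proof (rule ccontr)
  assume "p \<noteq> 0"
  then have "finite {z. poly p z = 0}" by (rule poly_roots_finite)
  moreover have "range (of_real :: real \<Rightarrow> complex) \<subseteq> {z. poly p z = 0}" using assms by auto
  ultimately have "finite (range (of_real :: real \<Rightarrow> complex))" by (rule rev_finite_subset)
  then show False
    using finite_imageD[of "of_real :: real \<Rightarrow> complex" UNIV] infinite_UNIV_char_0
    by (auto simp: inj_on_def)
qed

text \<open>Over one common denominator a sum vanishes exactly when its numerator does, so
  evaluation concerns polynomials only and there are no poles to avoid.\<close>

lemma common_denominator:
  fixes x :: "'i \<Rightarrow> K"
  assumes "finite S"
  shows "\<exists>D p. D \<noteq> 0 \<and> (\<forall>i\<in>S. x i = Fraction_Field.Fract (p i) D)"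
  using assms
proof (induction S rule: finite_induct)
  case empty
  show ?case by (rule exI[of _ 1]) auto
next
  case (insert a S)
  then obtain D p where D: "D \<noteq> 0" "\<forall>i\<in>S. x i = Fraction_Field.Fract (p i) D" by auto
  obtain u v where uv: "x a = Fraction_Field.Fract u v" "v \<noteq> 0" by (cases "x a")
  show ?case
    by (rule exI[of _ "D * v"], rule exI[of _ "\<lambda>i. if i = a then u * D else p i * v"])
      (use D uv insert in \<open>auto simp: eq_fract\<close>)
qed

lemma sum_Fract: "D \<noteq> 0 \<Longrightarrow> (\<Sum>i\<in>S. Fraction_Field.Fract (p i) D) = Fraction_Field.Fract (\<Sum>i\<in>S. p i) (D :: complex poly)"
  by (induction S rule: infinite_finite_induct) (auto simp: Zero_fract_def eq_fract algebra_simps)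

text \<open>Evaluating at real points turns the sum into a sum of squares of absolute values.\<close>
lemma sum_norm_eq_0:
  assumes "finite S" "(\<Sum>i\<in>S. x i * conjK (x i)) = 0" "i \<in> S"
  shows "x i = 0"
proof -
  obtain D p where D: "D \<noteq> 0" and p: "\<forall>i\<in>S. x i = Fraction_Field.Fract (p i) D"
    using common_denominator[OF assms(1)] by blast
  have "(\<Sum>i\<in>S. x i * conjK (x i)) = (\<Sum>i\<in>S. Fraction_Field.Fract (p i * pcnj (p i)) (D * pcnj D))"
    by (rule sum.cong) (auto simp: p conjK_Fract)
  also have "\<dots> = Fraction_Field.Fract (\<Sum>i\<in>S. p i * pcnj (p i)) (D * pcnj D)"
    using D by (intro sum_Fract) simp
  finally have *: "(\<Sum>i\<in>S. p i * pcnj (p i)) = 0"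
    using assms(2) D by (simp add: Zero_fract_def eq_fract)
  have "poly (p i) (of_real t) = 0" for t :: real
  proof -
    have "(\<Sum>i\<in>S. poly (p i) (of_real t) * cnj (poly (p i) (of_real t))) = 0"
      using arg_cong[OF *, of "\<lambda>r. poly r (of_real t)"] by (simp add: poly_sum)
    then have "complex_of_real (\<Sum>i\<in>S. (cmod (poly (p i) (of_real t)))\<^sup>2) = 0"
      by (simp only: of_real_sum complex_norm_square)
    then have "(\<Sum>i\<in>S. (cmod (poly (p i) (of_real t)))\<^sup>2) = 0"
      using of_real_eq_0_iff by blast
    then show ?thesis using assms(1,3) by (simp add: sum_nonneg_eq_0_iff)
  qed
  then have "p i = 0" by (rule poly_zero_on_reals)
  then show ?thesis using p assms(3) by (simp add: Zero_fract_def eq_fract)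
qed

text \<open>The sum runs over the support of the first argument only. The form is semilinear in the
  second argument, and additivity there needs no condition on supports.\<close>

definition herm :: "('a \<Rightarrow> K) \<Rightarrow> ('a \<Rightarrow> K) \<Rightarrow> K" where
  "herm x y = (\<Sum>a\<in>{a. x a \<noteq> 0}. x a * conjK (y a))"

lemma herm_on: "finite S \<Longrightarrow> {a. x a \<noteq> 0} \<subseteq> S \<Longrightarrow> herm x y = (\<Sum>a\<in>S. x a * conjK (y a))"
  unfolding herm_def by (rule sum.mono_neutral_left) auto

lemma herm_add_left: "x \<in> FS A \<Longrightarrow> y \<in> FS A \<Longrightarrow> herm (x + y) z = herm x z + herm y z"
proof -
  assume a: "x \<in> FS A" "y \<in> FS A"
  let ?S = "{a. x a \<noteq> 0} \<union> {a. y a \<noteq> 0}"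
  have fin: "finite ?S" using a by (auto intro: FS_finite)
  have "{a. (x + y) a \<noteq> 0} \<subseteq> ?S" by (auto simp: pointwise)
  then have "herm (x + y) z = (\<Sum>a\<in>?S. (x + y) a * conjK (z a))"
    using fin herm_on by blast
  also have "\<dots> = (\<Sum>a\<in>?S. x a * conjK (z a)) + (\<Sum>a\<in>?S. y a * conjK (z a))"
    unfolding sum.distrib[symmetric] by (rule sum.cong) (auto simp: algebra_simps pointwise)
  also have "\<dots> = herm x z + herm y z"
    using fin herm_on[of ?S x] herm_on[of ?S y] by auto
  finally show ?thesis .
qed

lemma herm_smul_left: "herm (smul c x) z = c * herm x z"
proof (cases "c = 0")
  case False
  then have "{a. smul c x a \<noteq> 0} = {a. x a \<noteq> 0}" by (auto simp: smul_def)
  then show ?thesis unfolding herm_def by (simp add: sum_distrib_left mult.assoc smul_def)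
qed (simp add: herm_def pointwise)

lemma herm_diff_left: "x \<in> FS A \<Longrightarrow> y \<in> FS A \<Longrightarrow> herm (x - y) z = herm x z - herm y z"
  using herm_add_left[of x A "smul (-1) y" z] herm_smul_left[of "-1" y z]
  by (simp add: smul_minus1)

lemma herm_add_right: "herm x (y + z) = herm x y + herm x z"
  unfolding herm_def by (simp add: sum.distrib algebra_simps pointwise)

lemma herm_smul_right: "herm x (smul c y) = conjK c * herm x y"
  unfolding herm_def smul_def by (simp add: sum_distrib_left algebra_simps)

lemma herm_0 [simp]: "herm x 0 = 0" "herm 0 x = 0"
  unfolding herm_def by (auto simp: pointwise)

lemma herm_sum_right: "herm x (\<Sum>i\<in>S. f i) = (\<Sum>i\<in>S. herm x (f i))"
  by (induction S rule: infinite_finite_induct) (auto simp: herm_add_right)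

lemma herm_bas_right: "x \<in> FS A \<Longrightarrow> herm x (bas a) = x a"
proof -
  assume x: "x \<in> FS A"
  have "herm x (bas a) = (\<Sum>b\<in>insert a {b. x b \<noteq> 0}. x b * conjK (bas a b))"
    by (rule herm_on) (use x in \<open>auto intro: FS_finite\<close>)
  also have "\<dots> = (\<Sum>b\<in>insert a {b. x b \<noteq> 0}. if b = a then x a else 0)"
    by (rule sum.cong) (auto simp: bas_def)
  finally show ?thesis using FS_finite[OF x] by simp
qed

lemma herm_bas_left: "herm (bas a) y = conjK (y a)"
proof -
  have "{b. bas a b \<noteq> 0} = {a}" by (auto simp: bas_def)
  then show ?thesis by (simp add: herm_def bas_def)
qed

lemma herm_definite: "x \<in> FS A \<Longrightarrow> herm x x = 0 \<Longrightarrow> x = 0"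
proof
  fix a assume x: "x \<in> FS A" "herm x x = 0"
  show "x a = 0 a"
    using sum_norm_eq_0[of "{a. x a \<noteq> 0}" x a] x FS_finite[OF x(1)]
    by (cases "x a = 0") (auto simp: herm_def pointwise)
qed

lemma herm_zero_on_kspan:
  assumes "\<And>s. s \<in> S \<Longrightarrow> herm z s = 0" "u \<in> kspan S"
  shows "herm z u = 0"
proof -
  obtain F c where F: "finite F" "F \<subseteq> S" and u: "u = (\<Sum>g\<in>F. smul (c g) g)"
    using assms(2) unfolding kspan_def by blast
  show ?thesis unfolding u herm_sum_right herm_smul_right
    using F assms(1) by (intro sum.neutral) auto
qed

text \<open>One Gram-Schmidt step: \<open>b\<close> is the part of the new vector \<open>a\<close>
  orthogonal to the old span, and the component of \<open>x\<close> along \<open>b\<close> is added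
  to the old projection \<open>p\<close>.\<close>

lemma projection_finite:
  assumes "finite S" "S \<subseteq> FS A" "x \<in> FS A"
  shows "\<exists>p\<in>kspan S. \<forall>u\<in>kspan S. herm (x - p) u = 0"
  using assms
proof (induction S arbitrary: x rule: finite_induct)
  case empty
  show ?case by (auto simp: kspan_eq_span)
next
  case (insert a S)
  obtain p where p: "p \<in> kspan S" "\<forall>u\<in>kspan S. herm (x - p) u = 0"
    using insert.IH[of x] insert.prems by auto
  obtain r where r: "r \<in> kspan S" "\<forall>u\<in>kspan S. herm (a - r) u = 0"
    using insert.IH[of a] insert.prems by auto
  have sub: "kspan S \<subseteq> FS A" using insert by (intro kspan_sub_FS) auto
  have pr: "p \<in> FS A" "r \<in> FS A" using sub p r by auto
  have aA: "a \<in> FS A" using insert by auto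
  define b where "b = a - r"
  have bA: "b \<in> FS A" using aA pr by (simp add: b_def)
  \<comment> \<open>If \<open>a\<close> already lies in the old span, then \<open>b = 0\<close> and
    the quotient is 0/0 = 0, so the projection does not change.\<close>
  define t where "t = herm (x - p) b / herm b b"
  have inS: "u \<in> kspan (insert a S)" if "u \<in> kspan S" for u
    using that unfolding kspan_eq_span by (meson kv.span_mono subsetD subset_insertI)
  have bin: "b \<in> kspan (insert a S)"
    unfolding b_def using inS[OF r(1)] unfolding kspan_eq_span
    by (simp add: kv.span_base kv.span_diff)
  have P1: "p + smul t b \<in> kspan (insert a S)"
    using inS[OF p(1)] bin unfolding kspan_eq_span by (simp add: kv.span_add kv.span_scale)
  have eq: "herm (x - (p + smul t b)) u = herm (x - p) u - t * herm b u" for u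
    using herm_diff_left[of "x - p" A "smul t b" u] insert.prems pr bA
    by (simp add: herm_smul_left diff_diff_eq)
  have hb: "herm (x - (p + smul t b)) b = 0"
    unfolding eq unfolding t_def using herm_definite[OF bA] by (cases "b = 0") auto
  have hS: "herm (x - (p + smul t b)) u = 0" if "u \<in> kspan S" for u
    unfolding eq using p(2) r(2) that by (simp add: b_def)
  have ha: "herm (x - (p + smul t b)) a = 0"
  proof -
    have "a = b + r" by (simp add: b_def)
    then show ?thesis using hb hS[OF r(1)] by (simp add: herm_add_right)
  qed
  have "herm (x - (p + smul t b)) u = 0" if "u \<in> kspan (insert a S)" for u
    using that by (rule herm_zero_on_kspan[rotated])
      (use ha hS in \<open>auto simp: kspan_eq_span kv.span_base\<close>)
  then show ?case using P1 by blast
qed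

text \<open>Since \<open>A\<close> is finite, \<open>FS A\<close> has finite dimension; a maximal
  independent subset of \<open>S\<close> is then finite and has the same span.\<close>

lemma projection:
  assumes "finite A" "S \<subseteq> FS A" "x \<in> FS A"
  shows "\<exists>p\<in>kspan S. \<forall>u\<in>kspan S. herm (x - p) u = 0"
proof -
  obtain B where B: "B \<subseteq> S" "kv.independent B" "S \<subseteq> kv.span B"
    using kv.maximal_independent_subset[of S] by blast
  have "FS A \<subseteq> kv.span (bas ` A)"
  proof
    fix y assume "y \<in> FS A"
    then show "y \<in> kv.span (bas ` A)"
      by (subst FS_expand_on[of y A]) (auto intro!: kv.span_sum kv.span_scale intro: kv.span_base simp: assms)
  qed
  then have "finite B"
    using kv.independent_span_bound[of "bas ` A" B] B assms by auto
  then obtain p where "p \<in> kspan B" "\<forall>u\<in>kspan B. herm (x - p) u = 0"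
    using projection_finite[of B A x] B assms by auto
  moreover have "kspan B = kspan S"
    unfolding kspan_eq_span using B by (metis kv.span_eq kv.span_superset order_trans)
  ultimately show ?thesis by auto
qed

declare comp_apply [simp del] id_apply [simp del]

section \<open>Permutations and reduced words\<close>

text \<open>The symmetric group on 1, ..., e inside the group of all finitary permutations. The
  inclusions between these groups, and between the Hecke algebras \<open>FS (SS e)\<close>, become
  inclusions of sets.\<close>

definition SS :: "nat \<Rightarrow> (nat \<Rightarrow> nat) set" where
  "SS e = {w. fperm w \<and> (\<forall>x>e. w x = x)}"

definition reduced :: "(nat \<Rightarrow> nat) \<Rightarrow> nat list \<Rightarrow> bool" where
  "reduced w is \<longleftrightarrow> (\<forall>i\<in>set is. 1 \<le> i) \<and> wordperm is = w \<and> length is = plen w"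

lemma sp_sp [simp]: "sp i (sp i x) = x"
  by (auto simp: sp_def)

lemma sp_comp_sp [simp]: "sp i \<circ> sp i = id" "w \<circ> sp i \<circ> sp i = w"
  by (auto simp: fun_eq_iff comp_apply id_apply)

lemma sp_at [simp]: "sp i i = Suc i" "sp i (Suc i) = i"
  by (auto simp: sp_def)

lemma sp_away: "x \<noteq> i \<Longrightarrow> x \<noteq> Suc i \<Longrightarrow> sp i x = x"
  by (auto simp: sp_def)

lemma sp_far: "Suc i < j \<Longrightarrow> w \<circ> sp i \<circ> sp j = w \<circ> sp j \<circ> sp i"
  by (auto simp: fun_eq_iff comp_apply id_apply sp_def)

lemma sp_braid: "w \<circ> sp i \<circ> sp (Suc i) \<circ> sp i = w \<circ> sp (Suc i) \<circ> sp i \<circ> sp (Suc i)"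
  by (auto simp: fun_eq_iff comp_apply id_apply sp_def)

lemma bij_sp: "bij (sp i)"
  by (rule o_bij[of "sp i"]) auto

lemma fperm_id [simp]: "fperm id"
  by (auto simp: fperm_def id_apply)

lemma fperm_comp: "fperm v \<Longrightarrow> fperm w \<Longrightarrow> fperm (v \<circ> w)"
proof -
  assume a: "fperm v" "fperm w"
  then have "finite ({i. v i \<noteq> i} \<union> {i. w i \<noteq> i})" by (auto simp: fperm_def)
  then have "finite {i. (v \<circ> w) i \<noteq> i}"
    by (rule rev_finite_subset) (auto simp: comp_apply)
  then show ?thesis using a by (auto simp: fperm_def bij_comp comp_apply)
qed

lemma fperm_sp [simp]: "1 \<le> i \<Longrightarrow> fperm (sp i)"
proof -
  assume "1 \<le> i"
  have "finite {x. sp i x \<noteq> x}"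
    by (rule finite_subset[of _ "{i, Suc i}"]) (auto simp: sp_def)
  then show ?thesis using \<open>1 \<le> i\<close> bij_sp by (auto simp: fperm_def sp_def)
qed

lemma fperm_comp_sp [simp]: "1 \<le> i \<Longrightarrow> fperm w \<Longrightarrow> fperm (w \<circ> sp i)"
  by (simp add: fperm_comp)

lemma fperm_inj: "fperm w \<Longrightarrow> w x = w y \<longleftrightarrow> x = y"
  by (auto simp: fperm_def bij_def inj_on_def)

lemma fperm_0: "fperm w \<Longrightarrow> w 0 = 0"
  by (simp add: fperm_def)

lemma fperm_pos: "fperm w \<Longrightarrow> 0 < x \<Longrightarrow> 0 < w x"
  by (metis fperm_0 fperm_inj neq0_conv)

lemma id_SS [simp]: "id \<in> SS e"
  by (simp add: SS_def id_apply)

lemma SS_fperm: "w \<in> SS e \<Longrightarrow> fperm w"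
  by (simp add: SS_def)

lemma SS_mono: "e \<le> e' \<Longrightarrow> SS e \<subseteq> SS e'"
  by (auto simp: SS_def)

lemma SS_comp_sp [simp]: "1 \<le> i \<Longrightarrow> i < e \<Longrightarrow> w \<in> SS e \<Longrightarrow> w \<circ> sp i \<in> SS e"
  by (auto simp: SS_def sp_away comp_apply)

lemma SS_sp [simp]: "1 \<le> i \<Longrightarrow> i < e \<Longrightarrow> sp i \<in> SS e"
  by (auto simp: SS_def sp_away)

lemma fperm_bound: "fperm w \<Longrightarrow> \<exists>e. w \<in> SS e"
proof -
  assume w: "fperm w"
  then have "finite {i. w i \<noteq> i}" by (simp add: fperm_def)
  then obtain e where "\<forall>i\<in>{i. w i \<noteq> i}. i \<le> e" using finite_nat_set_iff_bounded_le by blast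
  then have "w \<in> SS e" using w by (force simp: SS_def)
  then show ?thesis ..
qed

lemma SS_le: "w \<in> SS e \<Longrightarrow> x \<le> e \<Longrightarrow> w x \<le> e"
proof (rule ccontr)
  assume a: "w \<in> SS e" "x \<le> e" "\<not> w x \<le> e"
  then have "w (w x) = w x" by (auto simp: SS_def)
  then have "w x = x" using a fperm_inj[of w "w x" x] by (auto simp: SS_def)
  then show False using a by simp
qed

lemma finite_SS: "finite (SS e)"
proof -
  let ?r = "\<lambda>w. restrict w {..e}"
  have "SS e \<subseteq> (\<lambda>f x. if x \<le> e then f x else x) ` ({..e} \<rightarrow>\<^sub>E {..e})"
  proof
    fix w assume w: "w \<in> SS e"
    have "w = (\<lambda>x. if x \<le> e then ?r w x else x)" using w by (auto simp: SS_def fun_eq_iff comp_apply id_apply)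
    moreover have "?r w \<in> {..e} \<rightarrow>\<^sub>E {..e}" using SS_le[OF w] by auto
    ultimately show "w \<in> (\<lambda>f x. if x \<le> e then f x else x) ` ({..e} \<rightarrow>\<^sub>E {..e})" by blast
  qed
  moreover have "finite ({..e} \<rightarrow>\<^sub>E {..e::nat})" by (simp add: finite_PiE)
  ultimately show ?thesis by (meson finite_imageI finite_subset)
qed

section \<open>Inversions, descents and length\<close>

definition inversions :: "(nat \<Rightarrow> nat) \<Rightarrow> (nat \<times> nat) set" where
  "inversions w = {(a, b). 0 < a \<and> a < b \<and> w b < w a}"

lemma plen_inversions: "plen w = card (inversions w)"
  by (simp add: plen_def inversions_def)

lemma finite_inversions: "fperm w \<Longrightarrow> finite (inversions w)"
proof -
  assume w: "fperm w"
  then obtain e where e: "w \<in> SS e" using fperm_bound by blast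
  have "inversions w \<subseteq> {..e} \<times> {..e}"
  proof
    fix p assume "p \<in> inversions w"
    then obtain a b where p: "p = (a, b)" "0 < a" "a < b" "w b < w a" by (auto simp: inversions_def comp_apply)
    have "b \<le> e"
    proof (rule ccontr)
      assume "\<not> b \<le> e"
      then have "w b = b" using e by (auto simp: SS_def)
      moreover have "w a < b" if "a \<le> e" using SS_le[OF e that] \<open>\<not> b \<le> e\<close> by simp
      moreover have "w a = a" if "\<not> a \<le> e" using e that by (auto simp: SS_def)
      ultimately show False using p by (cases "a \<le> e") auto
    qed
    then show "p \<in> {..e} \<times> {..e}" using p by auto
  qed
  then show ?thesis by (rule finite_subset) auto
qed

lemma sp_less: "a < b \<Longrightarrow> (a, b) \<noteq> (i, Suc i) \<Longrightarrow> sp i a < sp i b"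
  by (auto simp: sp_def split: if_splits)

lemma sp_pos: "1 \<le> i \<Longrightarrow> 0 < a \<Longrightarrow> 0 < sp i a"
  by (auto simp: sp_def)

text \<open>Applying s_i to both entries carries the inversions of \<open>w\<close> to inversions of
  \<open>w \<circ> sp i\<close>. The only one missed is (i, i+1), the only pair of positions whose
  order s_i reverses.\<close>

lemma plen_asc:
  assumes "fperm w" "1 \<le> i" "w i < w (Suc i)"
  shows "plen (w \<circ> sp i) = Suc (plen w)"
proof -
  let ?g = "map_prod (sp i) (sp i)"
  have inj: "inj ?g" by (metis bij_sp bij_def prod.inj_map)
  have "inversions (w \<circ> sp i) = insert (i, Suc i) (?g ` inversions w)"
  proof (rule set_eqI, clarify)
    fix a b
    show "(a, b) \<in> inversions (w \<circ> sp i) \<longleftrightarrow> (a, b) \<in> insert (i, Suc i) (?g ` inversions w)"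
    proof (cases "(a, b) = (i, Suc i)")
      case True
      then show ?thesis using assms by (auto simp: inversions_def comp_apply)
    next
      case False
      have "(a, b) \<in> ?g ` inversions w \<longleftrightarrow> (sp i a, sp i b) \<in> inversions w"
        by (force simp: image_iff)
      also have "\<dots> \<longleftrightarrow> (a, b) \<in> inversions (w \<circ> sp i)"
      proof
        assume h: "(sp i a, sp i b) \<in> inversions w"
        then have "(sp i a, sp i b) \<noteq> (i, Suc i)" using assms(3) by (auto simp: inversions_def comp_apply)
        then show "(a, b) \<in> inversions (w \<circ> sp i)"
          using h sp_less[of "sp i a" "sp i b" i] sp_pos[of i "sp i a"] assms(2)
          by (auto simp: inversions_def comp_apply)
      next
        assume h: "(a, b) \<in> inversions (w \<circ> sp i)"
        then show "(sp i a, sp i b) \<in> inversions w"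
          using False sp_less[of a b i] sp_pos[of i a] assms(2) by (auto simp: inversions_def comp_apply)
      qed
      finally show ?thesis using False by blast
    qed
  qed
  moreover have "(i, Suc i) \<notin> ?g ` inversions w"
    by (auto simp: inversions_def comp_apply image_iff) (metis sp_sp sp_at lessI less_asym)
  moreover have "finite (?g ` inversions w)" using finite_inversions[OF assms(1)] by simp
  moreover have "card (?g ` inversions w) = card (inversions w)"
    by (rule card_image) (rule inj_on_subset[OF inj], simp)
  ultimately show ?thesis by (simp add: plen_inversions)
qed

lemma plen_desc:
  assumes "fperm w" "1 \<le> i" "w (Suc i) < w i"
  shows "plen w = Suc (plen (w \<circ> sp i))"
  using plen_asc[of "w \<circ> sp i" i] assms by (simp add: comp_apply)

lemma asc_or_desc: "fperm w \<Longrightarrow> w i < w (Suc i) \<or> w (Suc i) < w i"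
  by (metis fperm_inj n_not_Suc_n nat_neq_iff)

lemma plen_id [simp]: "plen id = 0"
  by (auto simp: plen_def id_apply intro: card_eq_0_iff[THEN iffD2])

text \<open>Without descents \<open>w\<close> is strictly increasing. An excess
  \<open>w x > x\<close> would then persist at all larger arguments, although \<open>w\<close> fixes
  almost all of them.\<close>

lemma no_descent_id:
  assumes w: "fperm w" and asc: "\<And>i. 1 \<le> i \<Longrightarrow> w i < w (Suc i)"
  shows "w = id"
proof -
  obtain e where e: "w \<in> SS e" using fperm_bound[OF w] by blast
  have sm: "w x < w (Suc x)" for x
    using asc[of x] fperm_pos[OF w, of 1] fperm_0[OF w] by (cases "x = 0") auto
  have ge: "x \<le> w x" for x
  proof (induction x)
    case (Suc x) then show ?case using sm[of x] by simp
  qed simp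
  have "w x \<le> x" for x
  proof (rule ccontr)
    assume "\<not> w x \<le> x"
    then have gt: "x + k < w (x + k)" for k
    proof (induction k)
      case (Suc k) then show ?case using sm[of "x + k"] by simp
    qed simp
    show False using gt[of "Suc e"] e by (simp add: SS_def)
  qed
  with ge show ?thesis by (auto simp: fun_eq_iff comp_apply id_apply intro: order_antisym)
qed

section \<open>Words in the simple reflections\<close>

lemma wordperm_Nil [simp]: "wordperm [] = id"
  by (simp add: wordperm_def id_apply)

lemma wordperm_Cons: "wordperm (i # is) = sp i \<circ> wordperm is"
  by (simp add: wordperm_def comp_apply)

lemma wordperm_snoc: "wordperm (is @ [i]) = wordperm is \<circ> sp i"
  by (induction "is") (auto simp: wordperm_Cons comp_assoc)

lemma fperm_wordperm: "\<forall>i\<in>set is. 1 \<le> i \<Longrightarrow> fperm (wordperm is)"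
  by (induction "is" rule: rev_induct) (auto simp: wordperm_snoc)

lemma plen_wordperm: "\<forall>i\<in>set is. 1 \<le> i \<Longrightarrow> plen (wordperm is) \<le> length is"
proof (induction "is" rule: rev_induct)
  case (snoc i "is")
  then have f: "fperm (wordperm is)" "1 \<le> i" by (auto intro: fperm_wordperm)
  then have "plen (wordperm is \<circ> sp i) \<le> Suc (plen (wordperm is))"
    using asc_or_desc[OF f(1), of i] plen_asc[OF f] plen_desc[OF f] by auto
  then show ?case using snoc by (auto simp: wordperm_snoc)
qed simp

lemma reduced_id [simp]: "reduced id []"
  by (simp add: reduced_def)

lemma reduced_fperm: "reduced w is \<Longrightarrow> fperm w"
  by (auto simp: reduced_def intro: fperm_wordperm)

text \<open>If \<open>i\<close> were an ascent of \<open>w\<close>, then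
  \<open>w \<circ> sp i\<close> would be longer than the word that represents it.\<close>

lemma reduced_snocD:
  assumes "reduced w (is @ [i])"
  shows "reduced (w \<circ> sp i) is" "1 \<le> i" "w (Suc i) < w i"
proof -
  have i: "1 \<le> i" and l: "\<forall>i\<in>set is. 1 \<le> i" and w: "w = wordperm is \<circ> sp i"
    and len: "Suc (length is) = plen w"
    using assms by (auto simp: reduced_def wordperm_snoc)
  have u: "w \<circ> sp i = wordperm is" using w by simp
  have f: "fperm w" using assms by (rule reduced_fperm)
  have "plen (w \<circ> sp i) \<le> length is" using u plen_wordperm[OF l] by simp
  then show d: "w (Suc i) < w i"
    using asc_or_desc[OF f, of i] plen_asc[OF f i] len by auto
  show "reduced (w \<circ> sp i) is" using plen_desc[OF f i d] len u l by (simp add: reduced_def)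
  show "1 \<le> i" by (rule i)
qed

lemma reduced_snocI:
  assumes "reduced w is" "1 \<le> i" "w i < w (Suc i)"
  shows "reduced (w \<circ> sp i) (is @ [i])"
  using assms plen_asc[OF reduced_fperm[OF assms(1)] assms(2,3)]
  by (auto simp: reduced_def wordperm_snoc)

lemma reduced_exists: "fperm w \<Longrightarrow> \<exists>is. reduced w is"
proof (induction "plen w" arbitrary: w rule: less_induct)
  case less
  show ?case
  proof (cases "w = id")
    case False
    then obtain i where i: "1 \<le> i" "w (Suc i) < w i"
      using no_descent_id[OF less.prems] asc_or_desc[OF less.prems] by blast
    then obtain "is" where "reduced (w \<circ> sp i) is"
      using less.hyps[of "w \<circ> sp i"] plen_desc[OF less.prems i] less.prems by auto
    from reduced_snocI[OF this i(1)] i have "reduced w (is @ [i])" by (simp add: comp_apply)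
    then show ?thesis by blast
  qed (auto intro: exI[of _ "[]"])
qed

lemma reduced_rword: "fperm w \<Longrightarrow> reduced w (rword w)"
  unfolding rword_def reduced_def using someI_ex[OF reduced_exists[of w], unfolded reduced_def] .

lemma SS_descent: "w \<in> SS e \<Longrightarrow> w (Suc i) < w i \<Longrightarrow> i < e"
proof (rule ccontr)
  assume a: "w \<in> SS e" "w (Suc i) < w i" "\<not> i < e"
  then have "w (Suc i) = Suc i" by (auto simp: SS_def)
  moreover have "w i \<le> i" using a SS_le[of w e i] by (cases "i = e") (auto simp: SS_def)
  ultimately show False using a by simp
qed

lemma reduced_letters: "reduced w is \<Longrightarrow> w \<in> SS e \<Longrightarrow> set is \<subseteq> {1..<e}"
proof (induction "is" arbitrary: w rule: rev_induct)
  case (snoc i "is")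
  note r = reduced_snocD[OF snoc.prems(1)]
  have "i < e" using SS_descent[OF snoc.prems(2) r(3)] .
  then show ?case using snoc.IH[OF r(1)] r snoc.prems by simp
qed simp

lemma rword_id [simp]: "rword id = []"
  using reduced_rword[of id] by (simp add: reduced_def)

lemma rword_sp: "1 \<le> i \<Longrightarrow> rword (sp i) = [i]"
proof -
  assume i: "1 \<le> i"
  have "plen (sp i) = 1" using plen_asc[of id i] i by (simp add: id_apply)
  then obtain j where j: "rword (sp i) = [j]"
    using reduced_rword[of "sp i"] i by (auto simp: reduced_def length_Suc_conv)
  then have "sp j = sp i" using reduced_rword[of "sp i"] i by (simp add: reduced_def wordperm_Cons)
  then have "sp j i = sp i i" by (simp only:)
  then have "j = i" unfolding sp_def by presburger
  then show ?thesis using j by simp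
qed

text \<open>Matsumoto's theorem: two reduced words that end in different letters are both compared with
  a word through the longest element of the rank two subgroup generated by these letters.\<close>
lemma matsumoto:
  assumes closed: "\<And>i x. 1 \<le> i \<Longrightarrow> i < e \<Longrightarrow> x \<in> X \<Longrightarrow> \<rho> i x \<in> X"
    and far: "\<And>i j x. 1 \<le> i \<Longrightarrow> Suc i < j \<Longrightarrow> j < e \<Longrightarrow> x \<in> X \<Longrightarrow> \<rho> i (\<rho> j x) = \<rho> j (\<rho> i x)"
    and braid: "\<And>i x. 1 \<le> i \<Longrightarrow> Suc i < e \<Longrightarrow> x \<in> X \<Longrightarrow>
        \<rho> i (\<rho> (Suc i) (\<rho> i x)) = \<rho> (Suc i) (\<rho> i (\<rho> (Suc i) x))"
    and "w \<in> SS e" "reduced w is" "reduced w js" "x \<in> X"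
  shows "fold \<rho> is x = fold \<rho> js x"
  using assms(4-6)
proof (induction "plen w" arbitrary: w "is" js rule: less_induct)
  case less
  have inX: "fold \<rho> ks x \<in> X" if "set ks \<subseteq> {1..<e}" for ks
    using that assms(7) by (induction ks rule: rev_induct) (auto intro: closed simp: comp_apply id_apply)
  show ?case
  proof (cases "is" rule: rev_cases)
    case Nil
    then have "js = []" using less.prems by (auto simp: reduced_def)
    then show ?thesis using Nil by (simp add: comp_apply)
  next
    case (snoc is' i)
    then have "js \<noteq> []" using less.prems by (auto simp: reduced_def)
    then obtain js' j where js: "js = js' @ [j]" by (metis rev_exhaust)
    have f: "fperm w" using less.prems by (auto simp: SS_def)
    note ri = reduced_snocD[OF less.prems(2)[unfolded snoc]]
    note rj = reduced_snocD[OF less.prems(3)[unfolded js]]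
    have ie: "i < e" "j < e" using SS_descent[OF less.prems(1)] ri rj by auto
    have step: "fold \<rho> us x = fold \<rho> vs x" if "reduced (w \<circ> sp l) us" "reduced (w \<circ> sp l) vs"
      "1 \<le> l" "w (Suc l) < w l" for us vs l
      using less.hyps[of "w \<circ> sp l" us vs] plen_desc[OF f that(3,4)] that less.prems
        SS_descent[OF less.prems(1) that(4)] by auto
    have main: "fold \<rho> (us @ [a]) x = fold \<rho> (vs @ [b]) x"
      if ab: "a < b" and ra: "reduced (w \<circ> sp a) us" "1 \<le> a" "w (Suc a) < w a"
        and rb: "reduced (w \<circ> sp b) vs" "1 \<le> b" "w (Suc b) < w b" for a b us vs
    proof -
      have be: "b < e" using SS_descent[OF less.prems(1) rb(3)] .
      show ?thesis
      proof (cases "Suc a < b")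
        case True
        let ?u = "w \<circ> sp a \<circ> sp b"
        have u: "?u = w \<circ> sp b \<circ> sp a" using sp_far[OF True] .
        have "fperm ?u" using f ra rb by auto
        then obtain ks where ks: "reduced ?u ks" using reduced_exists by blast
        have v: "w b = (w \<circ> sp a) b" "w (Suc b) = (w \<circ> sp a) (Suc b)"
          "w a = (w \<circ> sp b) a" "w (Suc a) = (w \<circ> sp b) (Suc a)"
          using True by (auto simp: sp_def comp_apply)
        have "reduced (?u \<circ> sp b) (ks @ [b])"
          by (rule reduced_snocI[OF ks rb(2)]) (use v rb in \<open>simp add: comp_apply\<close>)
        then have 1: "fold \<rho> us x = fold \<rho> (ks @ [b]) x"
          using step[OF ra(1) _ ra(2,3)] by simp
        have "reduced (?u \<circ> sp a) (ks @ [a])"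
          by (rule reduced_snocI[OF ks ra(2)]) (unfold u, use v ra in \<open>simp add: comp_apply\<close>)
        then have 2: "fold \<rho> vs x = fold \<rho> (ks @ [a]) x"
          using step[OF rb(1) _ rb(2,3)] unfolding u by simp
        have "set ks \<subseteq> {1..<e}"
          using reduced_letters[OF ks] less.prems(1) ra rb be True by auto
        then show ?thesis using far[OF ra(2) True be inX] 1 2 by (simp add: comp_apply)
      next
        case False
        then have b: "b = Suc a" using ab by simp
        let ?u = "w \<circ> sp a \<circ> sp b \<circ> sp a"
        have u: "?u = w \<circ> sp b \<circ> sp a \<circ> sp b" unfolding b by (rule sp_braid)
        have "fperm ?u" using f ra rb by auto
        then obtain ks where ks: "reduced ?u ks" using reduced_exists by blast
        have w3: "w (Suc (Suc a)) < w (Suc a)" "w (Suc a) < w a" using ra rb b by auto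
        have e1: "?u a = w (Suc (Suc a))" "?u (Suc a) = w (Suc a)" "?u (Suc (Suc a)) = w a"
          by (auto simp: b sp_def comp_apply)
        have r1: "reduced (?u \<circ> sp a) (ks @ [a])"
          by (rule reduced_snocI[OF ks ra(2)]) (use e1 w3 in \<open>simp add: comp_apply\<close>)
        have r2: "reduced (?u \<circ> sp b) (ks @ [b])"
          by (rule reduced_snocI[OF ks rb(2)]) (use e1 w3 b in \<open>simp add: comp_apply\<close>)
        have "reduced (?u \<circ> sp a \<circ> sp b) ((ks @ [a]) @ [b])"
          by (rule reduced_snocI[OF r1 rb(2)]) (use w3 in \<open>auto simp: b sp_def comp_apply\<close>)
        then have 1: "fold \<rho> us x = fold \<rho> (ks @ [a, b]) x"
          using step[OF ra(1) _ ra(2,3)] by simp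
        have "reduced (?u \<circ> sp b \<circ> sp a) ((ks @ [b]) @ [a])"
          by (rule reduced_snocI[OF r2 ra(2)]) (use w3 in \<open>auto simp: b sp_def comp_apply\<close>)
        then have 2: "fold \<rho> vs x = fold \<rho> (ks @ [b, a]) x"
          using step[OF rb(1) _ rb(2,3)] unfolding u by simp
        have "set ks \<subseteq> {1..<e}"
          using reduced_letters[OF ks] less.prems(1) ra rb be ab by auto
        then show ?thesis using braid[OF ra(2) _ inX] be 1 2 b by (simp add: comp_apply)
      qed
    qed
    show ?thesis
    proof (cases i j rule: linorder_cases)
      case less
      then show ?thesis using main[OF less ri rj] snoc js by (simp add: comp_apply)
    next
      case equal
      then show ?thesis using step[OF ri(1) _ ri(2,3)] rj(1) snoc js by (simp add: comp_apply)
    next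
      case greater
      then show ?thesis using main[OF greater rj ri] snoc js by (simp add: comp_apply)
    qed
  qed
qed

lemma shiftp_comp_sp: "1 \<le> i \<Longrightarrow> shiftp e (w \<circ> sp i) = shiftp e w \<circ> sp (i + e)"
  by (auto simp: shiftp_def sp_def fun_eq_iff comp_apply id_apply)

lemma shiftp_id [simp]: "shiftp e id = id"
  by (auto simp: shiftp_def fun_eq_iff id_apply)

lemma shiftp_0: "fperm w \<Longrightarrow> shiftp 0 w = w"
  by (auto simp: shiftp_def fun_eq_iff comp_apply id_apply fperm_0)

lemma shiftp_sp1: "shiftp e (sp (Suc 0)) = sp (Suc e)"
  by (auto simp: shiftp_def sp_def fun_eq_iff comp_apply id_apply)

lemma reduced_shiftp: "reduced w is \<Longrightarrow> reduced (shiftp e w) (map (\<lambda>i. i + e) is)"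
proof (induction "is" arbitrary: w rule: rev_induct)
  case Nil
  then have "w = id" by (simp add: reduced_def)
  then show ?case by simp
next
  case (snoc i "is")
  note r = reduced_snocD[OF snoc.prems]
  have "reduced (shiftp e (w \<circ> sp i) \<circ> sp (i + e)) (map (\<lambda>i. i + e) is @ [i + e])"
    by (rule reduced_snocI[OF snoc.IH[OF r(1)]]) (use r in \<open>auto simp: shiftp_def comp_apply\<close>)
  then show ?case using shiftp_comp_sp[OF r(2), of e "w \<circ> sp i"] by simp
qed

section \<open>Modules over the Hecke algebra given by generators\<close>

abbreviation qc :: K where "qc \<equiv> qq - inverse qq"

text \<open>The common pattern of \<open>Hmul\<close> and \<open>vact\<close>: T_w acts through the
  letters of a chosen reduced word. One locale then treats both the regular representation and
  tensor space.\<close>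

definition ract :: "(nat \<Rightarrow> 'a \<Rightarrow> 'a \<Rightarrow> K) \<Rightarrow> ('a \<Rightarrow> K) \<Rightarrow> hk \<Rightarrow> 'a \<Rightarrow> K" where
  "ract \<rho> v h = lext (\<lambda>w. fold (\<lambda>i. lext (\<rho> i)) (rword w) v) h"

lemma Hmul_ract: "Hmul x y = ract hRb x y"
  by (simp add: Hmul_def ract_def hT_def)

lemma vact_ract: "vact m v h = ract (vRb m) v h"
  by (simp add: vact_def ract_def vT_def)

lemma Hsub_FS: "Hsub e = FS (SS e)"
  by (auto simp: Hsub_def FS_def SS_def)

abbreviation PP :: "(nat \<Rightarrow> nat) set" where "PP \<equiv> {w. fperm w}"

lemma Hinf_FS: "Hinf = FS PP"
  by (auto simp: Hinf_def FS_def)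

lemma SS_PP: "SS e \<subseteq> PP"
  by (auto simp: SS_def)

lemma hRb_asc: "w i < w (Suc i) \<Longrightarrow> hRb i w = bas (w \<circ> sp i)"
  by (simp add: hRb_def)

lemma hRb_desc: "w (Suc i) < w i \<Longrightarrow> hRb i w = bas (w \<circ> sp i) + smul qc (bas w)"
  by (simp add: hRb_def)

lemma hRb_SS: "1 \<le> i \<Longrightarrow> i < e \<Longrightarrow> w \<in> SS e \<Longrightarrow> hRb i w \<in> FS (SS e)"
  by (auto simp: hRb_def)

text \<open>\<open>\<rho> i a\<close> is the image of the basis vector \<open>a\<close> under T_i,
  for i < e. \<open>gen_quad\<close> is (T_i - q)(T_i + q^{-1}) = 0 solved for the square of T_i;
  \<open>gen_sym\<close> and \<open>gen_real\<close> make T_i self-adjoint for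
  \<open>herm\<close>.\<close>

locale hrep =
  fixes \<rho> :: "nat \<Rightarrow> 'a \<Rightarrow> 'a \<Rightarrow> K" and A :: "'a set" and e :: nat
  assumes gen_in: "1 \<le> i \<Longrightarrow> i < e \<Longrightarrow> a \<in> A \<Longrightarrow> \<rho> i a \<in> FS A"
    and gen_quad: "1 \<le> i \<Longrightarrow> i < e \<Longrightarrow> a \<in> A \<Longrightarrow> lext (\<rho> i) (\<rho> i a) = bas a + smul qc (\<rho> i a)"
    and gen_far: "1 \<le> i \<Longrightarrow> Suc i < j \<Longrightarrow> j < e \<Longrightarrow> a \<in> A \<Longrightarrow>
        lext (\<rho> i) (\<rho> j a) = lext (\<rho> j) (\<rho> i a)"
    and gen_braid: "1 \<le> i \<Longrightarrow> Suc i < e \<Longrightarrow> a \<in> A \<Longrightarrow>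
        lext (\<rho> i) (lext (\<rho> (Suc i)) (\<rho> i a)) = lext (\<rho> (Suc i)) (lext (\<rho> i) (\<rho> (Suc i) a))"
    and gen_sym: "1 \<le> i \<Longrightarrow> i < e \<Longrightarrow> a \<in> A \<Longrightarrow> b \<in> A \<Longrightarrow> \<rho> i a b = \<rho> i b a"
    and gen_real: "1 \<le> i \<Longrightarrow> i < e \<Longrightarrow> a \<in> A \<Longrightarrow> conjK (\<rho> i a b) = \<rho> i a b"
begin

lemma op_lin: "1 \<le> i \<Longrightarrow> i < e \<Longrightarrow> lin A A (lext (\<rho> i))"
  by (rule lin_lext) (rule gen_in)

lemma op_in: "1 \<le> i \<Longrightarrow> i < e \<Longrightarrow> x \<in> FS A \<Longrightarrow> lext (\<rho> i) x \<in> FS A"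
  using op_lin linD(1) by blast

lemma op_quad:
  assumes "1 \<le> i" "i < e" "x \<in> FS A"
  shows "lext (\<rho> i) (lext (\<rho> i) x) = x + smul qc (lext (\<rho> i) x)"
  by (rule lin_eqI[OF lin_comp[OF op_lin op_lin] lin_add[OF lin_id[OF order_refl] lin_smul[OF op_lin]]])
    (use assms gen_quad in auto)

lemma op_far:
  assumes "1 \<le> i" "Suc i < j" "j < e" "x \<in> FS A"
  shows "lext (\<rho> i) (lext (\<rho> j) x) = lext (\<rho> j) (lext (\<rho> i) x)"
  by (rule lin_eqI[OF lin_comp[OF op_lin op_lin] lin_comp[OF op_lin op_lin]])
    (use assms gen_far in auto)

lemma op_braid:
  assumes "1 \<le> i" "Suc i < e" "x \<in> FS A"
  shows "lext (\<rho> i) (lext (\<rho> (Suc i)) (lext (\<rho> i) x))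
    = lext (\<rho> (Suc i)) (lext (\<rho> i) (lext (\<rho> (Suc i)) x))"
  by (rule lin_eqI[OF lin_comp[OF lin_comp[OF op_lin op_lin] op_lin]
        lin_comp[OF lin_comp[OF op_lin op_lin] op_lin]])
    (use assms gen_braid in auto)

lemma fold_lin: "set is \<subseteq> {1..<e} \<Longrightarrow> lin A A (fold (\<lambda>i. lext (\<rho> i)) is)"
proof (induction "is" rule: rev_induct)
  case Nil
  show ?case using lin_id[of A A] by (simp add: id_def)
next
  case (snoc i "is")
  then have "lin A A (\<lambda>x. lext (\<rho> i) (fold (\<lambda>i. lext (\<rho> i)) is x))"
    by (intro lin_comp[OF snoc.IH op_lin]) auto
  then show ?case by (simp add: comp_def id_apply)
qed

definition W where "W w v = fold (\<lambda>i. lext (\<rho> i)) (rword w) v"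

lemma rword_letters: "w \<in> SS e \<Longrightarrow> set (rword w) \<subseteq> {1..<e}"
  using reduced_letters[OF reduced_rword] SS_fperm by blast

lemma W_lin: "w \<in> SS e \<Longrightarrow> lin A A (W w)"
  using fold_lin[OF rword_letters] by (simp add: W_def[abs_def])

lemma W_in: "w \<in> SS e \<Longrightarrow> v \<in> FS A \<Longrightarrow> W w v \<in> FS A"
  using W_lin linD(1) by blast

text \<open>Matsumoto's theorem turns the arbitrary choice in \<open>rword\<close> into an operator
  that any reduced word computes.\<close>

lemma W_reduced:
  assumes "w \<in> SS e" "reduced w is" "v \<in> FS A"
  shows "W w v = fold (\<lambda>i. lext (\<rho> i)) is v"
  unfolding W_def
  by (rule matsumoto[of e "FS A", OF _ _ _ assms(1) reduced_rword assms(2,3)])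
    (use assms op_in op_far op_braid in \<open>auto simp: SS_fperm\<close>)

lemma W_asc:
  assumes "w \<in> SS e" "1 \<le> i" "i < e" "w i < w (Suc i)" "v \<in> FS A"
  shows "W (w \<circ> sp i) v = lext (\<rho> i) (W w v)"
proof -
  have "reduced (w \<circ> sp i) (rword w @ [i])"
    by (rule reduced_snocI[OF reduced_rword]) (use assms in \<open>auto simp: SS_fperm\<close>)
  then show ?thesis using W_reduced[of "w \<circ> sp i"] assms by (simp add: W_def comp_apply)
qed

lemma W_desc:
  assumes "w \<in> SS e" "1 \<le> i" "i < e" "w (Suc i) < w i" "v \<in> FS A"
  shows "lext (\<rho> i) (W w v) = W (w \<circ> sp i) v + smul qc (W w v)"
proof -
  have "W w v = lext (\<rho> i) (W (w \<circ> sp i) v)"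
    using W_asc[of "w \<circ> sp i" i v] assms by (simp add: comp_apply)
  then show ?thesis using op_quad[of i "W (w \<circ> sp i) v"] assms W_in by simp
qed

lemma ract_W: "ract \<rho> v h = lext (\<lambda>w. W w v) h"
  by (simp add: ract_def W_def)

lemma ract_bas: "ract \<rho> v (bas w) = W w v"
  by (simp add: ract_W)

lemma ract_lin_right: "v \<in> FS A \<Longrightarrow> lin (SS e) A (\<lambda>h. ract \<rho> v h)"
  unfolding ract_W by (rule lin_lext) (rule W_in)

lemma ract_lin_left: "h \<in> FS (SS e) \<Longrightarrow> lin A A (\<lambda>v. ract \<rho> v h)"
  unfolding ract_W by (rule lin_lext_param[where C = "SS e"]) (use W_lin in auto)

lemma ract_in: "v \<in> FS A \<Longrightarrow> h \<in> FS (SS e) \<Longrightarrow> ract \<rho> v h \<in> FS A"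
  using ract_lin_right linD(1) by blast

lemma ract_id [simp]: "ract \<rho> v (bas id) = v"
  by (simp add: ract_bas W_def id_apply)

lemma ract_sp: "1 \<le> i \<Longrightarrow> ract \<rho> v (bas (sp i)) = lext (\<rho> i) v"
  by (simp add: ract_bas W_def rword_sp comp_apply id_apply)

lemma R_lin: "1 \<le> i \<Longrightarrow> i < e \<Longrightarrow> lin (SS e) (SS e) (lext (hRb i))"
  by (rule lin_lext) (rule hRb_SS)

text \<open>\<open>W_asc\<close> and \<open>W_desc\<close> repeat the case distinction in the
  definition of \<open>hRb\<close>, so T_i on the module and right multiplication by T_i correspond
  on every T_w.\<close>

lemma ract_gen:
  assumes "1 \<le> i" "i < e" "v \<in> FS A" "h \<in> FS (SS e)"
  shows "lext (\<rho> i) (ract \<rho> v h) = ract \<rho> v (lext (hRb i) h)"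
proof (rule lin_eqI[OF lin_comp[OF ract_lin_right op_lin] lin_comp[OF R_lin ract_lin_right] _ assms(4)])
  fix w assume w: "w \<in> SS e"
  then have "fperm w" by (rule SS_fperm)
  show "lext (\<rho> i) (ract \<rho> v (bas w)) = ract \<rho> v (lext (hRb i) (bas w))"
  proof (cases "w i < w (Suc i)")
    case True
    then show ?thesis using W_asc[OF w assms(1,2) True assms(3)] by (simp add: ract_bas hRb_asc)
  next
    case False
    then have d: "w (Suc i) < w i" using asc_or_desc[OF \<open>fperm w\<close>] by blast
    then show ?thesis
      using W_desc[OF w assms(1,2) d assms(3)] linD(2,3)[OF ract_lin_right[OF assms(3)]] w assms
      by (simp add: ract_bas hRb_desc)
  qed
qed (use assms in auto)

lemma ract_fold:
  assumes "set is \<subseteq> {1..<e}" "v \<in> FS A" "h \<in> FS (SS e)"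
  shows "fold (\<lambda>i. lext (\<rho> i)) is (ract \<rho> v h) = ract \<rho> v (fold (\<lambda>i. lext (hRb i)) is h)
    \<and> fold (\<lambda>i. lext (hRb i)) is h \<in> FS (SS e)"
  using assms(1)
proof (induction "is" rule: rev_induct)
  case Nil
  show ?case using assms by (simp add: id_apply)
next
  case (snoc i "is")
  then have i: "1 \<le> i" "i < e" by auto
  show ?case using snoc ract_gen[OF i assms(2)] linD(1)[OF R_lin[OF i]] by (simp add: comp_apply)
qed

lemma Hmul_bas_in:
  assumes "h \<in> FS (SS e)" "w \<in> SS e" "v \<in> FS A"
  shows "Hmul h (bas w) \<in> FS (SS e)" "ract \<rho> v (Hmul h (bas w)) = ract \<rho> (ract \<rho> v h) (bas w)"
  using ract_fold[OF rword_letters[OF assms(2)] assms(3,1)]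
  by (auto simp: Hmul_ract ract_def[of hRb]) (simp_all add: ract_bas W_def)

lemma Hmul_in: 
  assumes "h \<in> FS (SS e)" "h' \<in> FS (SS e)"
  shows "Hmul h h' \<in> FS (SS e)"
proof -
  have "lin (SS e) (SS e) (lext (\<lambda>w. hT w h))"
    by (rule lin_lext) (use Hmul_bas_in(1)[OF assms(1) _ FS_zero] in \<open>simp add: Hmul_def\<close>)
  then show ?thesis unfolding Hmul_def using assms(2) by (rule linD(1))
qed

lemma Hmul_lin_right_SS: "h \<in> FS (SS e) \<Longrightarrow> lin (SS e) (SS e) (\<lambda>h'. Hmul h h')"
  unfolding Hmul_def
  by (rule lin_lext) (use Hmul_bas_in(1)[OF _ _ FS_zero] in \<open>simp add: Hmul_def\<close>)

text \<open>For the regular representation this is the associativity of \<open>Hmul\<close>.\<close>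

lemma ract_assoc:
  assumes "v \<in> FS A" "h \<in> FS (SS e)" "h' \<in> FS (SS e)"
  shows "ract \<rho> (ract \<rho> v h) h' = ract \<rho> v (Hmul h h')"
  by (rule lin_eqI[OF ract_lin_right lin_comp[OF Hmul_lin_right_SS ract_lin_right]])
    (use assms Hmul_bas_in ract_in in auto)

section \<open>Adjoints of the action\<close>

lemma herm_gen:
  assumes "1 \<le> i" "i < e" "v \<in> FS A" "u \<in> FS A"
  shows "herm (lext (\<rho> i) v) u = herm v (lext (\<rho> i) u)"
  using assms(3)
proof (induction rule: FS_induct)
  case zero
  show ?case by simp
next
  case (step c a y)
  let ?S = "{b. \<rho> i a b \<noteq> 0} \<union> {b. u b \<noteq> 0}"
  have fin: "finite ?S" using FS_finite[OF gen_in[OF assms(1,2) step(1)]] FS_finite[OF assms(4)] by simp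
  have sub: "b \<in> A" if "b \<in> ?S" for b
    using that gen_in[OF assms(1,2) step(1)] assms(4) by (auto simp: FS_def)
  have "herm (\<rho> i a) u = (\<Sum>b\<in>?S. \<rho> i a b * conjK (u b))"
    by (rule herm_on) (use fin in auto)
  also have "\<dots> = (\<Sum>b\<in>?S. conjK (u b * \<rho> i b a))"
  proof (rule sum.cong)
    fix b assume "b \<in> ?S"
    then have "b \<in> A" by (rule sub)
    then have "conjK (\<rho> i b a) = \<rho> i a b"
      using gen_sym[OF assms(1,2) step(1), of b] gen_real[OF assms(1,2), of b a] by simp
    then show "\<rho> i a b * conjK (u b) = conjK (u b * \<rho> i b a)" by simp
  qed simp
  also have "\<dots> = conjK (lext (\<rho> i) u a)"
    using fin lext_alt_on[of ?S u "\<rho> i"] by (simp add: conjK_sum sum_fun_apply smul_def)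
  finally have "herm (\<rho> i a) u = herm (bas a) (lext (\<rho> i) u)" by (simp add: herm_bas_left)
  moreover have "lext (\<rho> i) (smul c (bas a) + y) = smul c (\<rho> i a) + lext (\<rho> i) y"
    using linD(2,3)[OF op_lin[OF assms(1,2)]] step by simp
  ultimately show ?case
    using step herm_add_left[of "smul c (\<rho> i a)" A "lext (\<rho> i) y" u] herm_add_left[of "smul c (bas a)" A y]
      gen_in[OF assms(1,2) step(1)] op_in[OF assms(1,2)]
    by (simp add: herm_smul_left)
qed

text \<open>Every letter is self-adjoint, so the adjoint of a word is the reversed word, which again
  acts as an element of the algebra.\<close>

lemma adjoint_word:
  assumes "set is \<subseteq> {1..<e}"
  shows "\<exists>h\<in>FS (SS e). \<forall>v\<in>FS A. \<forall>u\<in>FS A.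
    herm (fold (\<lambda>i. lext (\<rho> i)) is v) u = herm v (ract \<rho> u h)"
  using assms
proof (induction "is" rule: rev_induct)
  case Nil
  show ?case by (rule bexI[of _ "bas id"]) (auto simp: id_apply)
next
  case (snoc i "is")
  then have i: "1 \<le> i" "i < e" by auto
  obtain h where h: "h \<in> FS (SS e)"
    "\<forall>v\<in>FS A. \<forall>u\<in>FS A. herm (fold (\<lambda>i. lext (\<rho> i)) is v) u = herm v (ract \<rho> u h)"
    using snoc by auto
  \<comment> \<open>The letter that acts last crosses first to the other side, hence T_i stands to
    the left of \<open>h\<close>.\<close>
  have "herm (fold (\<lambda>i. lext (\<rho> i)) (is @ [i]) v) u = herm v (ract \<rho> u (Hmul (bas (sp i)) h))"
    if vu: "v \<in> FS A" "u \<in> FS A" for v u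
  proof -
    have "fold (\<lambda>i. lext (\<rho> i)) is v \<in> FS A" using fold_lin snoc.prems vu linD(1) by fastforce
    then show ?thesis
      using herm_gen[OF i _ vu(2)] h op_in[OF i vu(2)] vu ract_assoc[OF vu(2) _ h(1), of "bas (sp i)"] i
      by (simp add: comp_apply ract_sp)
  qed
  moreover have "Hmul (bas (sp i)) h \<in> FS (SS e)" using h i by (intro Hmul_in) auto
  ultimately show ?case by blast
qed

lemma adjoint:
  assumes "h \<in> FS (SS e)"
  shows "\<exists>h'\<in>FS (SS e). \<forall>v\<in>FS A. \<forall>u\<in>FS A. herm (ract \<rho> v h) u = herm v (ract \<rho> u h')"
  using assms
proof (induction rule: FS_induct)
  case zero
  show ?case by (rule bexI[of _ 0]) (auto simp: ract_def)
next
  case (step c w y)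
  obtain h1 where h1: "h1 \<in> FS (SS e)"
    "\<forall>v\<in>FS A. \<forall>u\<in>FS A. herm (ract \<rho> v (bas w)) u = herm v (ract \<rho> u h1)"
    using adjoint_word[OF rword_letters[OF step(1)]] by (auto simp: ract_bas W_def)
  obtain h2 where h2: "h2 \<in> FS (SS e)"
    "\<forall>v\<in>FS A. \<forall>u\<in>FS A. herm (ract \<rho> v y) u = herm v (ract \<rho> u h2)"
    using step by auto
  have "herm (ract \<rho> v (smul c (bas w) + y)) u = herm v (ract \<rho> u (smul (conjK c) h1 + h2))"
    if vu: "v \<in> FS A" "u \<in> FS A" for v u
  proof -
    have "bas w \<in> FS (SS e)" using step by simp
    then show ?thesis
      using linD(2,3)[OF ract_lin_right[OF vu(1)]] linD(2,3)[OF ract_lin_right[OF vu(2)]] h1 h2 step vu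
        herm_add_left[of "smul c (ract \<rho> v (bas w))" A "ract \<rho> v y" u] ract_in
      by (simp add: herm_smul_left herm_add_right herm_smul_right)
  qed
  then show ?case using h1 h2 by (intro bexI[of _ "smul (conjK c) h1 + h2"]) auto
qed

end

section \<open>The regular representation\<close>

lemma hRb_form: "hRb i w = bas (w \<circ> sp i) + smul (if w i < w (Suc i) then 0 else qc) (bas w)"
  by (simp add: hRb_def)

lemma lext_add_UNIV: "x \<in> FS UNIV \<Longrightarrow> y \<in> FS UNIV \<Longrightarrow> lext f (x + y) = lext f x + lext f y"
  by (rule lext_add)

text \<open>If \<open>i\<close> is an ascent of \<open>w\<close>, then T_i acts on the span of T_w
  and T_{w s_i} by the symmetric matrix with diagonal 0, \<open>qc\<close> and off-diagonal entries
  1. The braid relation depends only on the relative order of three consecutive values of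
  \<open>a\<close>.\<close>

lemma hrep_regular: "hrep hRb (SS e) e"
proof
  fix i a assume a: "1 \<le> i" "i < e" "a \<in> SS e"
  then have f: "fperm a" by (simp add: SS_fperm)
  show "hRb i a \<in> FS (SS e)" using a by (rule hRb_SS)
  show "lext (hRb i) (hRb i a) = bas a + smul qc (hRb i a)"
    using asc_or_desc[OF f, of i]
    by (auto simp: hRb_form lext_add_UNIV lext_smul comp_apply smul_add)
  fix b assume "b \<in> SS e"
  then have fb: "fperm b" by (simp add: SS_fperm)
  have "a \<circ> sp i = b \<longleftrightarrow> b \<circ> sp i = a" by auto
  then show "hRb i a b = hRb i b a"
    by (cases "a = b") (auto simp: hRb_form pointwise smul_def bas_def)
next
  fix i a b assume a: "1 \<le> i" "i < e" "a \<in> SS e"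
  show "conjK (hRb i a b) = hRb i a b"
    by (auto simp: hRb_form pointwise smul_def bas_def)
next
  fix i j a assume a: "1 \<le> i" "Suc i < j" "j < e" "a \<in> SS e"
  have "a (sp i j) = a j" "a (sp i (Suc j)) = a (Suc j)" "a (sp j i) = a i" "a (sp j (Suc i)) = a (Suc i)"
    using a by (auto simp: sp_def)
  then show "lext (hRb i) (hRb j a) = lext (hRb j) (hRb i a)"
    using sp_far[OF a(2), of a]
    by (auto simp: hRb_form lext_add_UNIV lext_smul comp_apply smul_add add_ac)
next
  fix i a assume a: "1 \<le> i" "Suc i < e" "a \<in> SS e"
  then have f: "fperm a" by (simp add: SS_fperm)
  have v: "sp i (Suc (Suc i)) = Suc (Suc i)" "sp (Suc i) i = i" by (auto simp: sp_def)
  have d: "a i \<noteq> a (Suc i)" "a i \<noteq> a (Suc (Suc i))" "a (Suc i) \<noteq> a (Suc (Suc i))"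
    using fperm_inj[OF f] by auto
  show "lext (hRb i) (lext (hRb (Suc i)) (hRb i a)) = lext (hRb (Suc i)) (lext (hRb i) (hRb (Suc i) a))"
    using d sp_braid[of a i]
    by (cases "a i < a (Suc i)"; cases "a i < a (Suc (Suc i))"; cases "a (Suc i) < a (Suc (Suc i))")
      (simp_all add: hRb_form lext_add_UNIV lext_smul comp_apply smul_add v add_ac)
qed

interpretation reg: hrep hRb "SS e" e for e
  by (rule hrep_regular)

section \<open>The Hecke algebra\<close>

abbreviation TT :: "nat \<Rightarrow> hk" where "TT i \<equiv> bas (sp i)"

text \<open>\<open>Tpm False i\<close> is \<open>T_i\<close> and \<open>Tpm True i\<close> is its inverse.\<close>
definition Tpm :: "bool \<Rightarrow> nat \<Rightarrow> hk" where
  "Tpm b i = (if b then TT i - smul qc (bas id) else TT i)"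

text \<open>H_infinity is the union of the H_e, so identities between finitely many elements are
  inherited from one finite level.\<close>

lemma FS_PP_bound: "x \<in> FS PP \<Longrightarrow> \<exists>e. x \<in> FS (SS e)"
proof (induction rule: FS_induct)
  case (step c w y)
  obtain e1 where "w \<in> SS e1" using step fperm_bound by auto
  moreover obtain e2 where "y \<in> FS (SS e2)" using step by auto
  ultimately have "w \<in> SS (max e1 e2)" "y \<in> FS (SS (max e1 e2))"
    using SS_mono[of e1 "max e1 e2"] SS_mono[of e2 "max e1 e2"] FS_mono by fastforce+
  then have "smul c (bas w) + y \<in> FS (SS (max e1 e2))" by simp
  then show ?case by blast
qed auto

lemma FS_PP_common:
  assumes "x \<in> FS PP" "y \<in> FS PP" "z \<in> FS PP"
  obtains e where "x \<in> FS (SS e)" "y \<in> FS (SS e)" "z \<in> FS (SS e)"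
proof -
  obtain a b c where "x \<in> FS (SS a)" "y \<in> FS (SS b)" "z \<in> FS (SS c)"
    using assms FS_PP_bound by meson
  then have "x \<in> FS (SS (max a (max b c)))" "y \<in> FS (SS (max a (max b c)))" "z \<in> FS (SS (max a (max b c)))"
    by (auto elim!: FS_mono intro!: SS_mono)
  then show ?thesis by (rule that)
qed

lemma FS_SS_PP: "x \<in> FS (SS e) \<Longrightarrow> x \<in> FS PP"
  by (rule FS_mono[OF _ SS_PP])

lemma Hmul_SS [simp]: "x \<in> FS (SS e) \<Longrightarrow> y \<in> FS (SS e) \<Longrightarrow> Hmul x y \<in> FS (SS e)"
  by (rule reg.Hmul_in)

lemma Hmul_PP [simp]: "x \<in> FS PP \<Longrightarrow> y \<in> FS PP \<Longrightarrow> Hmul x y \<in> FS PP"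
  by (rule FS_PP_common[of x y y]) (auto intro: FS_SS_PP[OF Hmul_SS])

lemma Hmul_assoc:
  "x \<in> FS PP \<Longrightarrow> y \<in> FS PP \<Longrightarrow> z \<in> FS PP \<Longrightarrow> Hmul (Hmul x y) z = Hmul x (Hmul y z)"
  by (rule FS_PP_common[of x y z]) (auto simp: Hmul_ract reg.ract_assoc)

lemma Hmul_lin_right: "x \<in> FS PP \<Longrightarrow> lin PP PP (\<lambda>y. Hmul x y)"
proof -
  assume x: "x \<in> FS PP"
  have "hT w x \<in> FS PP" if "w \<in> PP" for w
    using Hmul_PP[of x "bas w"] x that by (simp add: Hmul_def)
  then show ?thesis unfolding Hmul_def by (intro lin_lext) auto
qed

lemma hRb_PP: "1 \<le> i \<Longrightarrow> w \<in> PP \<Longrightarrow> hRb i w \<in> FS PP"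
  by (auto simp: hRb_form)

lemma hT_lin: "\<forall>i\<in>set is. 1 \<le> i \<Longrightarrow> lin PP PP (fold (\<lambda>i. lext (hRb i)) is)"
proof (induction "is" rule: rev_induct)
  case Nil
  show ?case using lin_id[of PP PP] by (simp add: id_def)
next
  case (snoc i "is")
  then have "lin PP PP (\<lambda>x. lext (hRb i) (fold (\<lambda>i. lext (hRb i)) is x))"
    by (intro lin_comp[OF snoc.IH lin_lext] hRb_PP) auto
  then show ?case by (simp add: comp_def id_apply)
qed

lemma Hmul_lin_left: "y \<in> FS PP \<Longrightarrow> lin PP PP (\<lambda>x. Hmul x y)"
  unfolding Hmul_def hT_def
  by (rule lin_lext_param[where C = PP]) (auto intro!: hT_lin dest!: reduced_rword simp: reduced_def)

lemma Hmul_add_right: "x \<in> FS PP \<Longrightarrow> y \<in> FS PP \<Longrightarrow> z \<in> FS PP \<Longrightarrow> Hmul x (y + z) = Hmul x y + Hmul x z"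
  and Hmul_diff_right: "x \<in> FS PP \<Longrightarrow> y \<in> FS PP \<Longrightarrow> z \<in> FS PP \<Longrightarrow> Hmul x (y - z) = Hmul x y - Hmul x z"
  and Hmul_smul_right: "x \<in> FS PP \<Longrightarrow> y \<in> FS PP \<Longrightarrow> Hmul x (smul c y) = smul c (Hmul x y)"
  using linD(2,3)[OF Hmul_lin_right] lin_diff[OF Hmul_lin_right] by auto

lemma Hmul_add_left: "x \<in> FS PP \<Longrightarrow> y \<in> FS PP \<Longrightarrow> z \<in> FS PP \<Longrightarrow> Hmul (x + y) z = Hmul x z + Hmul y z"
  and Hmul_diff_left: "x \<in> FS PP \<Longrightarrow> y \<in> FS PP \<Longrightarrow> z \<in> FS PP \<Longrightarrow> Hmul (x - y) z = Hmul x z - Hmul y z"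
  and Hmul_smul_left: "x \<in> FS PP \<Longrightarrow> y \<in> FS PP \<Longrightarrow> Hmul (smul c x) y = smul c (Hmul x y)"
  using linD(2,3)[OF Hmul_lin_left] lin_diff[OF Hmul_lin_left] by auto

lemmas Hmul_distrib = Hmul_add_right Hmul_diff_right Hmul_smul_right
  Hmul_add_left Hmul_diff_left Hmul_smul_left

lemma Hmul_id_right [simp]: "Hmul x (bas id) = x"
  by (simp add: Hmul_ract)

lemma Hmul_TT: "1 \<le> i \<Longrightarrow> Hmul x (TT i) = lext (hRb i) x"
  by (simp add: Hmul_ract reg.ract_sp)

lemma bas_reduced: "reduced w is \<Longrightarrow> fold (\<lambda>i. lext (hRb i)) is (bas id) = bas w"
proof (induction "is" arbitrary: w rule: rev_induct)
  case Nil
  then show ?case by (simp add: reduced_def id_apply)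
next
  case (snoc i "is")
  note r = reduced_snocD[OF snoc.prems]
  have "(w \<circ> sp i) i < (w \<circ> sp i) (Suc i)" using r by (simp add: comp_apply)
  then show ?case using snoc.IH[OF r(1)] by (simp add: comp_apply[of "lext _"] hRb_asc)
qed

lemma Hmul_id_left [simp]: "x \<in> FS PP \<Longrightarrow> Hmul (bas id) x = x"
proof (rule lin_eqI[OF Hmul_lin_right lin_id[OF order_refl]])
  fix w assume "w \<in> PP"
  then show "Hmul (bas id) (bas w) = bas w"
    using bas_reduced[OF reduced_rword, of w] by (simp add: Hmul_def hT_def)
qed simp_all

section \<open>Relations between generators and their inverses\<close>

lemma Tpm_PP [simp]: "1 \<le> i \<Longrightarrow> Tpm b i \<in> FS PP"
  by (auto simp: Tpm_def)

lemma Tpm_SS [simp]: "1 \<le> i \<Longrightarrow> i < e \<Longrightarrow> Tpm b i \<in> FS (SS e)"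
  by (auto simp: Tpm_def)

lemma TT_quad: "1 \<le> i \<Longrightarrow> Hmul (TT i) (TT i) = bas id + smul qc (TT i)"
  using reg.op_quad[of i "Suc i" "bas id"] hRb_asc[of id i] by (simp add: Hmul_TT id_apply[of i] id_apply[of "Suc i"])

lemma TT_far: "1 \<le> i \<Longrightarrow> 1 \<le> j \<Longrightarrow> Suc i < j \<or> Suc j < i \<Longrightarrow> Hmul (TT i) (TT j) = Hmul (TT j) (TT i)"
  using reg.op_far[of i j "Suc j" "bas id"] reg.op_far[of j i "Suc i" "bas id"] hRb_asc[of id i] hRb_asc[of id j]
  by (auto simp add: Hmul_TT id_apply)

lemma TT_braid: "1 \<le> i \<Longrightarrow>
    Hmul (TT i) (Hmul (TT (Suc i)) (TT i)) = Hmul (TT (Suc i)) (Hmul (TT i) (TT (Suc i)))"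
  using reg.op_braid[of i "Suc (Suc i)" "bas id"] hRb_asc[of id i] hRb_asc[of id "Suc i"]
  by (simp add: Hmul_assoc[symmetric]) (simp add: Hmul_TT id_apply)

lemma Tpm_far:
  assumes "1 \<le> i" "1 \<le> j" "Suc i < j \<or> Suc j < i"
  shows "Hmul (TT i) (Tpm b j) = Hmul (Tpm b j) (TT i)"
  using assms TT_far[OF assms] by (auto simp: Tpm_def Hmul_distrib)

lemma Tpm_inv: "1 \<le> i \<Longrightarrow> Hmul (Tpm True i) (TT i) = bas id"
  by (simp add: Tpm_def Hmul_distrib TT_quad)

text \<open>Three of the four sign patterns are consequences of the braid relation. The excluded one
  would read T_i T_{i+1}^{-1} T_i = T_{i+1} T_i^{-1} T_{i+1}; its two sides differ by (q - q^{-1})^2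
  (T_i - T_{i+1}) up to sign.\<close>

lemma Tpm_braid:
  assumes i: "1 \<le> i" and b: "b \<longrightarrow> b'"
  shows "Hmul (TT i) (Hmul (Tpm b (Suc i)) (Tpm b' i)) = Hmul (Tpm b' (Suc i)) (Hmul (Tpm b i) (TT (Suc i)))"
  using i b TT_braid[OF i] TT_quad[OF i] TT_quad[of "Suc i"]
  by (cases b; cases b') (simp_all add: Tpm_def Hmul_distrib smul_diff smul_add)

lemma word_commute:
  assumes "1 \<le> p" "\<forall>i\<in>set is. 1 \<le> i \<and> (Suc i < p \<or> Suc p < i)"
  shows "fold (\<lambda>i. lext (hRb i)) is (bas id) \<in> FS PP
    \<and> Hmul (TT p) (fold (\<lambda>i. lext (hRb i)) is (bas id)) = Hmul (fold (\<lambda>i. lext (hRb i)) is (bas id)) (TT p)"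
  using assms(2)
proof (induction "is" rule: rev_induct)
  case Nil
  then show ?case using assms(1) by (simp add: id_apply[of "bas id"])
next
  case (snoc i "is")
  let ?y = "fold (\<lambda>i. lext (hRb i)) is (bas id)"
  have i: "1 \<le> i" "Suc i < p \<or> Suc p < i" using snoc by auto
  have y: "?y \<in> FS PP" "Hmul (TT p) ?y = Hmul ?y (TT p)" using snoc by auto
  have s: "fold (\<lambda>i. lext (hRb i)) (is @ [i]) (bas id) = Hmul ?y (TT i)"
    using i by (simp add: comp_apply Hmul_TT)
  have "Hmul (TT p) (Hmul ?y (TT i)) = Hmul (Hmul ?y (TT p)) (TT i)"
    using y i assms(1) Hmul_assoc[of "TT p" ?y "TT i"] by simp
  also have "\<dots> = Hmul (Hmul ?y (TT i)) (TT p)"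
    using y i assms(1) TT_far[of p i] Hmul_assoc[of ?y "TT p" "TT i"] Hmul_assoc[of ?y "TT i" "TT p"] by auto
  finally show ?case unfolding s using y i by simp
qed

lemma TT_commute_SS: "w \<in> SS l \<Longrightarrow> l < p \<Longrightarrow> Hmul (TT p) (bas w) = Hmul (bas w) (TT p)"
proof -
  assume a: "w \<in> SS l" "l < p"
  have r: "reduced w (rword w)" using a by (simp add: reduced_rword SS_fperm)
  then have "set (rword w) \<subseteq> {1..<l}" using a by (intro reduced_letters)
  then show ?thesis
    using word_commute[of p "rword w"] bas_reduced[OF r] a by force
qed

lemma TT_commute_shift: "fperm w \<Longrightarrow> 1 \<le> p \<Longrightarrow> p < e \<Longrightarrow> 
   Hmul (TT p) (bas (shiftp e w)) = Hmul (bas (shiftp e w)) (TT p)"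
proof -
  assume a: "fperm w" "1 \<le> p" "p < e"
  have r: "reduced w (rword w)" using a by (simp add: reduced_rword)
  then show ?thesis
    using word_commute[of p "map (\<lambda>i. i + e) (rword w)"] bas_reduced[OF reduced_shiftp[OF r, of e]] a
    by (force simp: reduced_def)
qed

lemma hshift_lin: "lin PP PP (hshift e)"
  unfolding hshift_def
  by (rule lin_lext) (simp add: reduced_fperm[OF reduced_shiftp[OF reduced_rword]])

lemma hshift_commute: "s \<in> FS PP \<Longrightarrow> 1 \<le> p \<Longrightarrow> p < e \<Longrightarrow> 
   Hmul (TT p) (hshift e s) = Hmul (hshift e s) (TT p)"
  by (rule lin_eqI[OF lin_comp[OF hshift_lin Hmul_lin_right] lin_comp[OF hshift_lin Hmul_lin_left]])
    (auto simp: hshift_def TT_commute_shift)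

lemma hshift_0: "s \<in> FS PP \<Longrightarrow> hshift 0 s = s"
  by (rule lin_eqI[OF hshift_lin lin_id[OF order_refl]]) (auto simp: hshift_def shiftp_0)

section \<open>The tensor space representation\<close>

definition wds :: "nat \<Rightarrow> nat \<Rightarrow> nat \<Rightarrow> nat list set" where
  "wds m n e = {I. length I = e \<and> set I \<subseteq> {1..m+n}}"

lemma Vten_FS: "Vten m n e = FS (wds m n e)"
  by (auto simp: Vten_def FS_def wds_def)

lemma finite_wds: "finite (wds m n e)"
  unfolding wds_def using finite_lists_length_eq[of "{1..m+n}" e] by (simp add: conj_commute)

definition sg :: "nat \<Rightarrow> nat \<Rightarrow> nat \<Rightarrow> K" where
  "sg m a b = (if m < a \<and> m < b then -1 else 1)"

text \<open>The eigenvalue of a generator on two equal letters: q for an even letter and -q^{-1} for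
  an odd one, the two roots of the quadratic relation.\<close>

definition ev :: "nat \<Rightarrow> nat \<Rightarrow> K" where
  "ev m a = (if m < a then -1 else 1) * qi m a"

lemma sg_sg [simp]: "sg m a b * sg m a b = 1" "sg m a b * (sg m a b * x) = x"
  by (auto simp: sg_def)

lemma sg_sym: "sg m a b = sg m b a"
  by (auto simp: sg_def)

lemma ev_quad: "ev m a * ev m a = 1 + qc * ev m a"
  by (auto simp: ev_def qi_def field_simps)

lemma vRb_split:
  assumes "p = Suc (length us)"
  shows "vRb m p (us @ a # b # vs) =
    (if b < a then smul (sg m a b) (bas (us @ b # a # vs))
     else if a = b then smul (ev m a) (bas (us @ a # b # vs))
     else smul (sg m a b) (bas (us @ b # a # vs)) + smul qc (bas (us @ a # b # vs)))"
  using assms by (auto simp: vRb_def Let_def sg_def ev_def nth_append list_update_append)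

lemma word_split:
  assumes "1 \<le> p" "p < length I"
  shows "\<exists>us a b vs. I = us @ a # b # vs \<and> p = Suc (length us)"
proof -
  have "I = take (p - 1) I @ I ! (p - 1) # I ! p # drop (Suc p) I"
    using assms id_take_nth_drop[of "p - 1" I] Cons_nth_drop_Suc[of p I] by simp
  moreover have "p = Suc (length (take (p - 1) I))" using assms by simp
  ultimately show ?thesis by blast
qed

lemma word_split3:
  assumes "1 \<le> p" "Suc p < length I"
  shows "\<exists>us a b c vs. I = us @ a # b # c # vs \<and> p = Suc (length us)"
proof -
  obtain us a b vs where *: "I = us @ a # b # vs" "p = Suc (length us)"
    using word_split[of p I] assms Suc_lessD less_trans by blast
  then obtain c vs' where "vs = c # vs'" using assms by (cases vs) auto
  then show ?thesis using * by blast
qed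

lemma word_split_far:
  assumes "1 \<le> p" "Suc p < r" "r < length I"
  shows "\<exists>us a b vs c d zs. I = us @ a # b # vs @ c # d # zs \<and> p = Suc (length us)
    \<and> r = Suc (length us + 2 + length vs)"
proof -
  obtain us a b vs where *: "I = us @ a # b # vs" "p = Suc (length us)"
    using word_split[of p I] assms Suc_lessD less_trans by blast
  then obtain us' c d zs where v: "vs = us' @ c # d # zs" "r - length us - 2 = Suc (length us')"
    using word_split[of "r - length us - 2" vs] assms by force
  have "I = us @ a # b # us' @ c # d # zs" "r = Suc (length us + 2 + length us')"
    using * v assms by auto
  then show ?thesis using *(2) by blast
qed

text \<open>Two different letters are interchanged with the same coefficient \<open>sg\<close> in
  both directions and the diagonal entries are real, hence the symmetry. The relations are local and
  are checked on the two, three or four letters involved, for all their orders including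
  ties.\<close>

lemma hrep_tensor: "hrep (vRb m) (wds m n e) e"
proof
  fix i I assume i: "1 \<le> i" "i < e" and I: "I \<in> wds m n e"
  then obtain us a b vs where s: "I = us @ a # b # vs" "i = Suc (length us)"
    using word_split[of i I] unfolding wds_def by blast
  show "vRb m i I \<in> FS (wds m n e)"
    using I unfolding s(1) vRb_split[OF s(2)] by (auto simp: wds_def)
  show "lext (vRb m i) (vRb m i I) = bas I + smul qc (vRb m i I)"
    unfolding s(1) vRb_split[OF s(2)]
    by (auto simp: vRb_split[OF s(2)] lext_add_UNIV lext_smul sg_sym[of m b a] ev_quad smul_add
        kv.scale_left_distrib mult.commute)
  show "conjK (vRb m i I J) = vRb m i I J" for J
    unfolding s(1) vRb_split[OF s(2)]
    by (auto simp: pointwise smul_def bas_def sg_def ev_def qi_def)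
  fix J assume "J \<in> wds m n e"
  then obtain us' a' b' vs' where s': "J = us' @ a' # b' # vs'" "i = Suc (length us')"
    using word_split[of i J] i unfolding wds_def by blast
  have "length us' = length us" using s s' by simp
  then show "vRb m i I J = vRb m i J I"
    unfolding s(1) s'(1) vRb_split[OF s(2)] vRb_split[OF s'(2)]
    by (auto simp: pointwise smul_def bas_def sg_sym)
next
  fix i j I assume i: "1 \<le> i" "Suc i < j" "j < e" and "I \<in> wds m n e"
  then obtain us a b vs c d zs where s: "I = us @ a # b # vs @ c # d # zs" "i = Suc (length us)"
      "j = Suc (length us + 2 + length vs)"
    using word_split_far[of i j I] unfolding wds_def by blast
  have v: "vRb m j (us @ a # b # vs @ c # d # zs) =
    (if d < c then smul (sg m c d) (bas (us @ a # b # vs @ d # c # zs))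
     else if c = d then smul (ev m c) (bas (us @ a # b # vs @ c # d # zs))
     else smul (sg m c d) (bas (us @ a # b # vs @ d # c # zs)) + smul qc (bas (us @ a # b # vs @ c # d # zs)))"
    for a b c d
    using vRb_split[of j "us @ a # b # vs" m c d zs] s by simp
  show "lext (vRb m i) (vRb m j I) = lext (vRb m j) (vRb m i I)"
    unfolding s(1)
    by (auto simp: v vRb_split[OF s(2)] lext_add_UNIV lext_smul smul_add mult.commute add_ac)
next
  fix i I assume i: "1 \<le> i" "Suc i < e" and "I \<in> wds m n e"
  then obtain us a b c vs where s: "I = us @ a # b # c # vs" "i = Suc (length us)"
    using word_split3[of i I] unfolding wds_def by blast
  have v: "vRb m (Suc i) (us @ a # b # c # vs) =
    (if c < b then smul (sg m b c) (bas (us @ a # c # b # vs))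
     else if b = c then smul (ev m b) (bas (us @ a # b # c # vs))
     else smul (sg m b c) (bas (us @ a # c # b # vs)) + smul qc (bas (us @ a # b # c # vs)))"
    for a b c
    using vRb_split[of "Suc i" "us @ [a]" m b c vs] s by simp
  \<comment> \<open>When letters coincide, two equal eigenvalues meet inside a longer product; this
    form of the quadratic relation reduces them there.\<close>
  have eq: "ev m x * (ev m x * y) = y + qc * (ev m x * y)" for x y
    using arg_cong[OF ev_quad[of m x], of "\<lambda>z. z * y"] by (simp add: algebra_simps)
  have sg: "sg m b a = sg m a b" "sg m c a = sg m a c" "sg m c b = sg m b c" by (auto simp: sg_sym)
  show "lext (vRb m i) (lext (vRb m (Suc i)) (vRb m i I)) = lext (vRb m (Suc i)) (lext (vRb m i) (vRb m (Suc i) I))"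
    unfolding s(1)
    by (cases a b rule: linorder_cases; cases b c rule: linorder_cases; cases a c rule: linorder_cases)
      (simp_all add: v vRb_split[OF s(2)] lext_add_UNIV lext_smul smul_add mult_ac add_ac sg
        ev_quad eq kv.scale_left_distrib)
qed

interpretation ten: hrep "vRb m" "wds m n e" e for m n e
  by (rule hrep_tensor)

section \<open>Operators on tensors and the defining relations\<close>

lemma lin_in_subspace:
  assumes "lin A C F" "kv.subspace U" "\<And>a. a \<in> A \<Longrightarrow> F (bas a) \<in> U" "x \<in> FS A"
  shows "F x \<in> U"
  using assms(4)
proof (induction rule: FS_induct)
  case zero
  show ?case using lin_zero[OF assms(1)] kv.subspace_0[OF assms(2)] by simp
next
  case (step c a y)
  have "F (smul c (bas a) + y) = smul c (F (bas a)) + F y"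
    using step linD(2,3)[OF assms(1)] by simp
  then show ?case using step assms(3) kv.subspace_add[OF assms(2)] kv.subspace_scale[OF assms(2)] by simp
qed

lemma tens_bas: "tens (bas I) (bas w) = bas (I, w)"
  by (auto simp: tens_def bas_def fun_eq_iff)

lemma tens_in [simp]: "v \<in> FS A \<Longrightarrow> x \<in> FS B \<Longrightarrow> tens v x \<in> FS (A \<times> B)"
proof -
  assume a: "v \<in> FS A" "x \<in> FS B"
  have "finite ({I. v I \<noteq> 0} \<times> {w. x w \<noteq> 0})" using a by (auto intro: FS_finite)
  then have "finite {p. tens v x p \<noteq> 0}" by (rule rev_finite_subset) (auto simp: tens_def)
  then show ?thesis using a by (auto simp: FS_def fsupp_def tens_def)
qed

lemma tens_lin_right: "v \<in> FS A \<Longrightarrow> lin B (A \<times> B) (\<lambda>x. tens v x)"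
  by (auto simp: lin_def) (auto simp: tens_def fun_eq_iff pointwise smul_def algebra_simps)

lemma tens_lin_left: "x \<in> FS B \<Longrightarrow> lin A (A \<times> B) (\<lambda>v. tens v x)"
  by (auto simp: lin_def) (auto simp: tens_def fun_eq_iff pointwise smul_def algebra_simps)

lemma tens_add_right: "tens v (x + y) = tens v x + tens v y"
  and tens_diff_right: "tens v (x - y) = tens v x - tens v y"
  and tens_smul_right: "tens v (smul c x) = smul c (tens v x)"
  and tens_smul_left: "tens (smul c v) x = smul c (tens v x)"
  and tens_add_left: "tens (u + v) x = tens u x + tens v x"
  and tens_zero [simp]: "tens v 0 = 0" "tens 0 x = 0"
  by (auto simp: tens_def fun_eq_iff pointwise smul_def algebra_simps)

lemma lext_tens_bas:
  assumes "lin PP C F" "\<And>w. w \<in> PP \<Longrightarrow> \<phi> (I, w) = F (bas w)" "x \<in> FS PP"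
  shows "lext \<phi> (tens (bas I) x) = F x"
proof (rule lin_eqI[OF lin_comp[OF tens_lin_right lin_lext] assms(1) _ assms(3)])
  show "bas I \<in> FS {I}" by simp
  show "\<phi> a \<in> FS C" if "a \<in> {I} \<times> PP" for a
    using that assms(2) linD(1)[OF assms(1)] by auto
  show "lext \<phi> (tens (bas I) (bas w)) = F (bas w)" if "w \<in> PP" for w
    using that assms(2) by (simp add: tens_bas)
qed

definition snocv :: "nat \<Rightarrow> (nat list \<Rightarrow> K) \<Rightarrow> nat list \<Rightarrow> K" where
  "snocv r v = lext (\<lambda>J. bas (J @ [r])) v"

definition RM :: "hk \<Rightarrow> bk \<Rightarrow> bk" where
  "RM h = lext (\<lambda>(I, w). tens (bas I) (Hmul (bas w) h))"

text \<open>Left multiplication by g_j(e_r). Lists hold words from right to left, so a new leftmost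
  tensor factor goes to the end of the list, and the shift by the length of \<open>I\<close> turns
  T_1 into the generator of index length + 1.\<close>

definition Gop :: "nat \<Rightarrow> bool \<Rightarrow> bk \<Rightarrow> bk" where
  "Gop r b = lext (\<lambda>(I, w). tens (bas (I @ [r])) (Hmul (Tpm b (Suc (length I))) (bas w)))"

definition App :: "nat \<Rightarrow> bk \<Rightarrow> bk" where
  "App r = lext (\<lambda>(I, w). bas (I @ [r], w))"

definition SL :: "hk \<Rightarrow> bk \<Rightarrow> bk" where
  "SL s = lext (\<lambda>(I, w). tens (bas I) (Hmul (hshift (length I) s) (bas w)))"

lemma RM_tens_bas: "h \<in> FS PP \<Longrightarrow> x \<in> FS PP \<Longrightarrow> RM h (tens (bas I) x) = tens (bas I) (Hmul x h)"
  unfolding RM_def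
  by (rule lext_tens_bas[OF lin_comp[OF Hmul_lin_left tens_lin_right[of _ UNIV]]]) auto

lemma Gop_tens_bas: "x \<in> FS PP \<Longrightarrow>
    Gop r b (tens (bas I) x) = tens (bas (I @ [r])) (Hmul (Tpm b (Suc (length I))) x)"
  unfolding Gop_def
  by (rule lext_tens_bas[OF lin_comp[OF Hmul_lin_right tens_lin_right[of _ UNIV]]]) auto

lemma App_tens_bas: "x \<in> FS PP \<Longrightarrow> App r (tens (bas I) x) = tens (bas (I @ [r])) x"
  unfolding App_def
  by (rule lext_tens_bas[OF tens_lin_right[of _ UNIV]]) (auto simp: tens_bas)

lemma SL_tens_bas: "s \<in> FS PP \<Longrightarrow> x \<in> FS PP \<Longrightarrow>
    SL s (tens (bas I) x) = tens (bas I) (Hmul (hshift (length I) s) x)"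
  unfolding SL_def
  by (rule lext_tens_bas[OF lin_comp[OF Hmul_lin_right tens_lin_right[of _ UNIV]]])
    (auto intro: linD(1)[OF hshift_lin])

lemma RM_lin: "h \<in> FS PP \<Longrightarrow> lin (A \<times> PP) (A \<times> PP) (RM h)"
  unfolding RM_def by (rule lin_lext) auto

lemma RM_lin_SS: "h \<in> FS (SS N) \<Longrightarrow> lin (A \<times> SS N) (A \<times> SS N) (RM h)"
  unfolding RM_def by (rule lin_lext) auto

lemma RM_tens: 
  assumes "v \<in> FS A" "h \<in> FS PP" "x \<in> FS PP"
  shows "RM h (tens v x) = tens v (Hmul x h)"
  by (rule lin_eqI[OF lin_comp[OF tens_lin_left RM_lin] tens_lin_left[of _ PP] _ assms(1)])
    (use assms in \<open>auto simp: RM_tens_bas\<close>)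

lemma RM_RM:
  assumes "h \<in> FS PP" "h' \<in> FS PP" "f \<in> FS (A \<times> PP)"
  shows "RM h (RM h' f) = RM (Hmul h' h) f"
  by (rule lin_eqI[OF lin_comp[OF RM_lin RM_lin] RM_lin _ assms(3)])
    (use assms in \<open>auto simp: RM_tens_bas Hmul_assoc simp flip: tens_bas\<close>)

lemma RM_id: "f \<in> FS (A \<times> PP) \<Longrightarrow> RM (bas id) f = f"
  by (rule lin_eqI[OF RM_lin lin_id[OF order_refl]])
    (auto simp: RM_tens_bas simp flip: tens_bas)

lemma RM_add: 
  assumes "h \<in> FS PP" "h' \<in> FS PP" "f \<in> FS (A \<times> PP)"
  shows "RM (h + h') f = RM h f + RM h' f"
  by (rule lin_eqI[OF RM_lin lin_add[OF RM_lin RM_lin] _ assms(3)])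
    (use assms in \<open>auto simp: RM_tens_bas Hmul_distrib tens_add_right simp flip: tens_bas\<close>)

lemma RM_smul: 
  assumes "h \<in> FS PP" "f \<in> FS (A \<times> PP)"
  shows "RM (smul c h) f = smul c (RM h f)"
  by (rule lin_eqI[OF RM_lin lin_smul[OF RM_lin] _ assms(2)])
    (use assms in \<open>auto simp: RM_tens_bas Hmul_distrib tens_smul_right simp flip: tens_bas\<close>)

lemma RM_zero [simp]: "RM h 0 = 0"
  by (simp add: RM_def)

abbreviation LW :: "nat \<Rightarrow> nat \<Rightarrow> nat list set" where "LW m n \<equiv> {I. set I \<subseteq> {1..m+n}}"

lemma wds_LW: "wds m n a \<subseteq> LW m n"
  by (auto simp: wds_def)

lemma wds_LW_PP: "wds m n a \<times> SS N \<subseteq> LW m n \<times> PP"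
  using SS_PP by (auto simp: wds_def)

lemma Gop_lin: "r \<in> {1..m+n} \<Longrightarrow> lin (LW m n \<times> PP) (LW m n \<times> PP) (Gop r b)"
  unfolding Gop_def by (rule lin_lext) auto

lemma Gop_lin_graded: "r \<in> {1..m+n} \<Longrightarrow> Suc (Suc a) \<le> N \<Longrightarrow>
    lin (wds m n a \<times> SS N) (wds m n (Suc a) \<times> SS N) (Gop r b)"
  unfolding Gop_def by (rule lin_lext) (auto intro!: tens_in Hmul_SS simp: wds_def)

lemma App_lin: "r \<in> {1..m+n} \<Longrightarrow> lin (LW m n \<times> PP) (LW m n \<times> PP) (App r)"
  unfolding App_def by (rule lin_lext) auto

lemma App_lin_graded: "r \<in> {1..m+n} \<Longrightarrow> lin (wds m n a \<times> SS N) (wds m n (Suc a) \<times> SS N) (App r)"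
  unfolding App_def by (rule lin_lext) (auto simp: wds_def)

lemma SL_lin: "s \<in> FS PP \<Longrightarrow> lin (LW m n \<times> PP) (LW m n \<times> PP) (SL s)"
  unfolding SL_def by (rule lin_lext) (auto intro!: tens_in Hmul_PP linD(1)[OF hshift_lin])

lemma snocv_lin: "r \<in> {1..m+n} \<Longrightarrow> lin (wds m n a) (wds m n (Suc a)) (snocv r)"
  unfolding snocv_def by (rule lin_lext) (auto simp: wds_def)

lemma snocv_bas [simp]: "snocv r (bas J) = bas (J @ [r])"
  by (simp add: snocv_def)

lemma Gop_tens:
  assumes "v \<in> FS (wds m n l)" "x \<in> FS PP" "r \<in> {1..m+n}"
  shows "Gop r b (tens v x) = tens (snocv r v) (Hmul (Tpm b (Suc l)) x)"
  by (rule lin_eqI[OF lin_mono[OF lin_comp[OF tens_lin_left Gop_lin] wds_LW order_refl]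
        lin_comp[OF snocv_lin tens_lin_left[of _ PP]] _ assms(1)])
    (use assms in \<open>auto simp: Gop_tens_bas wds_def\<close>)

lemma App_tens:
  assumes "v \<in> FS (wds m n l)" "x \<in> FS PP" "r \<in> {1..m+n}"
  shows "App r (tens v x) = tens (snocv r v) x"
  by (rule lin_eqI[OF lin_mono[OF lin_comp[OF tens_lin_left App_lin] wds_LW order_refl]
        lin_comp[OF snocv_lin tens_lin_left[of _ PP]] _ assms(1)])
    (use assms in \<open>auto simp: App_tens_bas\<close>)

lemma SL_tens:
  assumes "v \<in> FS (wds m n l)" "x \<in> FS PP" "s \<in> FS PP"
  shows "SL s (tens v x) = tens v (Hmul (hshift l s) x)"
  by (rule lin_eqI[OF lin_mono[OF lin_comp[OF tens_lin_left SL_lin] wds_LW order_refl]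
        tens_lin_left[of _ PP] _ assms(1)])
    (use assms linD(1)[OF hshift_lin] in \<open>auto simp: SL_tens_bas wds_def\<close>)

lemma Gop_RM:
  assumes "h \<in> FS PP" "f \<in> FS (LW m n \<times> PP)" "r \<in> {1..m+n}"
  shows "Gop r b (RM h f) = RM h (Gop r b f)"
  by (rule lin_eqI[OF lin_comp[OF RM_lin Gop_lin] lin_comp[OF Gop_lin RM_lin] _ assms(2)])
    (use assms in \<open>auto simp: RM_tens_bas Gop_tens_bas Hmul_assoc simp flip: tens_bas\<close>)

lemma App_RM:
  assumes "h \<in> FS PP" "f \<in> FS (LW m n \<times> PP)" "r \<in> {1..m+n}"
  shows "App r (RM h f) = RM h (App r f)"
  by (rule lin_eqI[OF lin_comp[OF RM_lin App_lin] lin_comp[OF App_lin RM_lin] _ assms(2)])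
    (use assms in \<open>auto simp: RM_tens_bas App_tens_bas simp flip: tens_bas\<close>)

lemma SL_RM:
  assumes "h \<in> FS PP" "f \<in> FS (LW m n \<times> PP)" "s \<in> FS PP"
  shows "SL s (RM h f) = RM h (SL s f)"
  by (rule lin_eqI[OF lin_comp[OF RM_lin SL_lin] lin_comp[OF SL_lin RM_lin] _ assms(2)])
    (use assms linD(1)[OF hshift_lin] in \<open>auto simp: RM_tens_bas SL_tens_bas Hmul_assoc simp flip: tens_bas\<close>)

lemma vRb_in: "1 \<le> p \<Longrightarrow> p < length I \<Longrightarrow> I \<in> LW m n \<Longrightarrow> vRb m p I \<in> FS (wds m n (length I))"
  using ten.gen_in[of p "length I" I m n] by (simp add: wds_def)

lemma vRb_snoc:
  assumes "1 \<le> p" "p < length I"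
  shows "vRb m p (I @ [r]) = snocv r (vRb m p I)"
proof -
  obtain us a b vs where s: "I = us @ a # b # vs" "p = Suc (length us)"
    using word_split[OF assms] by blast
  have "vRb m p (I @ [r]) = vRb m p (us @ a # b # (vs @ [r]))" by (simp add: s)
  then show ?thesis unfolding s(1) vRb_split[OF s(2)]
    by (simp add: snocv_def lext_add_UNIV lext_smul)
qed

section \<open>The relations and the maps that respect them\<close>

lemma Nall_subspace: "kv.subspace (Nall m n)"
  unfolding Nall_def kspan_eq_span by (rule kv.subspace_span)

lemmas N_zero = kv.subspace_0[OF Nall_subspace]
  and N_add = kv.subspace_add[OF Nall_subspace]
  and N_diff = kv.subspace_diff[OF Nall_subspace]
  and N_smul = kv.subspace_scale[OF Nall_subspace]
  and N_sum = kv.subspace_sum[OF Nall_subspace]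

lemma N_rel: "v \<in> FS (wds m n e) \<Longrightarrow> h \<in> FS (SS e) \<Longrightarrow> x \<in> FS PP \<Longrightarrow>
    tens (vact m v h) x - tens v (Hmul h x) \<in> Nall m n"
  unfolding Nall_def kspan_eq_span
  by (rule kv.span_base) (auto simp: Vten_FS Hsub_FS Hinf_FS)

lemma N_gen: "I \<in> LW m n \<Longrightarrow> 1 \<le> p \<Longrightarrow> p < length I \<Longrightarrow> x \<in> FS PP \<Longrightarrow>
    tens (vRb m p I) x - tens (bas I) (Hmul (TT p) x) \<in> Nall m n"
  using N_rel[of "bas I" m n "length I" "TT p" x] ten.ract_sp[of p m "bas I"]
  by (simp add: wds_def vact_ract)

lemma Nall_Bsp: "Nall m n \<subseteq> FS (LW m n \<times> PP)"
  unfolding Nall_def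
proof (rule kspan_sub_FS, clarify)
  fix e v h x assume a: "v \<in> Vten m n e" "h \<in> Hsub e" "x \<in> Hinf"
  then have b: "v \<in> FS (wds m n e)" "h \<in> FS (SS e)" "x \<in> FS PP"
    by (auto simp: Vten_FS Hsub_FS Hinf_FS)
  then have "v \<in> FS (LW m n)" "vact m v h \<in> FS (LW m n)" "h \<in> FS PP"
    using FS_mono[OF _ wds_LW] ten.ract_in[of v m n e h] FS_SS_PP by (auto simp: vact_ract)
  then show "tens (vact m v h) x - tens v (Hmul h x) \<in> FS (LW m n \<times> PP)" using b by simp
qed

text \<open>A test on basis words, single generators and basis elements suffices: linearity extends
  it to all tensors, and a product of generators crosses the tensor sign one letter at a time.
  \<open>U\<close> is arbitrary because it will be \<open>Nall\<close> itself as well as the zero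
  space.\<close>

lemma Nall_pres:
  assumes \<Phi>: "lin (LW m n \<times> PP) C \<Phi>" and U: "kv.subspace U"
    and gen: "\<And>I w p. I \<in> LW m n \<Longrightarrow> fperm w \<Longrightarrow> 1 \<le> p \<Longrightarrow> p < length I \<Longrightarrow>
        \<Phi> (tens (vRb m p I) (bas w)) - \<Phi> (tens (bas I) (Hmul (TT p) (bas w))) \<in> U"
    and f: "f \<in> Nall m n"
  shows "\<Phi> f \<in> U"
proof -
  have T: "TT p \<in> FS PP" if "1 \<le> p" for p using that by simp
  have g1: "\<Phi> (tens (vRb m p I) x) - \<Phi> (tens (bas I) (Hmul (TT p) x)) \<in> U"
    if I: "I \<in> LW m n" "1 \<le> p" "p < length I" and x: "x \<in> FS PP" for I p x
  proof (rule lin_in_subspace[OF _ U _ x])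
    have "vRb m p I \<in> FS (LW m n)" "bas I \<in> FS (LW m n)"
      using I vRb_in[OF I(2,3,1)] FS_mono[OF _ wds_LW] by auto
    then show "lin PP C (\<lambda>x. \<Phi> (tens (vRb m p I) x) - \<Phi> (tens (bas I) (Hmul (TT p) x)))"
      by (intro lin_minus lin_comp[OF tens_lin_right \<Phi>]
          lin_comp[OF lin_comp[OF Hmul_lin_right[OF T[OF I(2)]] tens_lin_right] \<Phi>])
  qed (use gen I in auto)
  have g2: "\<Phi> (tens (lext (vRb m p) v) x) - \<Phi> (tens v (Hmul (TT p) x)) \<in> U"
    if p: "1 \<le> p" "p < e" and v: "v \<in> FS (wds m n e)" and x: "x \<in> FS PP" for e p v x
  proof (rule lin_in_subspace[OF _ U _ v])
    have L: "lin (wds m n e) C (\<lambda>v. \<Phi> (tens v y))" if "y \<in> FS PP" for y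
      using lin_mono[OF lin_comp[OF tens_lin_left[OF that] \<Phi>] wds_LW order_refl] .
    show "lin (wds m n e) C (\<lambda>v. \<Phi> (tens (lext (vRb m p) v) x) - \<Phi> (tens v (Hmul (TT p) x)))"
      by (intro lin_minus lin_comp[OF ten.op_lin[OF p] L[OF x]] L) (use p x in auto)
  qed (use g1 p x in \<open>auto simp: wds_def\<close>)
  have g3: "\<Phi> (tens (fold (\<lambda>i. lext (vRb m i)) is v) x)
      - \<Phi> (tens v (Hmul (fold (\<lambda>i. lext (hRb i)) is (bas id)) x)) \<in> U"
    if "set is \<subseteq> {1..<e}" and v: "v \<in> FS (wds m n e)" and x: "x \<in> FS PP" for e "is" v x
    using that(1) x
  proof (induction "is" arbitrary: x rule: rev_induct)
    case Nil
    then show ?case using kv.subspace_0[OF U] by (simp add: id_apply[of v] id_apply[of "bas id"])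
  next
    case (snoc i "is")
    let ?u = "fold (\<lambda>i. lext (vRb m i)) is v" and ?h = "fold (\<lambda>i. lext (hRb i)) is (bas id)"
    have i: "1 \<le> i" "i < e" and l: "set is \<subseteq> {1..<e}" using snoc.prems by auto
    have u: "?u \<in> FS (wds m n e)" using linD(1)[OF ten.fold_lin[OF l] v] .
    have h: "?h \<in> FS PP" using linD(1)[OF hT_lin, of "is" "bas id"] l by force
    have x: "x \<in> FS PP" "Hmul (TT i) x \<in> FS PP" using snoc.prems i by auto
    \<comment> \<open>The last letter crosses first and is absorbed into \<open>x\<close>; the
      shorter word is then treated with T_i x in place of \<open>x\<close>. This is why
      \<open>x\<close> varies in the induction.\<close>
    have "\<Phi> (tens (lext (vRb m i) ?u) x) - \<Phi> (tens ?u (Hmul (TT i) x))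
        + (\<Phi> (tens ?u (Hmul (TT i) x)) - \<Phi> (tens v (Hmul ?h (Hmul (TT i) x)))) \<in> U"
      by (rule kv.subspace_add[OF U g2[OF i u x(1)] snoc.IH[OF l x(2)]])
    moreover have "Hmul (lext (hRb i) ?h) x = Hmul ?h (Hmul (TT i) x)"
      using Hmul_assoc[OF h T[OF i(1)] x(1)] i by (simp add: Hmul_TT)
    ultimately show ?case by (simp add: comp_apply)
  qed
  have g4: "\<Phi> (tens (vact m v h) x) - \<Phi> (tens v (Hmul h x)) \<in> U"
    if v: "v \<in> FS (wds m n e)" and h: "h \<in> FS (SS e)" and x: "x \<in> FS PP" for e v h x
  proof (rule lin_in_subspace[OF _ U _ h])
    have v': "v \<in> FS (LW m n)" using FS_mono[OF v wds_LW] .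
    have "lin (SS e) C (\<lambda>h. \<Phi> (tens (vact m v h) x))" unfolding vact_ract
      by (rule lin_comp[OF lin_mono[OF ten.ract_lin_right[OF v] order_refl wds_LW]
            lin_comp[OF tens_lin_left[OF x] \<Phi>]])
    moreover have "lin (SS e) C (\<lambda>h. \<Phi> (tens v (Hmul h x)))"
      by (rule lin_comp[OF lin_mono[OF Hmul_lin_left[OF x] SS_PP order_refl]
            lin_comp[OF tens_lin_right[OF v'] \<Phi>]])
    ultimately show "lin (SS e) C (\<lambda>h. \<Phi> (tens (vact m v h) x) - \<Phi> (tens v (Hmul h x)))"
      by (rule lin_minus)
    fix w assume w: "w \<in> SS e"
    then have "reduced w (rword w)" by (simp add: reduced_rword SS_fperm)
    then show "\<Phi> (tens (vact m v (bas w)) x) - \<Phi> (tens v (Hmul (bas w) x)) \<in> U"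
      using g3[OF ten.rword_letters[OF w] v x] bas_reduced by (simp add: vact_def vT_def)
  qed
  obtain F c where F: "finite F" "F \<subseteq> {tens (vact m v h) x - tens v (Hmul h x) | e v h x.
      v \<in> Vten m n e \<and> h \<in> Hsub e \<and> x \<in> Hinf}" and f': "f = (\<Sum>g\<in>F. smul (c g) g)"
    using f unfolding Nall_def kspan_def by blast
  have FN: "F \<subseteq> Nall m n" using F(2) N_rel by (fastforce simp: Vten_FS Hsub_FS Hinf_FS)
  then have FB: "F \<subseteq> FS (LW m n \<times> PP)" using Nall_Bsp by blast
  have "\<Phi> g \<in> U" if gF: "g \<in> F" for g
  proof -
    obtain e v h x where g: "g = tens (vact m v h) x - tens v (Hmul h x)"
      and "v \<in> Vten m n e" "h \<in> Hsub e" "x \<in> Hinf" using F(2) gF by blast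
    then have b: "v \<in> FS (wds m n e)" "h \<in> FS (SS e)" "x \<in> FS PP"
      by (auto simp: Vten_FS Hsub_FS Hinf_FS)
    then have "v \<in> FS (LW m n)" "vact m v h \<in> FS (LW m n)" "h \<in> FS PP"
      using FS_mono[OF _ wds_LW] ten.ract_in[of v m n e h] FS_SS_PP by (auto simp: vact_ract)
    then show ?thesis unfolding g using b g4[OF b] lin_diff[OF \<Phi>] by simp
  qed
  moreover have "\<Phi> f = (\<Sum>g\<in>F. smul (c g) (\<Phi> g))"
    unfolding f' using lin_sum[OF \<Phi>, of F "\<lambda>g. smul (c g) g"] FB linD(3)[OF \<Phi>]
    by (simp add: subset_iff)
  ultimately show ?thesis by (auto intro!: kv.subspace_sum[OF U] kv.subspace_scale[OF U])
qed

lemma RM_N: "h \<in> FS PP \<Longrightarrow> f \<in> Nall m n \<Longrightarrow> RM h f \<in> Nall m n"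
proof (rule Nall_pres[OF RM_lin Nall_subspace])
  fix I w p assume a: "h \<in> FS PP" "I \<in> LW m n" "fperm w" "1 \<le> p" "p < length I"
  show "RM h (tens (vRb m p I) (bas w)) - RM h (tens (bas I) (Hmul (TT p) (bas w))) \<in> Nall m n"
    using a N_gen[OF a(2,4,5), of "Hmul (bas w) h"] RM_tens[OF vRb_in[OF a(4,5,2)]]
    by (simp add: RM_tens_bas Hmul_assoc)
qed

text \<open>The generator of the relation has index below the length of \<open>I\<close> and the new
  factor has index length + 1. They differ by at least two and commute.\<close>

lemma Gop_N: "r \<in> {1..m+n} \<Longrightarrow> f \<in> Nall m n \<Longrightarrow> Gop r b f \<in> Nall m n"
proof (rule Nall_pres[OF Gop_lin Nall_subspace])
  fix I w p assume a: "r \<in> {1..m+n}" "I \<in> LW m n" "fperm w" "1 \<le> p" "p < length I"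
  let ?t = "Tpm b (Suc (length I))"
  have "Hmul (TT p) (Hmul ?t (bas w)) = Hmul ?t (Hmul (TT p) (bas w))"
    using a Tpm_far[of p "Suc (length I)" b] Hmul_assoc[of "TT p" ?t "bas w"] Hmul_assoc[of ?t "TT p" "bas w"]
    by simp
  then show "Gop r b (tens (vRb m p I) (bas w)) - Gop r b (tens (bas I) (Hmul (TT p) (bas w))) \<in> Nall m n"
    using a N_gen[of "I @ [r]" m n p "Hmul ?t (bas w)"] Gop_tens[OF vRb_in[OF a(4,5,2)]]
    by (simp add: Gop_tens_bas vRb_snoc)
qed

lemma App_N: "r \<in> {1..m+n} \<Longrightarrow> f \<in> Nall m n \<Longrightarrow> App r f \<in> Nall m n"
proof (rule Nall_pres[OF App_lin Nall_subspace])
  fix I w p assume a: "r \<in> {1..m+n}" "I \<in> LW m n" "fperm w" "1 \<le> p" "p < length I"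
  then show "App r (tens (vRb m p I) (bas w)) - App r (tens (bas I) (Hmul (TT p) (bas w))) \<in> Nall m n"
    using N_gen[of "I @ [r]" m n p "bas w"] App_tens[OF vRb_in[OF a(4,5,2)]]
    by (simp add: App_tens_bas vRb_snoc)
qed

text \<open>The shift moves \<open>s\<close> to strands beyond the word, where it commutes with
  every generator that permutes letters.\<close>

lemma SL_N: "s \<in> FS PP \<Longrightarrow> f \<in> Nall m n \<Longrightarrow> SL s f \<in> Nall m n"
proof (rule Nall_pres[OF SL_lin Nall_subspace])
  fix I w p assume a: "s \<in> FS PP" "I \<in> LW m n" "fperm w" "1 \<le> p" "p < length I"
  let ?t = "hshift (length I) s"
  have t: "?t \<in> FS PP" using linD(1)[OF hshift_lin] a by blast
  have "Hmul (TT p) (Hmul ?t (bas w)) = Hmul ?t (Hmul (TT p) (bas w))"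
    using a t hshift_commute[OF a(1,4,5)] Hmul_assoc[of "TT p" ?t "bas w"] Hmul_assoc[of ?t "TT p" "bas w"]
    by simp
  then show "SL s (tens (vRb m p I) (bas w)) - SL s (tens (bas I) (Hmul (TT p) (bas w))) \<in> Nall m n"
    using a t N_gen[of I m n p "Hmul ?t (bas w)"] SL_tens[OF vRb_in[OF a(4,5,2)]]
    by (simp add: SL_tens_bas)
qed

section \<open>The operators dual to the letters\<close>

text \<open>The scalar of the product of all f_j over the letters of \<open>I\<close>: one factor
  q_j^{-1} for each letter equal to \<open>j\<close>.\<close>

definition kap :: "nat \<Rightarrow> nat \<Rightarrow> nat list \<Rightarrow> K" where
  "kap m j I = inverse (qi m j) ^ count_list I j"

primrec DR :: "nat \<Rightarrow> nat \<Rightarrow> nat list \<Rightarrow> bk" where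
  "DR m j [] = 0"
| "DR m j (r # zs) = (if r = j then smul (kap m j zs) (bas (rev zs, id)) else 0)
      + smul (sg m j r) (Gop r (r < j) (DR m j zs))"

definition Dw :: "nat \<Rightarrow> nat \<Rightarrow> nat list \<Rightarrow> bk" where
  "Dw m j I = DR m j (rev I)"

definition Dop :: "nat \<Rightarrow> nat \<Rightarrow> bk \<Rightarrow> bk" where
  "Dop m j = lext (\<lambda>(I, s). RM (bas s) (Dw m j I))"

lemma Dw_Nil [simp]: "Dw m j [] = 0"
  by (simp add: Dw_def)

lemma Dw_snoc: "Dw m j (I @ [r]) = (if r = j then smul (kap m j I) (bas (I, id)) else 0)
      + smul (sg m j r) (Gop r (r < j) (Dw m j I))"
  by (simp add: Dw_def kap_def count_list_rev)

lemma Gop_zero [simp]: "Gop r b 0 = 0"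
  by (simp add: Gop_def)

lemma Dw_in: "I \<in> LW m n \<Longrightarrow> Dw m j I \<in> FS (wds m n (length I - 1) \<times> SS (length I))"
proof (induction I rule: rev_induct)
  case (snoc r I)
  have "Gop r (r < j) (Dw m j I) \<in> FS (wds m n (length I) \<times> SS (Suc (length I)))"
  proof (cases "I = []")
    case False
    then have l: "Suc (length I - 1) = length I" by (cases I) auto
    have "Dw m j I \<in> FS (wds m n (length I - 1) \<times> SS (Suc (length I)))"
      by (rule FS_mono[OF snoc.IH]) (use snoc.prems SS_mono[of "length I" "Suc (length I)"] in auto)
    then show ?thesis
      using linD(1)[OF Gop_lin_graded[of r m n "length I - 1" "Suc (length I)"]] snoc.prems l by auto
  qed simp
  moreover have "bas (I, id) \<in> FS (wds m n (length I) \<times> SS (Suc (length I)))"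
    using snoc.prems by (simp add: wds_def)
  ultimately show ?case by (simp add: Dw_snoc)
qed simp

lemma Dw_LW: "I \<in> LW m n \<Longrightarrow> Dw m j I \<in> FS (LW m n \<times> PP)"
  using FS_mono[OF Dw_in wds_LW_PP] .

text \<open>For b \<le> a the generator only swaps the letters, up to this scalar, equal letters
  included. The order a < b will be recovered by means of the quadratic relation.\<close>

definition sc :: "nat \<Rightarrow> nat \<Rightarrow> nat \<Rightarrow> K" where
  "sc m a b = (if a = b then ev m a else sg m a b)"

lemma vRb_le: "p = Suc (length us) \<Longrightarrow> b \<le> a \<Longrightarrow> vRb m p (us @ a # b # vs) = smul (sc m a b) (bas (us @ b # a # vs))"
  using vRb_split[of p us m a b vs] by (auto simp: sc_def)

text \<open>\<open>f\<close> comes from a word that has lost one letter. The crossing of the two new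
  letters is therefore T_l on the left of the Hecke factor, but T_{l+1} on its right for the
  original word. \<open>Tpm_braid\<close> converts one into the other; its condition holds since b
  \<le> a and a < j give b < j. Elements of \<open>SS l\<close> commute with T_{l+1}.\<close>

lemma Gop_Gop_rel:
  assumes "b \<le> a" "a \<in> {1..m+n}" "b \<in> {1..m+n}" "1 \<le> l" "f \<in> FS (wds m n (l - 1) \<times> SS l)"
  shows "smul (sc m a b) (Gop a (a < j) (Gop b (b < j) f))
    - RM (TT (Suc l)) (Gop b (b < j) (Gop a (a < j) f)) \<in> Nall m n"
proof (rule lin_in_subspace[OF _ Nall_subspace _ assms(5)])
  have G: "lin (wds m n (l - 1) \<times> SS l) (LW m n \<times> PP) (\<lambda>f. Gop r b (Gop r' b' f))"
    if "r \<in> {1..m+n}" "r' \<in> {1..m+n}" for r r' b b'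
    by (rule lin_mono[OF lin_comp[OF Gop_lin[OF that(2)] Gop_lin[OF that(1)]] wds_LW_PP order_refl])
  show "lin (wds m n (l - 1) \<times> SS l) (LW m n \<times> PP) (\<lambda>f. smul (sc m a b) (Gop a (a < j) (Gop b (b < j) f))
    - RM (TT (Suc l)) (Gop b (b < j) (Gop a (a < j) f)))"
    by (intro lin_minus lin_smul G assms(2,3) lin_comp[OF G RM_lin]) auto
  fix z assume "z \<in> wds m n (l - 1) \<times> SS l"
  then obtain Z u where z: "z = (Z, u)" "Z \<in> wds m n (l - 1)" "u \<in> SS l" by auto
  have l: "l = Suc (length Z)" using z assms(4) by (simp add: wds_def)
  have u: "bas u \<in> FS PP" using z SS_PP by auto
  let ?A = "Tpm (a < j)" and ?B = "Tpm (b < j)"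
  let ?y = "Hmul (?A (Suc l)) (Hmul (?B l) (bas u))"
  have y: "?y \<in> FS PP" using u assms(4) by simp
  have "Hmul (TT l) ?y = Hmul (Hmul (TT l) (Hmul (?A (Suc l)) (?B l))) (bas u)"
    using u assms(4) by (simp add: Hmul_assoc)
  also have "\<dots> = Hmul (Hmul (?B (Suc l)) (Hmul (?A l) (TT (Suc l)))) (bas u)"
    using Tpm_braid[of l "a < j" "b < j"] assms(1,4) by simp
  also have "\<dots> = Hmul (?B (Suc l)) (Hmul (?A l) (Hmul (bas u) (TT (Suc l))))"
    using u assms(4) TT_commute_SS[OF z(3), of "Suc l"] by (simp add: Hmul_assoc)
  also have "\<dots> = Hmul (Hmul (?B (Suc l)) (Hmul (?A l) (bas u))) (TT (Suc l))"
    using u assms(4) by (simp add: Hmul_assoc)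
  finally have e: "Hmul (TT l) ?y = Hmul (Hmul (?B (Suc l)) (Hmul (?A l) (bas u))) (TT (Suc l))" .
  have I: "Z @ [a, b] \<in> LW m n" "l < length (Z @ [a, b])" using z assms(2,3) l by (auto simp: wds_def)
  have 1: "Gop a (a < j) (Gop b (b < j) (bas z)) = tens (bas (Z @ [b, a])) ?y"
    using u l by (simp add: z(1) Gop_tens_bas flip: tens_bas)
  have 2: "RM (TT (Suc l)) (Gop b (b < j) (Gop a (a < j) (bas z))) = tens (bas (Z @ [a, b])) (Hmul (TT l) ?y)"
    using u e unfolding l by (simp add: z(1) Gop_tens_bas RM_tens_bas flip: tens_bas)
  show "smul (sc m a b) (Gop a (a < j) (Gop b (b < j) (bas z)))
    - RM (TT (Suc l)) (Gop b (b < j) (Gop a (a < j) (bas z))) \<in> Nall m n"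
    using N_gen[OF I(1) assms(4) I(2) y] vRb_le[OF l assms(1), of m "[]"] unfolding 1 2
    by (simp add: tens_smul_left)
qed

lemma kap_snoc: "kap m j (Z @ [a]) = (if a = j then inverse (qi m j) * kap m j Z else kap m j Z)"
  by (simp add: kap_def)

text \<open>The crossing concerns the last two letters. The terms in which one of them is removed
  agree exactly (\<open>head\<close>); the terms in which both survive agree modulo relations by
  \<open>Gop_Gop_rel\<close>.\<close>

lemma Dw_rel_top:
  assumes "b \<le> a" "a \<in> {1..m+n}" "b \<in> {1..m+n}" "Z \<in> LW m n" "p = Suc (length Z)"
  shows "smul (sc m a b) (Dw m j (Z @ [b, a])) - RM (TT p) (Dw m j (Z @ [a, b])) \<in> Nall m n"
proof -
  let ?k = "kap m j Z" and ?f = "Dw m j Z"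
  have f: "?f \<in> FS (LW m n \<times> PP)" using Dw_LW[OF assms(4)] .
  have T: "TT p \<in> FS PP" using assms(5) by simp
  define head where "head c d = (if d = j then smul (kap m j (Z @ [c])) (bas (Z @ [c], id)) else 0)
    + (if c = j then smul (sg m j d * ?k) (tens (bas (Z @ [d])) (Tpm (d < j) p)) else 0)" for c d
  have D: "Dw m j (Z @ [c, d]) = head c d + smul (sg m j d * sg m j c) (Gop d (d < j) (Gop c (c < j) ?f))"
    if "c \<in> {1..m+n}" "d \<in> {1..m+n}" for c d
  proof -
    have L: "lin (LW m n \<times> PP) (LW m n \<times> PP) (Gop d (d < j))" using Gop_lin that by blast
    have 1: "Gop d (d < j) (bas (Z, id)) = tens (bas (Z @ [d])) (Tpm (d < j) p)"
      using assms(5) by (simp add: Gop_tens_bas flip: tens_bas)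
    have 2: "bas (Z, id) \<in> FS (LW m n \<times> PP)" "Gop c (c < j) ?f \<in> FS (LW m n \<times> PP)"
      using assms(4) linD(1)[OF Gop_lin f] that by auto
    have "Dw m j (Z @ [c, d]) = Dw m j ((Z @ [c]) @ [d])" by simp
    also have "\<dots> = head c d + smul (sg m j d * sg m j c) (Gop d (d < j) (Gop c (c < j) ?f))"
      unfolding Dw_snoc head_def using 2 linD(2,3)[OF L] by (simp add: 1 smul_add add.assoc)
    finally show ?thesis .
  qed
  have hin: "head c d \<in> FS (LW m n \<times> PP)" if "c \<in> {1..m+n}" "d \<in> {1..m+n}" for c d
    unfolding head_def using that assms(4,5) by (auto intro!: FS_add FS_smul tens_in)
  have G: "Gop c x (Gop d y ?f) \<in> FS (LW m n \<times> PP)" if "c \<in> {1..m+n}" "d \<in> {1..m+n}" for c d x y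
    using linD(1)[OF Gop_lin linD(1)[OF Gop_lin f]] that by blast
  have h: "smul (sc m a b) (head b a) = RM (TT p) (head a b)"
  proof -
    have L: "lin (LW m n \<times> PP) (LW m n \<times> PP) (RM (TT p))" using RM_lin[OF T] .
    have R0: "RM (TT p) (bas (Z @ [c], id)) = tens (bas (Z @ [c])) (TT p)" for c
      using T by (simp add: RM_tens_bas flip: tens_bas)
    have R1: "RM (TT p) (tens (bas (Z @ [c])) (Tpm x p)) = tens (bas (Z @ [c])) (Hmul (Tpm x p) (TT p))" for c x
      using T assms(5) by (simp add: RM_tens_bas)
    have i: "bas (Z @ [c], id) \<in> FS (LW m n \<times> PP)" "tens (bas (Z @ [c])) (Tpm x p) \<in> FS (LW m n \<times> PP)"
      if "c \<in> {1..m+n}" for c x using that assms(4,5) by (auto intro!: tens_in)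
    consider "b = a" "a = j" | "b < a" "a = j" | "b < a" "b = j" | "a \<noteq> j" "b \<noteq> j"
      using assms(1) by (cases "a = b") auto
    then show ?thesis
    proof cases
      case 1
      \<comment> \<open>Both identities hold for q_j = q with eigenvalue q and for q_j = q^{-1} with
        eigenvalue -q^{-1}. The first one accounts for the scalar q_j^{-1} in f_j.\<close>
      have e1: "ev m j * (inverse (qi m j) * ?k) = sg m j j * ?k"
        "ev m j * (sg m j j * ?k) = inverse (qi m j) * ?k + sg m j j * ?k * qc"
        by (auto simp: ev_def sg_def qi_def field_simps)
      have F: "RM (TT p) (tens (bas (Z @ [j])) (TT p)) = tens (bas (Z @ [j])) (bas id + smul qc (TT p))"
        "tens (bas (Z @ [j])) (TT p) \<in> FS (LW m n \<times> PP)"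
        using R1[of j False] TT_quad[of p] i(2)[of j False] 1 assms(2,5) unfolding Tpm_def by auto
      have "RM (TT p) (head j j) = smul (kap m j (Z @ [j])) (tens (bas (Z @ [j])) (TT p))
          + smul (sg m j j * ?k) (tens (bas (Z @ [j])) (bas id + smul qc (TT p)))"
        unfolding head_def using linD(2,3)[OF L] i(1)[of j] 1 assms(2) R0 F by (simp add: Tpm_def)
      also have "\<dots> = smul (sg m j j * ?k) (bas (Z @ [j], id))
          + smul (inverse (qi m j) * ?k + sg m j j * ?k * qc) (bas (Z @ [j], sp p))"
        by (simp add: kap_snoc tens_add_right tens_smul_right smul_add kv.scale_left_distrib tens_bas add_ac)
      also have "\<dots> = smul (ev m j) (head j j)"
      proof -
        have "smul (ev m j) (head j j) = smul (ev m j * (inverse (qi m j) * ?k)) (bas (Z @ [j], id))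
            + smul (ev m j * (sg m j j * ?k)) (bas (Z @ [j], sp p))"
          by (simp add: head_def Tpm_def kap_snoc tens_bas smul_add)
        then show ?thesis unfolding e1 by simp
      qed
      finally show ?thesis using 1 by (simp add: sc_def)
    next
      \<comment> \<open>The surviving letter is below \<open>j\<close>, so its g_j carries the
        inverse of T_p and cancels the T_p that comes from the right.\<close>
      case 2
      then show ?thesis
        unfolding head_def using linD(3)[OF L i(2)[OF assms(3)]] R1 Tpm_inv[of p] assms(5)
        by (simp add: sc_def kap_snoc tens_bas)
    next
      \<comment> \<open>The surviving letter is above \<open>j\<close>, so its g_j carries T_p
        itself, just what the other side receives from the right.\<close>
      case 3
      then show ?thesis
        unfolding head_def using linD(3)[OF L i(1)[OF assms(2)]] R0 sg_sym[of m b a]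
        by (simp add: sc_def kap_snoc Tpm_def)
    next
      case 4
      then show ?thesis by (simp add: head_def)
    qed
  qed
  have "smul (sc m a b) (Dw m j (Z @ [b, a])) - RM (TT p) (Dw m j (Z @ [a, b]))
    = smul (sg m j a * sg m j b) (smul (sc m a b) (Gop a (a < j) (Gop b (b < j) ?f))
        - RM (TT p) (Gop b (b < j) (Gop a (a < j) ?f)))"
    unfolding D[OF assms(2,3)] D[OF assms(3,2)]
    using linD(2,3)[OF RM_lin[OF T, of "LW m n"]] hin[OF assms(2,3)] G[OF assms(3,2)]
    by (simp add: smul_add smul_diff h mult_ac)
  moreover have "smul (sc m a b) (Gop a (a < j) (Gop b (b < j) ?f))
        - RM (TT p) (Gop b (b < j) (Gop a (a < j) ?f)) \<in> Nall m n"
  proof (cases "Z = []")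
    case True
    then show ?thesis using N_zero by simp
  next
    case False
    then show ?thesis
      using Gop_Gop_rel[OF assms(1-3), of "length Z"] Dw_in[OF assms(4)] assms(5) by (cases Z) auto
  qed
  ultimately show ?thesis using N_smul by simp
qed

text \<open>A crossing below the last letter passes through the recursion. A crossing with the last
  letter is \<open>Dw_rel_top\<close> if r \<le> a, and otherwise follows from the relation of the
  swapped word.\<close>

lemma Dw_rel:
  assumes "I \<in> LW m n" "1 \<le> p" "p < length I"
  shows "lext (Dw m j) (vRb m p I) - RM (TT p) (Dw m j I) \<in> Nall m n"
  using assms
proof (induction I rule: rev_induct)
  case (snoc r I)
  have I: "I \<in> LW m n" and r: "r \<in> {1..m+n}" using snoc.prems by auto
  have T: "TT p \<in> FS PP" using snoc.prems by simp
  show ?case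
  proof (cases "p < length I")
    case True
    \<comment> \<open>A crossing preserves the number of letters equal to \<open>j\<close> and with
      it the scalar \<open>kap\<close>, which is therefore constant on the words that occur.\<close>
    define E where "E = {J \<in> wds m n (length I). count_list J j = count_list I j}"
    obtain us a b vs where s: "I = us @ a # b # vs" "p = Suc (length us)"
      using word_split[OF snoc.prems(2) True] by blast
    have v: "vRb m p I \<in> FS E"
      using I unfolding E_def s(1) vRb_split[OF s(2)] by (auto simp: wds_def)
    have G: "lin (LW m n \<times> PP) (LW m n \<times> PP) (Gop r (r < j))" using r by (rule Gop_lin)
    have D: "lin E (LW m n \<times> PP) (lext (Dw m j))"
      by (rule lin_lext, rule Dw_LW) (auto simp: E_def wds_def)
    have TL: "lin E (LW m n \<times> PP) (\<lambda>v. tens v (bas id))"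
      by (rule lin_mono[OF tens_lin_left[of "bas id" PP "LW m n"]]) (auto simp: E_def wds_def)
    let ?c = "if r = j then kap m j I else 0"
    have "lext (Dw m j) (snocv r (vRb m p I)) =
        smul ?c (tens (vRb m p I) (bas id)) + smul (sg m j r) (Gop r (r < j) (lext (Dw m j) (vRb m p I)))"
    proof (rule lin_eqI[OF lin_comp[OF _ lin_lext] lin_add[OF lin_smul[OF TL] lin_smul[OF lin_comp[OF D G]]] _ v])
      show "lin E (wds m n (Suc (length I))) (snocv r)"
        using lin_mono[OF snocv_lin[OF r, of "length I"]] by (auto simp: E_def)
      show "Dw m j a \<in> FS (LW m n \<times> PP)" if "a \<in> wds m n (Suc (length I))" for a
        by (rule Dw_LW) (use that in \<open>auto simp: wds_def\<close>)
      show "lext (Dw m j) (snocv r (bas J)) = smul ?c (tens (bas J) (bas id))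
          + smul (sg m j r) (Gop r (r < j) (lext (Dw m j) (bas J)))" if "J \<in> E" for J
        using that by (simp add: Dw_snoc E_def kap_def tens_bas)
    qed
    moreover have "RM (TT p) (Dw m j (I @ [r])) = smul ?c (tens (bas I) (TT p))
        + smul (sg m j r) (Gop r (r < j) (RM (TT p) (Dw m j I)))"
    proof -
      have "smul ?c (bas (I, id)) \<in> FS (LW m n \<times> PP)" "bas (I, id) \<in> FS (LW m n \<times> PP)"
         "Gop r (r < j) (Dw m j I) \<in> FS (LW m n \<times> PP)"
        using I linD(1)[OF G Dw_LW[OF I]] by auto
      moreover have "RM (TT p) (bas (I, id)) = tens (bas I) (TT p)"
        using T by (simp add: RM_tens_bas flip: tens_bas)
      ultimately show ?thesis
        using linD(2,3)[OF RM_lin[OF T, of "LW m n"]] Gop_RM[OF T Dw_LW[OF I] r] by (simp add: Dw_snoc)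
    qed
    ultimately have "lext (Dw m j) (vRb m p (I @ [r])) - RM (TT p) (Dw m j (I @ [r]))
      = smul ?c (tens (vRb m p I) (bas id) - tens (bas I) (Hmul (TT p) (bas id)))
        + smul (sg m j r) (Gop r (r < j) (lext (Dw m j) (vRb m p I) - RM (TT p) (Dw m j I)))"
      using vRb_snoc[OF snoc.prems(2) True] lin_diff[OF G linD(1)[OF D v] linD(1)[OF RM_lin[OF T, of "LW m n"] Dw_LW[OF I]]]
      by (simp add: smul_diff)
    moreover have "\<dots> \<in> Nall m n"
      using snoc.IH[OF I snoc.prems(2) True] N_gen[OF I snoc.prems(2) True, of "bas id"]
      by (intro N_add N_smul Gop_N[OF r]) auto
    ultimately show ?thesis by simp
  next
    case False
    then have p: "p = length I" using snoc.prems by simp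
    then obtain Z a where I': "I = Z @ [a]" using snoc.prems by (cases I rule: rev_cases) auto
    have Z: "Z \<in> LW m n" "a \<in> {1..m+n}" "p = Suc (length Z)" using I I' p by auto
    show ?thesis
    proof (cases "r \<le> a")
      case True
      show ?thesis
        using Dw_rel_top[OF True Z(2) r Z(1,3), of j] vRb_le[OF Z(3) True, of m "[]"] I'
        by (simp add: lext_smul)
    next
      case False
      let ?s = "sg m a r" and ?D = "Dw m j (Z @ [a, r])" and ?D' = "Dw m j (Z @ [r, a])"
      \<comment> \<open>The relation of the swapped word. Multiplied by T_p, whose square is 1 + (q
        - q^{-1}) T_p, it yields the wanted relation as a combination of \<open>?X\<close> and its
        product with T_p.\<close>
      let ?X = "smul ?s ?D - RM (TT p) ?D'"
      have X: "?X \<in> Nall m n"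
        using Dw_rel_top[OF _ r Z(2) Z(1,3), of j] False by (simp add: sc_def sg_sym[of m r a])
      have inD: "?D \<in> FS (LW m n \<times> PP)" "?D' \<in> FS (LW m n \<times> PP)" by (rule Dw_LW, use Z r in force)+
      have L: "lin (LW m n \<times> PP) (LW m n \<times> PP) (RM (TT p))" using RM_lin[OF T] .
      have RR: "RM (TT p) (RM (TT p) ?D') = ?D' + smul qc (RM (TT p) ?D')"
        using RM_RM[OF T T inD(2)] TT_quad[OF snoc.prems(2)] RM_add[OF _ _ inD(2), of "bas id" "smul qc (TT p)"]
          RM_smul[OF T inD(2)] RM_id[OF inD(2)] T by simp
      have RX: "RM (TT p) ?X = smul ?s (RM (TT p) ?D) - (?D' + smul qc (RM (TT p) ?D'))"
        using lin_diff[OF L FS_smul[OF inD(1)] linD(1)[OF L inD(2)]] linD(3)[OF L inD(1)] RR by simp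
      have "vRb m p (Z @ [a, r]) = smul ?s (bas (Z @ [r, a])) + smul qc (bas (Z @ [a, r]))"
        using vRb_split[OF Z(3), of m a r "[]"] False by simp
      then have "lext (Dw m j) (vRb m p (I @ [r])) - RM (TT p) (Dw m j (I @ [r]))
        = smul ?s ?D' + smul qc ?D - RM (TT p) ?D"
        using I' by (simp add: lext_add_UNIV lext_smul)
      also have "\<dots> = smul (?s * qc) ?X - smul ?s (RM (TT p) ?X)"
        unfolding RX by (simp add: smul_add smul_diff mult_ac)
      finally show ?thesis using N_diff[OF N_smul[OF X] N_smul[OF RM_N[OF T X]]] by simp
    qed
  qed
qed simp

lemma RM_lin_elem: "f \<in> FS (A \<times> PP) \<Longrightarrow> lin PP (A \<times> PP) (\<lambda>h. RM h f)"
  unfolding lin_def using RM_add RM_smul linD(1)[OF RM_lin] by blast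

lemma Dop_tens_bas:
  assumes "I \<in> LW m n" "x \<in> FS PP"
  shows "Dop m j (tens (bas I) x) = RM x (Dw m j I)"
  unfolding Dop_def by (rule lext_tens_bas[OF RM_lin_elem[OF Dw_LW[OF assms(1)]] _ assms(2)]) simp

lemma Dop_lin: "lin (LW m n \<times> PP) (LW m n \<times> PP) (Dop m j)"
  unfolding Dop_def
proof (rule lin_lext, clarsimp simp del: One_nat_def)
  fix I w assume a: "set I \<subseteq> {1..m+n}" "fperm w"
  show "RM (bas w) (Dw m j I) \<in> FS (LW m n \<times> PP)"
    by (rule linD(1)[OF RM_lin Dw_LW]) (use a in auto)
qed

lemma Dop_lin_graded: "a \<le> N \<Longrightarrow> lin (wds m n a \<times> SS N) (wds m n (a - 1) \<times> SS N) (Dop m j)"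
  unfolding Dop_def
proof (rule lin_lext, clarsimp)
  fix I w assume a: "a \<le> N" "I \<in> wds m n a" "w \<in> SS N"
  have "Dw m j I \<in> FS (wds m n (a - 1) \<times> SS N)"
    by (rule FS_mono[OF Dw_in[of I m n]]) (use a SS_mono[of a N] in \<open>auto simp: wds_def\<close>)
  then show "RM (bas w) (Dw m j I) \<in> FS (wds m n (a - Suc 0) \<times> SS N)"
    using linD(1)[OF RM_lin_SS[of "bas w" N]] a by auto
qed

lemma Dop_RM:
  assumes "h \<in> FS PP" "f \<in> FS (LW m n \<times> PP)"
  shows "Dop m j (RM h f) = RM h (Dop m j f)"
proof (rule lin_eqI[OF lin_comp[OF RM_lin Dop_lin] lin_comp[OF Dop_lin RM_lin] _ assms(2)])
  fix a assume "a \<in> LW m n \<times> PP"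
  then obtain I w where a: "a = (I, w)" "I \<in> LW m n" "bas w \<in> FS PP" by auto
  show "Dop m j (RM h (bas a)) = RM h (Dop m j (bas a))"
    using a assms RM_RM[OF assms(1) a(3) Dw_LW[OF a(2)]] Dop_tens_bas[OF a(2)]
    by (simp add: RM_tens_bas flip: tens_bas)
qed (use assms in auto)

lemma Dop_N:
  assumes "f \<in> Nall m n"
  shows "Dop m j f \<in> Nall m n"
proof (rule Nall_pres[OF Dop_lin Nall_subspace _ assms])
  fix I w p assume a: "I \<in> LW m n" "fperm w" "1 \<le> p" "p < length I"
  have w: "bas w \<in> FS PP" "TT p \<in> FS PP" using a by auto
  have D: "lin (wds m n (length I)) (LW m n \<times> PP) (lext (Dw m j))"
    by (rule lin_lext, rule Dw_LW) (auto simp: wds_def)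
  have v: "vRb m p I \<in> FS (wds m n (length I))" using vRb_in[OF a(3,4,1)] .
  have "Dop m j (tens v (bas w)) = RM (bas w) (lext (Dw m j) v)" if "v \<in> FS (wds m n (length I))" for v
  proof (rule lin_eqI[OF lin_mono[OF lin_comp[OF tens_lin_left Dop_lin] wds_LW order_refl]
        lin_comp[OF D RM_lin] _ that])
    fix J assume "J \<in> wds m n (length I)"
    then have J: "J \<in> LW m n" by (auto simp: wds_def)
    show "Dop m j (tens (bas J) (bas w)) = RM (bas w) (lext (Dw m j) (bas J))"
      using Dop_tens_bas[OF J w(1)] by simp
  qed (use w in auto)
  then have "Dop m j (tens (vRb m p I) (bas w)) - Dop m j (tens (bas I) (Hmul (TT p) (bas w)))
    = RM (bas w) (lext (Dw m j) (vRb m p I)) - RM (bas w) (RM (TT p) (Dw m j I))"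
    using v Dop_tens_bas[OF a(1) Hmul_PP[OF w(2,1)], of j] RM_RM[OF w(1,2) Dw_LW[OF a(1)]] by simp
  also have "\<dots> = RM (bas w) (lext (Dw m j) (vRb m p I) - RM (TT p) (Dw m j I))"
    using lin_diff[OF RM_lin[OF w(1)] linD(1)[OF D v] linD(1)[OF RM_lin[OF w(2)] Dw_LW[OF a(1)]]] by simp
  finally show "Dop m j (tens (vRb m p I) (bas w)) - Dop m j (tens (bas I) (Hmul (TT p) (bas w))) \<in> Nall m n"
    using RM_N[OF w(1) Dw_rel[OF a(1,3,4)]] by simp
qed

section \<open>Comparison with the product of the algebra\<close>

lemma tprod_bas: "tprod (bas p) f = lext (tprodb p) f"
  by (simp add: tprod_def)

lemma tprodb_letter: "fperm s \<Longrightarrow> tprodb ([r], id) (I, s) = bas (I @ [r], s)"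
  by (simp add: tprodb_def hshift_def tens_bas)

lemma tprod_letter: "f \<in> FS (LW m n \<times> PP) \<Longrightarrow> tprod (bas ([r], id)) f = App r f"
  unfolding tprod_bas App_def by (rule lext_cong) (auto simp: tprodb_letter)

lemma tprod_smul: "tprod (smul c a) f = smul c (tprod a f)"
  by (simp add: tprod_def lext_smul)

lemma tprod_fj: "f \<in> FS (LW m n \<times> PP) \<Longrightarrow>
    tprod (fj m j r) f = smul (if j = r then inverse (qi m j) else 1) (App r f)"
  by (simp add: fj_def tprod_smul tprod_letter)

lemma tprod_gj:
  assumes f: "f \<in> FS (LW m n \<times> PP)" and r: "r \<in> {1..m+n}"
  shows "tprod (gj j r) f = Gop r (r < j) f"
proof -
  have T1: "tprodb ([r], sp 1) (I, s) = tens (bas (I @ [r])) (Hmul (TT (Suc (length I))) (bas s))" for I s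
    by (simp add: tprodb_def hshift_def shiftp_sp1)
  have L1: "lext (tprodb ([r], sp 1)) f = Gop r False f"
    unfolding Gop_def by (rule lext_cong[OF f]) (auto simp: T1 Tpm_def simp del: One_nat_def)
  show ?thesis
  proof (cases "r < j")
    case False
    then show ?thesis using L1 by (simp add: gj_def tens_bas tprod_bas)
  next
    case True
    let ?F = "\<lambda>p. lext (tprodb p) f"
    have A: "App r f \<in> FS (LW m n \<times> PP)" "Gop r False f \<in> FS (LW m n \<times> PP)"
      using linD(1)[OF App_lin[OF r] f] linD(1)[OF Gop_lin[OF r] f] .
    have "lin {([r], sp 1), ([r], id)} (LW m n \<times> PP) (lext ?F)"
      by (rule lin_lext) (use A L1 tprod_letter[OF f] in \<open>auto simp: tprod_bas\<close>)
    then have "lext ?F (bas ([r], sp 1) - smul qc (bas ([r], id))) = Gop r False f - smul qc (App r f)"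
      using lin_diff[of _ _ "lext ?F" "bas ([r], sp 1)" "smul qc (bas ([r], id))"] linD(3)[of _ _ "lext ?F" "bas ([r], id)"]
        L1 tprod_letter[OF f] by (simp add: tprod_bas)
    moreover have "gj j r = bas ([r], sp 1) - smul qc (bas ([r], id))"
      using True by (simp add: gj_def tens_diff_right tens_smul_right tens_bas)
    moreover have "Gop r False f - smul qc (App r f) = Gop r True f"
      by (rule lin_eqI[OF lin_minus[OF Gop_lin lin_smul[OF App_lin]] Gop_lin _ f])
        (use r in \<open>auto simp: Gop_tens_bas App_tens_bas Tpm_def Hmul_distrib tens_diff_right tens_smul_right simp flip: tens_bas\<close>)
    ultimately show ?thesis using True by (simp add: tprod_def)
  qed
qed

definition ldterm :: "nat \<Rightarrow> nat \<Rightarrow> nat list \<Rightarrow> (nat \<Rightarrow> nat) \<Rightarrow> nat \<Rightarrow> bk" where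
  "ldterm m j xs s k = foldr tprod
              (map (\<lambda>l. gj j (xs ! (l - 1))) (rev [Suc k..<Suc (length xs)])
               @ map (\<lambda>l. fj m j (xs ! (l - 1))) (rev [1..<k])) (bas ([], s))"

definition ldsign :: "nat \<Rightarrow> nat \<Rightarrow> nat list \<Rightarrow> nat \<Rightarrow> K" where
  "ldsign m j xs k = (if m < j \<and> odd (card {l. k < l \<and> l \<le> length xs \<and> m < xs ! (l - 1)}) then -1 else 1)"

lemma Ldb_alt: "Ldb m j (xs, s) = (\<Sum>k\<in>{1..length xs}. if xs ! (k - 1) = j then smul (ldsign m j xs k) (ldterm m j xs s k) else 0)"
  unfolding Ldb_def ldterm_def ldsign_def by (simp only: prod.case)

lemma fj_fold:
  assumes "xs \<in> LW m n" "fperm s"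
  shows "k \<le> length xs \<Longrightarrow> foldr tprod (map (\<lambda>l. fj m j (xs ! (l - 1))) (rev [1..<Suc k])) (bas ([], s))
    = smul (kap m j (take k xs)) (bas (take k xs, s))"
proof (induction k)
  case 0
  show ?case by (simp add: kap_def id_apply)
next
  case (Suc k)
  have t: "bas (take k xs, s) \<in> FS (LW m n \<times> PP)" using assms set_take_subset[of k xs] by auto
  have i: "foldr tprod (map (\<lambda>l. fj m j (xs ! (l - 1))) (rev [1..<Suc k])) (bas ([], s))
    = smul (kap m j (take k xs)) (bas (take k xs, s))" using Suc by simp
  have "rev [1..<Suc (Suc k)] = Suc k # rev [1..<Suc k]" by simp
  then have "foldr tprod (map (\<lambda>l. fj m j (xs ! (l - 1))) (rev [1..<Suc (Suc k)])) (bas ([], s))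
    = tprod (fj m j (xs ! k)) (smul (kap m j (take k xs)) (bas (take k xs, s)))"
    using i by (simp del: upt_Suc add: comp_apply)
  also have "\<dots> = smul (kap m j (take (Suc k) xs)) (bas (take (Suc k) xs, s))"
    using tprod_fj[of "smul (kap m j (take k xs)) (bas (take k xs, s))" m n j "xs ! k"] t Suc.prems
    by (simp add: App_def lext_smul take_Suc_conv_app_nth kap_snoc mult.commute)
  finally show ?case .
qed

lemma foldr_gj:
  assumes "xs \<in> LW m n" "fperm s" "1 \<le> k" "k \<le> length xs"
  shows "ldterm m j xs s k \<in> FS (LW m n \<times> PP)"
proof -
  have b: "foldr tprod (map (\<lambda>l. fj m j (xs ! (l - 1))) (rev [1..<k])) (bas ([], s)) \<in> FS (LW m n \<times> PP)"
    using fj_fold[OF assms(1,2), of "k - 1" j] assms set_take_subset[of "k - 1" xs] by auto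
  have "foldr tprod (map (\<lambda>l. gj j (xs ! (l - 1))) ls) y \<in> FS (LW m n \<times> PP)"
    if "y \<in> FS (LW m n \<times> PP)" "set ls \<subseteq> {1..length xs}" for ls y
    using that
  proof (induction ls)
    case (Cons a ls)
    then have r: "xs ! (a - 1) \<in> {1..m+n}" using assms(1) nth_mem[of "a - 1" xs] by fastforce
    show ?case using Cons tprod_gj[OF _ r] linD(1)[OF Gop_lin[OF r]] by (simp add: comp_apply del: One_nat_def)
  qed (simp add: id_apply)
  moreover have "set (rev [Suc k..<Suc (length xs)]) \<subseteq> {1..length xs}" using assms by auto
  ultimately show ?thesis unfolding ldterm_def foldr_append comp_apply using b by blast
qed

text \<open>The new letter stands to the left of every earlier position, so e_j^* passes it in each
  of the old summands.\<close>

lemma ldsign_snoc: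
  assumes "1 \<le> k" "k \<le> length xs"
  shows "ldsign m j (xs @ [r]) k = sg m j r * ldsign m j xs k"
proof -
  let ?S = "{l. k < l \<and> l \<le> length xs \<and> m < xs ! (l - 1)}"
  have "finite ?S" by (rule finite_subset[of _ "{..length xs}"]) auto
  moreover have "{l. k < l \<and> l \<le> length (xs @ [r]) \<and> m < (xs @ [r]) ! (l - 1)} =
      (if m < r then insert (Suc (length xs)) ?S else ?S)"
    using assms by (auto simp: nth_append le_Suc_eq split: if_splits)
  ultimately have "card {l. k < l \<and> l \<le> length (xs @ [r]) \<and> m < (xs @ [r]) ! (l - 1)} =
      (if m < r then Suc (card ?S) else card ?S)" by simp
  then show ?thesis by (auto simp: ldsign_def sg_def)
qed

lemma ldterm_snoc:
  assumes "xs \<in> LW m n" "fperm s" "r \<in> {1..m+n}" "1 \<le> k" "k \<le> length xs"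
  shows "ldterm m j (xs @ [r]) s k = Gop r (r < j) (ldterm m j xs s k)"
proof -
  have u: "rev [Suc k..<Suc (length (xs @ [r]))] = Suc (length xs) # rev [Suc k..<Suc (length xs)]"
    using assms by simp
  have e1: "map (\<lambda>l. gj j ((xs @ [r]) ! (l - 1))) (rev [Suc k..<Suc (length (xs @ [r]))])
    = gj j r # map (\<lambda>l. gj j (xs ! (l - 1))) (rev [Suc k..<Suc (length xs)])"
    unfolding u list.map using assms
    by (auto simp del: upt_Suc simp: nth_append intro!: map_cong)
  have e2: "map (\<lambda>l. fj m j ((xs @ [r]) ! (l - 1))) (rev [1..<k]) = map (\<lambda>l. fj m j (xs ! (l - 1))) (rev [1..<k])"
    using assms by (intro map_cong) (auto simp: nth_append)
  have "ldterm m j (xs @ [r]) s k = tprod (gj j r) (ldterm m j xs s k)"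
    unfolding ldterm_def e1 e2 by (simp add: comp_apply)
  then show ?thesis using tprod_gj[OF foldr_gj[OF assms(1,2,4,5)] assms(3)] by simp
qed

text \<open>The summand of the last position is the branch of the recursion that removes this
  letter; every other summand acquires the leftmost factor g_j(e_r).\<close>

lemma Ldb_Dw:
  assumes "xs \<in> LW m n" "fperm s"
  shows "Ldb m j (xs, s) = RM (bas s) (Dw m j xs)"
  using assms(1)
proof (induction xs rule: rev_induct)
  case Nil
  show ?case by (simp add: Ldb_def)
next
  case (snoc r xs)
  have xs: "xs \<in> LW m n" and r: "r \<in> {1..m+n}" using snoc.prems by auto
  have s: "bas s \<in> FS PP" using assms by simp
  let ?t = "\<lambda>xs k. if xs ! (k - 1) = j then smul (ldsign m j xs k) (ldterm m j xs s k) else 0"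
  have top: "?t (xs @ [r]) (Suc (length xs)) = (if r = j then smul (kap m j xs) (bas (xs, s)) else 0)"
  proof -
    have e: "map (\<lambda>l. fj m j ((xs @ [r]) ! (l - 1))) (rev [1..<Suc (length xs)]) = map (\<lambda>l. fj m j (xs ! (l - 1))) (rev [1..<Suc (length xs)])"
      by (intro map_cong) (auto simp: nth_append)
    have "[Suc (Suc (length xs))..<Suc (length (xs @ [r]))] = []" by simp
    then have "ldterm m j (xs @ [r]) s (Suc (length xs)) = smul (kap m j xs) (bas (xs, s))"
      using fj_fold[OF xs assms(2), of "length xs" j] unfolding ldterm_def e
      by (simp only: rev.simps list.map append_Nil take_all order_refl)
    moreover have "{l. Suc (length xs) < l \<and> l \<le> length (xs @ [r]) \<and> m < (xs @ [r]) ! (l - 1)} = {}" by auto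
    then have "ldsign m j (xs @ [r]) (Suc (length xs)) = 1" unfolding ldsign_def by (simp only: card.empty) simp
    ultimately show ?thesis by auto
  qed
  have G: "lin (LW m n \<times> PP) (LW m n \<times> PP) (Gop r (r < j))" using r by (rule Gop_lin)
  have tin: "?t xs k \<in> FS (LW m n \<times> PP)" if "k \<in> {1..length xs}" for k
    using foldr_gj[OF xs assms(2)] that by simp
  have low: "?t (xs @ [r]) k = smul (sg m j r) (Gop r (r < j) (?t xs k))" if "k \<in> {1..length xs}" for k
  proof -
    have "(xs @ [r]) ! (k - 1) = xs ! (k - 1)" using that by (auto simp: nth_append)
    then show ?thesis
      using that ldsign_snoc[of k xs m j r] ldterm_snoc[OF xs assms(2) r, of k j] linD(3)[OF G foldr_gj[OF xs assms(2)]]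
      by simp
  qed
  have "Ldb m j (xs @ [r], s) = (\<Sum>k\<in>{1..Suc (length xs)}. ?t (xs @ [r]) k)"
    by (simp add: Ldb_alt)
  also have "\<dots> = (\<Sum>k\<in>{1..length xs}. ?t (xs @ [r]) k) + ?t (xs @ [r]) (Suc (length xs))"
    by (subst sum.cl_ivl_Suc) simp
  also have "(\<Sum>k\<in>{1..length xs}. ?t (xs @ [r]) k) = (\<Sum>k\<in>{1..length xs}. smul (sg m j r) (Gop r (r < j) (?t xs k)))"
    by (rule sum.cong[OF refl]) (rule low)
  also have "\<dots> = smul (sg m j r) (Gop r (r < j) (Ldb m j (xs, s)))"
    using lin_sum[OF G tin, of "{1..length xs}"] by (simp add: Ldb_alt smul_sum)
  also have "\<dots> + ?t (xs @ [r]) (Suc (length xs)) = RM (bas s) (Dw m j (xs @ [r]))"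
  proof -
    have "bas (xs, id) \<in> FS (LW m n \<times> PP)" "Gop r (r < j) (Dw m j xs) \<in> FS (LW m n \<times> PP)"
      using xs linD(1)[OF G Dw_LW[OF xs]] by auto
    moreover have "RM (bas s) (bas (xs, id)) = bas (xs, s)"
      using s by (simp add: RM_tens_bas flip: tens_bas)
    ultimately show ?thesis
      unfolding top snoc.IH[OF xs] Dw_snoc
      using linD(2,3)[OF RM_lin[OF s, of "LW m n"]] Gop_RM[OF s Dw_LW[OF xs] r] by (auto simp: add.commute)
  qed
  finally show ?case .
qed

lemma lext_Ldb: "f \<in> FS (LW m n \<times> PP) \<Longrightarrow> lext (Ldb m j) f = Dop m j f"
  unfolding Dop_def
proof (erule lext_cong)
  fix a assume "a \<in> LW m n \<times> PP"
  then obtain I w where a: "a = (I, w)" "I \<in> LW m n" "fperm w" by auto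
  show "Ldb m j a = (case a of (I, s) \<Rightarrow> RM (bas s) (Dw m j I))"
    using Ldb_Dw[OF a(2,3)] a(1) by simp
qed

section \<open>The longest permutation\<close>

definition w0 :: "nat \<Rightarrow> nat \<Rightarrow> nat" where
  "w0 e x = (if 1 \<le> x \<and> x \<le> e then Suc e - x else x)"

text \<open>Interpolates between \<open>w0 a\<close> (for \<open>t = Suc a\<close>) and \<open>w0 (Suc a)\<close> (for \<open>t = 1\<close>)
  by moving the value \<open>Suc a\<close> one position to the left at a time.\<close>
definition ux :: "nat \<Rightarrow> nat \<Rightarrow> nat \<Rightarrow> nat" where
  "ux a t x = (if x < t then w0 a x else if x = t then Suc a else if x \<le> Suc a then w0 a (x - 1) else x)"

lemma w0_w0: "w0 e (w0 e x) = x"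
  by (auto simp: w0_def)

lemma w0_SS: "w0 e \<in> SS e"
proof -
  have "bij (w0 e)" by (rule o_bij[of "w0 e"]) (auto simp: fun_eq_iff comp_apply id_apply w0_w0)
  moreover have "finite {i. w0 e i \<noteq> i}" by (rule finite_subset[of _ "{..e}"]) (auto simp: w0_def)
  ultimately show ?thesis by (auto simp: SS_def fperm_def w0_def)
qed

lemma ux_top: "ux a (Suc a) = w0 a"
  by (auto simp: ux_def w0_def fun_eq_iff)

lemma ux_bot: "ux a 1 = w0 (Suc a)"
  by (auto simp: ux_def w0_def fun_eq_iff)

lemma ux_step: "1 \<le> t \<Longrightarrow> t \<le> a \<Longrightarrow> ux a t = ux a (Suc t) \<circ> sp t"
  by (auto simp: ux_def w0_def fun_eq_iff comp_apply sp_def)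

lemma ux_asc: "1 \<le> t \<Longrightarrow> t \<le> a \<Longrightarrow> ux a (Suc t) t < ux a (Suc t) (Suc t)"
  by (auto simp: ux_def w0_def)

lemma ux_SS: "1 \<le> t \<Longrightarrow> t \<le> Suc a \<Longrightarrow> ux a t \<in> SS (Suc a)"
proof (induction "Suc a - t" arbitrary: t)
  case 0
  then have "t = Suc a" by simp
  then show ?case using w0_SS SS_mono[of a "Suc a"] by (auto simp: ux_top)
next
  case (Suc k)
  then have "ux a (Suc t) \<in> SS (Suc a)" by auto
  then show ?case using Suc ux_step[of t a] by auto
qed

lemma plen_ux: "1 \<le> t \<Longrightarrow> t \<le> a \<Longrightarrow> plen (ux a t) = Suc (plen (ux a (Suc t)))"
  using ux_step[of t a] ux_asc[of t a] plen_asc[of "ux a (Suc t)" t]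
    SS_fperm[OF ux_SS[of "Suc t" a]] by simp

lemma plen_ux_w0: "t \<le> a \<Longrightarrow> plen (ux a (Suc t)) + t = plen (w0 (Suc a))"
proof (induction t)
  case 0
  show ?case using ux_bot by simp
next
  case (Suc t)
  then show ?case using plen_ux[of "Suc t" a] by simp
qed

lemma plen_w0_Suc: "plen (w0 (Suc a)) = plen (w0 a) + a"
  using plen_ux_w0[of a a] by (simp add: ux_top)

text \<open>Composition with \<open>w0 d\<close> reverses the positions, so descents at all places
  below \<open>d\<close> turn into ascents, and \<open>no_descent_id\<close> applies.\<close>

lemma no_ascent_w0:
  assumes w: "w \<in> SS d" and desc: "\<And>i. 1 \<le> i \<Longrightarrow> i < d \<Longrightarrow> w (Suc i) < w i"
  shows "w = w0 d"
proof -
  have "w \<circ> w0 d = id"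
  proof (rule no_descent_id)
    show "fperm (w \<circ> w0 d)" using w w0_SS SS_fperm by (intro fperm_comp) blast+
    fix i :: nat assume i: "1 \<le> i"
    consider "i < d" | "i = d" | "d < i" by linarith
    then show "(w \<circ> w0 d) i < (w \<circ> w0 d) (Suc i)"
    proof cases
      case 1
      then show ?thesis using desc[of "d - i"] i by (simp add: comp_apply w0_def Suc_diff_le)
    next
      \<comment> \<open>At the boundary the value to the left is \<open>w 1 \<le> d\<close>, while d
        + 1 is fixed.\<close>
      case 2
      then have "w 1 \<le> d" using SS_le[OF w, of 1] i by simp
      then show ?thesis using 2 i w by (simp add: comp_apply w0_def SS_def)
    next
      case 3
      then show ?thesis using w by (simp add: comp_apply w0_def SS_def)
    qed
  qed
  then have "(w \<circ> w0 d) (w0 d x) = w0 d x" for x by (simp add: id_apply)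
  then show ?thesis by (simp add: comp_apply w0_w0 fun_eq_iff)
qed

text \<open>The matrix of T_i is symmetric, so coefficients transform by the same formula as basis
  vectors.\<close>

lemma hR_coeff:
  assumes "x \<in> FS PP" "1 \<le> i" "fperm w"
  shows "lext (hRb i) x w = x (w \<circ> sp i) + (if w i < w (Suc i) then 0 else qc) * x w"
  using assms(1)
proof (induction rule: FS_induct)
  case zero
  show ?case unfolding lext_zero by (simp add: zero_fun_apply)
next
  case (step c u y)
  have "u \<circ> sp i = w \<longleftrightarrow> u = w \<circ> sp i" by auto
  then have "hRb i u w = bas u (w \<circ> sp i) + (if w i < w (Suc i) then 0 else qc) * bas u w"
    by (auto simp: hRb_form pointwise smul_def bas_def)
  moreover have eq: "lext (hRb i) (smul c (bas u) + y) = smul c (hRb i u) + lext (hRb i) y"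
    using step by (simp add: lext_add[where A = PP] lext_smul)
  ultimately show ?case unfolding eq unfolding pointwise smul_def
    using step(3) by (simp add: algebra_simps)
qed

section \<open>Length filtration\<close>

definition FL :: "nat \<Rightarrow> nat \<Rightarrow> (nat \<Rightarrow> nat) set" where
  "FL e l = {w \<in> SS e. plen w \<le> l}"

lemma FL_SS: "FL e l \<subseteq> SS e"
  by (auto simp: FL_def)

lemma FL_mono: "l \<le> l' \<Longrightarrow> FL e l \<subseteq> FL e l'"
  by (auto simp: FL_def)

lemma plen_sp_le: "fperm w \<Longrightarrow> 1 \<le> i \<Longrightarrow> plen (w \<circ> sp i) \<le> Suc (plen w)"
  using asc_or_desc[of w i] plen_asc[of w i] plen_desc[of w i] by force

lemma hRb_FL: "1 \<le> i \<Longrightarrow> i < e \<Longrightarrow> w \<in> FL e l \<Longrightarrow> hRb i w \<in> FS (FL e (Suc l))"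
  using plen_sp_le[of w i] by (auto simp: hRb_form FL_def SS_fperm intro!: FS_add FS_smul)

lemma fold_FL:
  assumes "set is \<subseteq> {1..<e}" "x \<in> FS (FL e l)"
  shows "fold (\<lambda>i. lext (hRb i)) is x \<in> FS (FL e (l + length is))"
  using assms(1)
proof (induction "is" rule: rev_induct)
  case Nil
  show ?case using assms(2) by (simp add: id_apply)
next
  case (snoc i "is")
  then have "lext (hRb i) (fold (\<lambda>i. lext (hRb i)) is x) \<in> FS (FL e (Suc (l + length is)))"
    by (intro lext_FS hRb_FL) auto
  then show ?case by (simp add: comp_apply)
qed

lemma Hmul_bas_FL: "x \<in> FS (FL e l) \<Longrightarrow> w \<in> SS e \<Longrightarrow> Hmul x (bas w) \<in> FS (FL e (l + plen w))"
  using fold_FL[OF reg.rword_letters] reduced_rword[OF SS_fperm] 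
  by (fastforce simp: Hmul_def hT_def reduced_def)

lemma Hmul_FL: "x \<in> FS (FL e l) \<Longrightarrow> y \<in> FS (FL e l') \<Longrightarrow> Hmul x y \<in> FS (FL e (l + l'))"
proof -
  assume a: "x \<in> FS (FL e l)" "y \<in> FS (FL e l')"
  have "hT w x \<in> FS (FL e (l + l'))" if "w \<in> FL e l'" for w
    using Hmul_bas_FL[OF a(1), of w] that FS_mono[OF _ FL_mono[of "l + plen w" "l + l'"]]
    by (auto simp: Hmul_def FL_def)
  then show ?thesis unfolding Hmul_def using a(2) by (intro lext_FS)
qed

lemma Tpm_FL: "1 \<le> i \<Longrightarrow> i < e \<Longrightarrow> Tpm b i \<in> FS (FL e 1)"
  using plen_sp_le[of id i] by (auto simp: Tpm_def FL_def)

lemma FS_FL_PP: "x \<in> FS (FL e l) \<Longrightarrow> x \<in> FS PP"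
  using FS_mono[OF _ FL_SS] FS_SS_PP by blast

text \<open>\<open>x\<close> has no term as long as \<open>w\<close>, so all corrections
  proportional to \<open>x\<close> vanish at \<open>w\<close>. Hence T_i and its inverse produce the
  same leading coefficient.\<close>

lemma Tpm_coeff:
  assumes "x \<in> FS (FL e l)" "1 \<le> i" "fperm w" "l < plen w" "w (Suc i) < w i"
  shows "Hmul x (Tpm b i) w = x (w \<circ> sp i)"
proof -
  have x: "x \<in> FS PP" using FS_FL_PP[OF assms(1)] .
  have "x w = 0" using assms(1,4) FS_outside[of x "FL e l" w] by (simp add: FL_def)
  then have "lext (hRb i) x w = x (w \<circ> sp i)" using hR_coeff[OF x assms(2,3)] by simp
  moreover have "Hmul x (Tpm b i) = (if b then lext (hRb i) x - smul qc x else lext (hRb i) x)"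
    using x assms(2) by (simp add: Tpm_def Hmul_distrib Hmul_TT)
  ultimately show ?thesis using \<open>x w = 0\<close> by (simp add: minus_apply[of _ _ w] smul_def)
qed

section \<open>Nondegeneracy of the top coefficient\<close>

text \<open>If \<open>i\<close> is an ascent of \<open>w\<close>, then the coefficient of x T_i at w
  s_i is x(w) plus a multiple of x(w s_i). Going down from the longest element, all coefficients of
  all members of \<open>X\<close> vanish. This is the nondegeneracy of the Frobenius form on
  H_d.\<close>

lemma top_coeff_nondegenerate:
  assumes X: "X \<subseteq> FS (SS d)" and closed: "\<And>x i. x \<in> X \<Longrightarrow> 1 \<le> i \<Longrightarrow> i < d \<Longrightarrow> lext (hRb i) x \<in> X"
    and zero: "\<And>x. x \<in> X \<Longrightarrow> x (w0 d) = 0" and x: "x \<in> X"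
  shows "x = 0"
proof -
  define B where "B = Max (plen ` SS d)"
  have B: "plen w \<le> B" if "w \<in> SS d" for w unfolding B_def using finite_SS that by simp
  have "x w = 0" if "w \<in> SS d" "x \<in> X" for w x
    using that
  proof (induction "B - plen w" arbitrary: w x rule: less_induct)
    case less
    have f: "fperm w" using less.prems SS_fperm by blast
    show ?case
    proof (cases "\<exists>i. 1 \<le> i \<and> i < d \<and> w i < w (Suc i)")
      case True
      then obtain i where i: "1 \<le> i" "i < d" "w i < w (Suc i)" by blast
      have s: "w \<circ> sp i \<in> SS d" using less.prems i by simp
      have m: "B - plen (w \<circ> sp i) < B - plen w" using plen_asc[OF f i(1,3)] B[OF s] by simp
      have "x (w \<circ> sp i) = 0" "lext (hRb i) x (w \<circ> sp i) = 0"
        using less.hyps[OF m s] closed[OF less.prems(2) i(1,2)] less.prems by auto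
      moreover have "x \<in> FS PP" using X less.prems FS_SS_PP by blast
      ultimately show ?thesis using hR_coeff[of x i "w \<circ> sp i"] i f by simp
    next
      case False
      then have "w = w0 d" using asc_or_desc[OF f] less.prems by (intro no_ascent_w0) blast+
      then show ?thesis using zero less.prems by simp
    qed
  qed
  then have "x w = 0" for w using x X FS_outside[of x "SS d" w] by (cases "w \<in> SS d") auto
  then show ?thesis by (simp add: fun_eq_iff pointwise)
qed

section \<open>The maps to the Hecke algebra\<close>

text \<open>\<open>foldr\<close> lets the last letter of \<open>P\<close> act first; the reversal of
  \<open>P\<close> in \<open>Ew_top\<close> originates here.\<close>

definition EE :: "nat \<Rightarrow> nat list \<Rightarrow> bk \<Rightarrow> bk" where
  "EE m P f = foldr (\<lambda>j. Dop m j) P f"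

definition ex0 :: "bk \<Rightarrow> hk" where
  "ex0 g = (\<lambda>w. g ([], w))"

text \<open>Removing d letters from a word of length d leaves the empty word, and \<open>ex0\<close>
  reads off the remaining element of the Hecke algebra.\<close>

definition Ew :: "nat \<Rightarrow> nat list \<Rightarrow> bk \<Rightarrow> hk" where
  "Ew m P f = ex0 (EE m P f)"

lemma ex0_lin: "lin (A \<times> B) B ex0"
proof -
  have "ex0 x \<in> FS B" if "x \<in> FS (A \<times> B)" for x
  proof -
    have "finite (snd ` {p. x p \<noteq> 0})" using FS_finite[OF that] by simp
    then have "finite {w. x ([], w) \<noteq> 0}" by (rule rev_finite_subset) force
    then show ?thesis using that by (auto simp: FS_def fsupp_def ex0_def)
  qed
  then show ?thesis by (auto simp: lin_def) (auto simp: ex0_def fun_eq_iff pointwise smul_def)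
qed

lemma ex0_tens [simp]: "ex0 (tens (bas []) x) = x"
  by (auto simp: ex0_def tens_def bas_def)

lemma tens_ex0: "g \<in> FS (wds m n 0 \<times> B) \<Longrightarrow> tens (bas []) (ex0 g) = g"
  by (auto simp: FS_def wds_def ex0_def tens_def bas_def fun_eq_iff)

lemma EE_lin: "lin (LW m n \<times> PP) (LW m n \<times> PP) (EE m P)"
proof (induction P)
  case Nil
  show ?case using lin_id[of "LW m n \<times> PP" "LW m n \<times> PP"] by (simp add: EE_def[abs_def] id_apply)
next
  case (Cons j P)
  then show ?case using lin_comp[OF Cons Dop_lin] by (simp add: EE_def[abs_def] comp_apply)
qed

lemma EE_lin_graded: "a \<le> N \<Longrightarrow> length P \<le> a \<Longrightarrow>
    lin (wds m n a \<times> SS N) (wds m n (a - length P) \<times> SS N) (EE m P)"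
proof (induction P)
  case Nil
  show ?case using lin_id[of "wds m n a \<times> SS N" "wds m n a \<times> SS N"] by (simp add: EE_def[abs_def] id_apply)
next
  case (Cons j P)
  then have "lin (wds m n a \<times> SS N) (wds m n (a - length P) \<times> SS N) (EE m P)" by simp
  from lin_comp[OF this Dop_lin_graded[of "a - length P" N m n j]] show ?case using Cons.prems
    by (simp add: EE_def[abs_def] comp_apply)
qed

lemma EE_RM: "h \<in> FS PP \<Longrightarrow> f \<in> FS (LW m n \<times> PP) \<Longrightarrow> EE m P (RM h f) = RM h (EE m P f)"
proof (induction P)
  case (Cons j P)
  then show ?case using Dop_RM[OF Cons.prems(1) linD(1)[OF EE_lin Cons.prems(2)], of j P]
    by (simp add: EE_def comp_apply)
qed (simp add: EE_def id_apply)

lemma EE_N: "f \<in> Nall m n \<Longrightarrow> EE m P f \<in> Nall m n"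
  by (induction P) (auto simp: EE_def id_apply comp_apply intro: Dop_N)

text \<open>A relation from a generator needs a word of at least two letters. In degree zero the
  quotient imposes nothing, so values in the Hecke algebra do not depend on representatives.\<close>

lemma ex0_N:
  assumes "g \<in> Nall m n"
  shows "ex0 g = 0"
proof -
  have "ex0 g \<in> {0}"
  proof (rule Nall_pres[OF ex0_lin _ _ assms])
    show "kv.subspace {0}" by (auto simp: kv.subspace_def)
    fix I w p assume a: "I \<in> LW m n" "1 \<le> p" "p < length I"
    have "vRb m p I [] = 0"
      by (rule FS_outside[OF vRb_in[OF a(2,3,1)]]) (use a in \<open>auto simp: wds_def\<close>)
    then have "ex0 (tens (vRb m p I) x) = 0" for x by (auto simp: ex0_def tens_def fun_eq_iff pointwise)
    moreover have "ex0 (tens (bas I) x) = 0" for x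
      using a by (auto simp: ex0_def tens_def bas_def fun_eq_iff pointwise)
    ultimately show "ex0 (tens (vRb m p I) (bas w)) - ex0 (tens (bas I) (Hmul (TT p) (bas w))) \<in> {0}" by simp
  qed
  then show ?thesis by simp
qed

lemma Ew_lin_graded: "a \<le> N \<Longrightarrow> length P = a \<Longrightarrow> lin (wds m n a \<times> SS N) (SS N) (Ew m P)"
  unfolding Ew_def using lin_comp[OF EE_lin_graded[of a N P m n] ex0_lin] by simp

lemma Ew_lin: "lin (LW m n \<times> PP) PP (Ew m P)"
  unfolding Ew_def by (rule lin_comp[OF EE_lin ex0_lin])

lemma Ew_N: "f \<in> Nall m n \<Longrightarrow> Ew m P f = 0"
  unfolding Ew_def by (rule ex0_N[OF EE_N])

lemma EE_Ew: "a \<le> N \<Longrightarrow> length P = a \<Longrightarrow> f \<in> FS (wds m n a \<times> SS N) \<Longrightarrow> EE m P f = tens (bas []) (Ew m P f)"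
  unfolding Ew_def using linD(1)[OF EE_lin_graded[of a N P m n]] tens_ex0 by fastforce

lemma Ew_RM:
  assumes "a \<le> N" "length P = a" "f \<in> FS (wds m n a \<times> SS N)" "h \<in> FS (SS N)"
  shows "Ew m P (RM h f) = Hmul (Ew m P f) h"
proof -
  have f: "f \<in> FS (LW m n \<times> PP)" using FS_mono[OF assms(3) wds_LW_PP] .
  have h: "h \<in> FS PP" using FS_SS_PP[OF assms(4)] .
  have e: "Ew m P f \<in> FS PP" using linD(1)[OF Ew_lin f] .
  have "Ew m P (RM h f) = ex0 (RM h (tens (bas []) (Ew m P f)))"
    unfolding Ew_def[of m P "RM h f"] EE_RM[OF h f] EE_Ew[OF assms(1-3)] ..
  then show ?thesis using RM_tens_bas[OF h e] by simp
qed

text \<open>The product T_l ... T_1, with some factors inverted, that accumulates when the letter in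
  front of \<open>I\<close> is removed and all l letters of \<open>I\<close> survive.\<close>

definition Yw :: "nat \<Rightarrow> nat list \<Rightarrow> hk" where
  "Yw j I = foldr (\<lambda>k y. Hmul (Tpm (I ! (k - 1) < j) k) y) (rev [1..<Suc (length I)]) (bas id)"

lemma Yw_Nil [simp]: "Yw j [] = bas id"
  by (simp add: Yw_def id_apply[of "bas id"])

lemma Yw_snoc: "Yw j (I @ [s]) = Hmul (Tpm (s < j) (Suc (length I))) (Yw j I)"
proof -
  have "foldr (\<lambda>k y. Hmul (Tpm ((I @ [s]) ! (k - 1) < j) k) y) (rev [1..<Suc (length I)]) (bas id)
    = foldr (\<lambda>k y. Hmul (Tpm (I ! (k - 1) < j) k) y) (rev [1..<Suc (length I)]) (bas id)"
    by (rule foldr_cong) (auto simp: nth_append fun_eq_iff)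
  moreover have "rev [1..<Suc (length (I @ [s]))] = Suc (length I) # rev [1..<Suc (length I)]" by simp
  ultimately show ?thesis unfolding Yw_def by (simp del: upt_Suc add: comp_apply)
qed

lemma Yw_FL: "Yw j I \<in> FS (FL (Suc (length I)) (length I))"
proof (induction I rule: rev_induct)
  case Nil
  show ?case by (simp add: FL_def)
next
  case (snoc s I)
  have "Yw j I \<in> FS (FL (Suc (Suc (length I))) (length I))"
    by (rule FS_mono[OF snoc]) (use SS_mono[of "Suc (length I)" "Suc (Suc (length I))"] in \<open>auto simp: FL_def\<close>)
  then show ?case
    using Hmul_FL[OF Tpm_FL[of "Suc (length I)" "Suc (Suc (length I))"]] by (simp add: Yw_snoc)
qed

text \<open>Each factor lengthens a permutation by at most one, and \<open>y\<close> starts at the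
  length from which the longest element needs all of them. By \<open>Tpm_coeff\<close> the
  coefficient is carried unchanged along the chain \<open>ux\<close>.\<close>

lemma Yw_top_coeff:
  assumes "length I \<le> a" "y \<in> FS (FL (Suc a) (plen (ux a (Suc (length I)))))"
  shows "Hmul y (Yw j I) (w0 (Suc a)) = y (ux a (Suc (length I)))"
  using assms
proof (induction I arbitrary: y rule: rev_induct)
  case Nil
  then show ?case using ux_bot by simp
next
  case (snoc s I)
  let ?l = "Suc (length I)" and ?T = "Tpm (s < j) (Suc (length I))"
  have l: "1 \<le> ?l" "?l \<le> a" using snoc.prems by auto
  have p: "plen (ux a ?l) = Suc (plen (ux a (Suc ?l)))" using plen_ux[OF l] .
  have y: "y \<in> FS (FL (Suc a) (plen (ux a (Suc ?l))))" using snoc.prems by simp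
  have "Hmul y ?T \<in> FS (FL (Suc a) (plen (ux a ?l)))"
    using Hmul_FL[OF y Tpm_FL[of ?l "Suc a" "s < j"]] l p by simp
  then have "Hmul (Hmul y ?T) (Yw j I) (w0 (Suc a)) = Hmul y ?T (ux a ?l)"
    using snoc.IH l by simp
  also have "\<dots> = y (ux a ?l \<circ> sp ?l)"
  proof (rule Tpm_coeff[OF y])
    show "fperm (ux a ?l)" using SS_fperm[OF ux_SS[of ?l a]] l by simp
    show "ux a ?l (Suc ?l) < ux a ?l ?l" using ux_asc[OF l] by (simp add: ux_step[OF l] comp_apply)
  qed (use p in auto)
  also have "\<dots> = y (ux a (Suc ?l))" by (simp add: ux_step[OF l])
  finally show ?case
    using Hmul_assoc[of y ?T "Yw j I"] FS_FL_PP[OF y] FS_FL_PP[OF Yw_FL[of j I]] by (simp add: Yw_snoc)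
qed

definition eta :: "nat \<Rightarrow> nat \<Rightarrow> nat list \<Rightarrow> K" where
  "eta m j I = foldr (\<lambda>s c. sg m j s * c) I 1"

lemma eta_nz: "eta m j I \<noteq> 0"
  by (induction I) (auto simp: eta_def sg_def comp_apply id_apply)

lemma eta_snoc: "eta m j (I @ [s]) = sg m j s * eta m j I"
  by (induction I) (auto simp: eta_def comp_apply id_apply)

text \<open>Removing the first letter is the only way to get a product of as many generators as
  there are remaining letters.\<close>
lemma Dw_leading:
  assumes "r # I \<in> LW m n"
  shows "\<exists>R \<in> FS (wds m n (length I) \<times> {w \<in> SS (Suc (length I)). plen w < length I}).
    Dw m j (r # I) = (if r = j then smul (eta m j I) (tens (bas I) (Yw j I)) else 0) + R"
  using assms
proof (induction I rule: rev_induct)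
  case Nil
  show ?case
    using Dw_snoc[of m j "[]" r] by (intro bexI[of _ 0]) (auto simp: kap_def eta_def tens_bas id_apply)
next
  case (snoc s I)
  let ?S = "\<lambda>e l. {w \<in> SS e. plen w < l}"
  have I: "r # I \<in> LW m n" "I \<in> LW m n" and s: "s \<in> {1..m+n}" using snoc.prems by auto
  obtain R where R: "R \<in> FS (wds m n (length I) \<times> ?S (Suc (length I)) (length I))"
    and D: "Dw m j (r # I) = (if r = j then smul (eta m j I) (tens (bas I) (Yw j I)) else 0) + R"
    using snoc.IH I by blast
  have RL: "R \<in> FS (LW m n \<times> PP)"
    by (rule FS_mono[OF R]) (use SS_PP in \<open>auto simp: wds_def\<close>)
  have Y: "Yw j I \<in> FS PP" using FS_FL_PP[OF Yw_FL] .
  have tL: "tens (bas I) (Yw j I) \<in> FS (LW m n \<times> PP)" using I Y by simp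
  have G: "lin (LW m n \<times> PP) (LW m n \<times> PP) (Gop s (s < j))" using s by (rule Gop_lin)
  let ?T = "wds m n (Suc (length I)) \<times> ?S (Suc (Suc (length I))) (Suc (length I))"
  have GR: "Gop s (s < j) R \<in> FS ?T"
    unfolding Gop_def
  proof (rule lext_FS[OF R], clarify)
    fix J w assume a: "J \<in> wds m n (length I)" "w \<in> SS (Suc (length I))" "plen w < length I"
    then have l: "length J = length I" "w \<in> SS (Suc (Suc (length I)))"
      using SS_mono[of "Suc (length I)" "Suc (Suc (length I))"] by (auto simp: wds_def)
    have "Hmul (Tpm (s < j) (Suc (length J))) (bas w) \<in> FS (FL (Suc (Suc (length I))) (1 + plen w))"
      by (rule Hmul_bas_FL[OF Tpm_FL]) (use l in auto)
    then have "Hmul (Tpm (s < j) (Suc (length J))) (bas w) \<in> FS (?S (Suc (Suc (length I))) (Suc (length I)))"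
      by (rule FS_mono) (use a in \<open>auto simp: FL_def\<close>)
    then show "tens (bas (J @ [s])) (Hmul (Tpm (s < j) (Suc (length J))) (bas w)) \<in> FS ?T"
      using a s by (intro tens_in) (auto simp: wds_def)
  qed
  define R' where "R' = (if s = j then smul (kap m j (r # I)) (bas (r # I, id)) else 0)
      + smul (sg m j s) (Gop s (s < j) R)"
  have b: "bas (r # I, id) \<in> FS ?T" using I by (auto simp: wds_def)
  have R': "R' \<in> FS ?T" unfolding R'_def using GR b by auto
  have "Gop s (s < j) (Dw m j (r # I)) =
     (if r = j then smul (eta m j I) (tens (bas (I @ [s])) (Yw j (I @ [s]))) else 0) + Gop s (s < j) R"
    unfolding D using linD(2,3)[OF G] tL RL Gop_tens_bas[OF Y, of s "s < j" I] by (simp add: Yw_snoc)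
  then have "Dw m j (r # (I @ [s])) = (if r = j then smul (eta m j (I @ [s])) (tens (bas (I @ [s])) (Yw j (I @ [s]))) else 0) + R'"
    using Dw_snoc[of m j "r # I" s] by (simp add: R'_def smul_add eta_snoc add_ac)
  then show ?case using R' by auto
qed

text \<open>As \<open>plen (w0 (Suc a)) = plen (w0 a) + a\<close>, only a term with \<open>a\<close>
  new generators reaches the longest element. This is the leading term of \<open>Dw\<close>, present
  only if the first letter of \<open>I\<close> is the last letter of \<open>P\<close>; the other
  letters are compared by induction.\<close>

lemma Ew_top:
  assumes "length P = a" "I \<in> wds m n a"
  shows "Ew m P (bas (I, id)) \<in> FS (FL a (plen (w0 a)))
    \<and> (Ew m P (bas (I, id)) (w0 a) \<noteq> 0 \<longleftrightarrow> I = rev P)"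
  using assms
proof (induction a arbitrary: I P)
  case 0
  have "w0 0 = id" by (auto simp: w0_def fun_eq_iff id_apply)
  moreover have "Ew m [] (bas ([], id)) = bas id"
    unfolding Ew_def EE_def using ex0_tens[of "bas id"] by (simp add: tens_bas id_apply[of "bas ([], id)"])
  moreover have "bas (id :: nat \<Rightarrow> nat) id = 1" by (simp add: bas_def)
  ultimately show ?case using 0 by (simp add: FL_def wds_def)
next
  case (Suc a)
  obtain P' j where P: "P = P' @ [j]" using Suc.prems by (cases P rule: rev_cases) auto
  have lP: "length P' = a" using Suc.prems P by simp
  obtain r J where I: "I = r # J" "length J = a" "r # J \<in> LW m n" "J \<in> wds m n a"
    using Suc.prems by (cases I) (auto simp: wds_def)
  obtain R where R: "R \<in> FS (wds m n a \<times> {w \<in> SS (Suc a). plen w < a})"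
    and D: "Dw m j (r # J) = (if r = j then smul (eta m j J) (tens (bas J) (Yw j J)) else 0) + R"
    using Dw_leading[OF I(3), of j] I(2) by blast
  have L: "lin (wds m n a \<times> SS (Suc a)) (SS (Suc a)) (Ew m P')"
    using Ew_lin_graded[of a "Suc a" P'] lP by simp
  have Rin: "R \<in> FS (wds m n a \<times> SS (Suc a))" by (rule FS_mono[OF R]) auto
  have Y: "Yw j J \<in> FS (FL (Suc a) a)" using Yw_FL[of j J] I by simp
  have YS: "Yw j J \<in> FS (SS (Suc a))" using FS_mono[OF Y FL_SS] .
  have tY: "tens (bas J) (Yw j J) \<in> FS (wds m n a \<times> SS (Suc a))" using I YS by simp
  have E0: "Ew m P' (bas (Z, id)) \<in> FS (FL (Suc a) (plen (w0 a)))" if "Z \<in> wds m n a" for Z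
    using Suc.IH[OF lP that] SS_mono[of a "Suc a"] by (auto simp: FL_def elim!: FS_mono)
  have Egen: "Ew m P' (tens (bas Z) y) = Hmul (Ew m P' (bas (Z, id))) y"
    if "Z \<in> wds m n a" "y \<in> FS (SS (Suc a))" for Z y
  proof -
    have "RM y (bas (Z, id)) = tens (bas Z) y"
      using FS_SS_PP[OF that(2)] by (simp add: RM_tens_bas flip: tens_bas)
    then show ?thesis using Ew_RM[of a "Suc a" P' "bas (Z, id)" m n y] lP that by simp
  qed
  \<comment> \<open>Every term of the remainder contributes length below \<open>a\<close>, so its
    image stays strictly shorter than the longest element.\<close>
  have ER: "Ew m P' R \<in> FS {w \<in> SS (Suc a). plen w < plen (w0 a) + a}"
  proof -
    have "Ew m P' R = lext (\<lambda>p. Ew m P' (bas p)) R" by (rule lin_as_lext[OF L Rin])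
    also have "\<dots> \<in> FS {w \<in> SS (Suc a). plen w < plen (w0 a) + a}"
    proof (rule lext_FS[OF R], clarify)
      fix Z u assume z: "Z \<in> wds m n a" "u \<in> SS (Suc a)" "plen u < a"
      have "Ew m P' (bas (Z, u)) \<in> FS (FL (Suc a) (plen (w0 a) + plen u))"
        using Egen[OF z(1), of "bas u"] z(2) Hmul_bas_FL[OF E0[OF z(1)] z(2)] by (simp add: tens_bas)
      then show "Ew m P' (bas (Z, u)) \<in> FS {w \<in> SS (Suc a). plen w < plen (w0 a) + a}"
        by (rule FS_mono) (use z in \<open>auto simp: FL_def\<close>)
    qed
    finally show ?thesis .
  qed
  have DL: "Dw m j (r # J) \<in> FS (LW m n \<times> PP)" using Dw_LW[OF I(3)] .
  have "Dop m j (bas (I, id)) = Dw m j (r # J)"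
    using Dop_tens_bas[OF I(3), of "bas id" j] RM_id[OF DL] I(1) by (simp add: tens_bas)
  then have "Ew m P (bas (I, id)) = Ew m P' (Dw m j (r # J))"
    by (simp add: Ew_def EE_def P comp_apply id_apply)
  also have "\<dots> = (if r = j then smul (eta m j J) (Hmul (Ew m P' (bas (J, id))) (Yw j J)) else 0) + Ew m P' R"
    unfolding D using linD(2,3)[OF L] lin_zero[OF L] tY Rin Egen[OF I(4) YS] by simp
  finally have E: "Ew m P (bas (I, id)) =
     (if r = j then smul (eta m j J) (Hmul (Ew m P' (bas (J, id))) (Yw j J)) else 0) + Ew m P' R" .
  have c: "plen (w0 (Suc a)) = plen (w0 a) + a" by (rule plen_w0_Suc)
  have "Hmul (Ew m P' (bas (J, id))) (Yw j J) \<in> FS (FL (Suc a) (plen (w0 (Suc a))))"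
    using Hmul_FL[OF E0[OF I(4)] Y] c by simp
  moreover have "Ew m P' R \<in> FS (FL (Suc a) (plen (w0 (Suc a))))"
    by (rule FS_mono[OF ER]) (auto simp: FL_def c)
  ultimately have 1: "Ew m P (bas (I, id)) \<in> FS (FL (Suc a) (plen (w0 (Suc a))))"
    unfolding E by auto
  have "Ew m P' R (w0 (Suc a)) = 0" by (rule FS_outside[OF ER]) (simp add: c)
  moreover have "Hmul (Ew m P' (bas (J, id))) (Yw j J) (w0 (Suc a)) = Ew m P' (bas (J, id)) (w0 a)"
    using Yw_top_coeff[of J a "Ew m P' (bas (J, id))" j] E0[OF I(4)] I(2) by (simp add: ux_top)
  ultimately have "Ew m P (bas (I, id)) (w0 (Suc a)) =
      (if r = j then eta m j J * Ew m P' (bas (J, id)) (w0 a) else 0)"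
    unfolding E by (auto simp: pointwise smul_def)
  then have "Ew m P (bas (I, id)) (w0 (Suc a)) \<noteq> 0 \<longleftrightarrow> I = rev P"
    using Suc.IH[OF lP I(4)] eta_nz I(1) P by auto
  then show ?case using 1 by blast
qed

section \<open>Module maps from tensor space to the Hecke algebra\<close>

lemma Ew_word_lin:
  assumes "length P = d"
  shows "lin (wds m n d) (SS d) (\<lambda>v. Ew m P (tens v (bas id)))"
  by (rule lin_comp[OF tens_lin_left Ew_lin_graded]) (use assms in auto)

text \<open>Modulo relations T_i passes from the word to the Hecke factor; \<open>Ew\<close> kills
  relations and commutes with right multiplication.\<close>

lemma Ew_word_gen:
  assumes "length P = d" "v \<in> FS (wds m n d)" "1 \<le> i" "i < d"
  shows "Ew m P (tens (lext (vRb m i) v) (bas id)) = lext (hRb i) (Ew m P (tens v (bas id)))"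
proof -
  have v: "v \<in> FS (LW m n)" "lext (vRb m i) v \<in> FS (LW m n)"
    using FS_mono[OF _ wds_LW] assms ten.op_in by blast+
  have T: "TT i \<in> FS PP" using assms by simp
  have t: "tens v (bas id) \<in> FS (wds m n d \<times> SS d)" using assms by simp
  have "vact m v (TT i) = lext (vRb m i) v" using ten.ract_sp[of i m v] assms by (simp add: vact_ract)
  then have "tens (lext (vRb m i) v) (bas id) - tens v (TT i) \<in> Nall m n"
    using N_rel[of v m n d "TT i" "bas id"] assms by simp
  then have "Ew m P (tens (lext (vRb m i) v) (bas id)) = Ew m P (tens v (TT i))"
    using Ew_N lin_diff[OF Ew_lin, of "tens (lext (vRb m i) v) (bas id)" m n "tens v (TT i)" P] v T by simp
  also have "tens v (TT i) = RM (TT i) (tens v (bas id))"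
    using RM_tens[OF assms(2) T, of "bas id"] T by simp
  also have "Ew m P \<dots> = Hmul (Ew m P (tens v (bas id))) (TT i)"
    by (rule Ew_RM[OF _ assms(1) t]) (use assms in auto)
  finally show ?thesis using assms by (simp add: Hmul_TT)
qed

text \<open>The matrix of top coefficients of the maps \<open>Ew m P\<close> on basis words has one
  nonzero entry in each row and column, so dividing by these entries gives scalars that match the
  top coefficients of \<open>\<Psi>\<close>. The image of the difference is closed under the
  generators and has no top coefficients, so it is zero.\<close>

lemma equivariant_maps_spanned:
  assumes lin: "lin (wds m n d) (SS d) \<Psi>"
    and eqv: "\<And>v i. v \<in> FS (wds m n d) \<Longrightarrow> 1 \<le> i \<Longrightarrow> i < d \<Longrightarrow> \<Psi> (lext (vRb m i) v) = lext (hRb i) (\<Psi> v)"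
  shows "\<exists>a. \<forall>v\<in>FS (wds m n d). \<Psi> v = (\<Sum>P\<in>wds m n d. smul (a P) (Ew m P (tens v (bas id))))"
proof -
  let ?A = "wds m n d"
  define a where "a P = \<Psi> (bas (rev P)) (w0 d) / Ew m P (bas (rev P, id)) (w0 d)" for P
  define F where "F v = (\<Sum>P\<in>?A. smul (a P) (Ew m P (tens v (bas id))))" for v
  have len: "length P = d" if "P \<in> ?A" for P using that by (simp add: wds_def)
  have Fl: "lin ?A (SS d) F"
    unfolding F_def by (intro lin_setsum lin_smul Ew_word_lin len)
  have rl: "lin (SS d) (SS d) (lext (hRb i))" if "1 \<le> i" "i < d" for i by (rule reg.op_lin[OF that])
  have Fe: "F (lext (vRb m i) v) = lext (hRb i) (F v)" if "v \<in> FS ?A" "1 \<le> i" "i < d" for v i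
  proof -
    have s: "Ew m P (tens v (bas id)) \<in> FS (SS d)" if "P \<in> ?A" for P
      using linD(1)[OF Ew_word_lin[OF len]] that \<open>v \<in> FS ?A\<close> by blast
    have "lext (hRb i) (F v) = (\<Sum>P\<in>?A. smul (a P) (lext (hRb i) (Ew m P (tens v (bas id)))))"
      unfolding F_def using lin_sum[OF rl[OF that(2,3)], of ?A] s by (simp add: lext_smul)
    then show ?thesis unfolding F_def using Ew_word_gen[OF len] that by simp
  qed
  define D where "D v = \<Psi> v - F v" for v
  have Dl: "lin ?A (SS d) D" unfolding D_def by (rule lin_minus[OF lin Fl])
  have top: "D v (w0 d) = 0" if "v \<in> FS ?A" for v
  proof -
    have b: "D (bas I) (w0 d) = 0" if I: "I \<in> ?A" for I
    proof -
      have r: "rev I \<in> ?A" using I by (simp add: wds_def)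
      have t: "Ew m P (bas (I, id)) (w0 d) \<noteq> 0 \<longleftrightarrow> I = rev P" if "P \<in> ?A" for P
        using Ew_top[OF len[OF that] I] by blast
      have "F (bas I) (w0 d) = (\<Sum>P\<in>?A. a P * Ew m P (bas (I, id)) (w0 d))"
        unfolding F_def by (simp add: sum_fun_apply smul_def tens_bas)
      also have "\<dots> = (\<Sum>P\<in>?A. if P = rev I then \<Psi> (bas I) (w0 d) else 0)"
      proof (rule sum.cong[OF refl])
        fix P assume P: "P \<in> ?A"
        show "a P * Ew m P (bas (I, id)) (w0 d) = (if P = rev I then \<Psi> (bas I) (w0 d) else 0)"
        proof (cases "P = rev I")
          case True
          then show ?thesis using t[OF P] by (simp add: a_def)
        next
          case False
          then have "I \<noteq> rev P" by auto
          then show ?thesis using t[OF P] False by simp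
        qed
      qed
      also have "\<dots> = \<Psi> (bas I) (w0 d)" using r finite_wds by simp
      finally show ?thesis by (simp add: D_def pointwise)
    qed
    have "D v = lext (\<lambda>I. D (bas I)) v" by (rule lin_as_lext[OF Dl that])
    then have "D v (w0 d) = (\<Sum>I\<in>{I. v I \<noteq> 0}. v I * D (bas I) (w0 d))" by (simp add: lext_def)
    also have "\<dots> = 0" by (rule sum.neutral) (use b that in \<open>auto simp: FS_def\<close>)
    finally show ?thesis .
  qed
  have "D v = 0" if v: "v \<in> FS ?A" for v
  proof (rule top_coeff_nondegenerate[of "D ` FS ?A" d])
    show "D ` FS ?A \<subseteq> FS (SS d)" using linD(1)[OF Dl] by blast
    show "x (w0 d) = 0" if "x \<in> D ` FS ?A" for x using that top by auto
    show "D v \<in> D ` FS ?A" using v by simp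
    fix x i assume x: "x \<in> D ` FS ?A" and i: "1 \<le> i" "i < d"
    then obtain u where u: "u \<in> FS ?A" "x = D u" by blast
    have "lext (hRb i) (D u) = D (lext (vRb m i) u)"
      unfolding D_def eqv[OF u(1) i] Fe[OF u(1) i]
      using lin_diff[OF rl[OF i]] linD(1)[OF lin] linD(1)[OF Fl] u(1) by blast
    then show "lext (hRb i) x \<in> D ` FS ?A" using u ten.op_in[OF i u(1)] by blast
  qed
  then have "\<forall>v\<in>FS ?A. \<Psi> v = F v" by (simp add: D_def)
  then show ?thesis unfolding F_def by blast
qed

section \<open>Dual bases for the tensor space\<close>

text \<open>The adjoint of the map h \<mapsto> e_J h from H_d to tensor space.\<close>

definition PhiJ :: "nat \<Rightarrow> nat \<Rightarrow> nat list \<Rightarrow> (nat list \<Rightarrow> K) \<Rightarrow> hk" where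
  "PhiJ m d J v = (\<lambda>w. if w \<in> SS d then herm v (ract (vRb m) (bas J) (bas w)) else 0)"

lemma finite_FS: "finite A \<Longrightarrow> (\<And>a. a \<notin> A \<Longrightarrow> x a = 0) \<Longrightarrow> x \<in> FS A"
  unfolding FS_def fsupp_def by (auto intro: rev_finite_subset[of A])

lemma PhiJ_lin: "lin (wds m n d) (SS d) (PhiJ m d J)"
proof -
  have "PhiJ m d J v \<in> FS (SS d)" for v by (rule finite_FS[OF finite_SS]) (simp add: PhiJ_def)
  then show ?thesis
    by (auto simp: lin_def) (auto simp: PhiJ_def fun_eq_iff pointwise smul_def[of _ "_ :: _ \<Rightarrow> K"] 
        herm_add_left herm_smul_left[unfolded smul_def])
qed

text \<open>The generators are self-adjoint on both sides, so the adjoint of a map linear over H_d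
  is again linear over H_d.\<close>

lemma PhiJ_gen:
  assumes "J \<in> wds m n d" "v \<in> FS (wds m n d)" "1 \<le> i" "i < d"
  shows "PhiJ m d J (lext (vRb m i) v) = lext (hRb i) (PhiJ m d J v)"
proof
  fix w
  have P: "PhiJ m d J u \<in> FS (SS d)" if "u \<in> FS (wds m n d)" for u using linD(1)[OF PhiJ_lin that] .
  show "PhiJ m d J (lext (vRb m i) v) w = lext (hRb i) (PhiJ m d J v) w"
  proof (cases "w \<in> SS d")
    case False
    then show ?thesis using FS_outside[OF reg.op_in[OF assms(3,4) P[OF assms(2)]]] by (simp add: PhiJ_def)
  next
    case w: True
    have f: "fperm w" using SS_fperm[OF w] .
    have J: "bas J \<in> FS (wds m n d)" using assms by simp
    let ?e = "\<lambda>w. ten.W m w (bas J)"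
    have s: "w \<circ> sp i \<in> SS d" using w assms by simp
    have e: "?e w \<in> FS (wds m n d)" by (rule ten.W_in[OF w J])
    have "lext (hRb i) (PhiJ m d J v) w = herm v (?e (w \<circ> sp i)) + (if w i < w (Suc i) then 0 else qc) * herm v (?e w)"
      unfolding hR_coeff[OF FS_SS_PP[OF P[OF assms(2)]] assms(3) f] using w s by (simp add: PhiJ_def ten.ract_bas)
    also have "\<dots> = herm v (lext (vRb m i) (?e w))"
    proof (cases "w i < w (Suc i)")
      case True
      then show ?thesis using ten.W_asc[OF w assms(3,4) True J] by simp
    next
      case False
      then have "w (Suc i) < w i" using asc_or_desc[OF f] by blast
      then show ?thesis using ten.W_desc[OF w assms(3,4) _ J] False by (simp add: herm_add_right herm_smul_right)
    qed
    also have "\<dots> = herm (lext (vRb m i) v) (?e w)" by (rule ten.herm_gen[OF assms(3,4,2) e, symmetric])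
    finally show ?thesis using w by (simp add: PhiJ_def ten.ract_bas)
  qed
qed

definition Cv :: "nat \<Rightarrow> nat \<Rightarrow> nat \<Rightarrow> (nat list \<Rightarrow> K) \<Rightarrow> nat list \<Rightarrow> K" where
  "Cv m n d v = (\<Sum>J\<in>wds m n d. ract (vRb m) (bas J) (PhiJ m d J v))"

lemma Cv_lin: "lin (wds m n d) (wds m n d) (Cv m n d)"
  unfolding Cv_def by (intro lin_setsum lin_comp[OF PhiJ_lin ten.ract_lin_right]) simp

lemma Cv_gen:
  assumes "v \<in> FS (wds m n d)" "1 \<le> i" "i < d"
  shows "Cv m n d (lext (vRb m i) v) = lext (vRb m i) (Cv m n d v)"
proof -
  have P: "PhiJ m d J v \<in> FS (SS d)" for J using linD(1)[OF PhiJ_lin assms(1)] .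
  have "lext (vRb m i) (Cv m n d v) = (\<Sum>J\<in>wds m n d. lext (vRb m i) (ract (vRb m) (bas J) (PhiJ m d J v)))"
    unfolding Cv_def by (rule lin_sum[OF ten.op_lin[OF assms(2,3)]]) (auto intro!: ten.ract_in P)
  also have "\<dots> = Cv m n d (lext (vRb m i) v)"
    unfolding Cv_def by (rule sum.cong) (use assms P in \<open>auto simp: PhiJ_gen ten.ract_gen[where n = n and e = d]\<close>)
  finally show ?thesis by simp
qed

text \<open>\<open>Cv\<close> is the frame operator of the vectors \<open>e\<^sub>J T\<^sub>w\<close>, hence positive definite.\<close>
lemma Cv_definite:
  assumes v: "v \<in> FS (wds m n d)" and z: "herm v (Cv m n d v) = 0"
  shows "v = 0"
proof -
  let ?S = "wds m n d \<times> SS d" and ?h = "\<lambda>(J, w). herm v (ract (vRb m) (bas J) (bas w))"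
  have "ract (vRb m) (bas J) (PhiJ m d J v) = (\<Sum>w\<in>SS d. smul (?h (J, w)) (ract (vRb m) (bas J) (bas w)))" for J
  proof -
    have "ract (vRb m) (bas J) (PhiJ m d J v) = (\<Sum>w\<in>SS d. smul (PhiJ m d J v w) (ten.W m w (bas J)))"
      unfolding ten.ract_W by (rule lext_alt_on[OF finite_SS]) (auto simp: PhiJ_def)
    also have "\<dots> = (\<Sum>w\<in>SS d. smul (?h (J, w)) (ract (vRb m) (bas J) (bas w)))"
      by (rule sum.cong) (auto simp: PhiJ_def ten.ract_bas)
    finally show ?thesis .
  qed
  then have "herm v (Cv m n d v) = (\<Sum>p\<in>?S. conjK (?h p) * ?h p)"
    by (simp add: Cv_def herm_sum_right herm_smul_right sum.cartesian_product split_def)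
  then have "(\<Sum>p\<in>?S. ?h p * conjK (?h p)) = 0" using z by (simp add: mult.commute)
  then have h: "?h p = 0" if "p \<in> ?S" for p
    using sum_norm_eq_0[of ?S ?h p] that finite_wds finite_SS by blast
  have "v J = 0" for J
  proof (cases "J \<in> wds m n d")
    case True
    then show ?thesis using h[of "(J, id)"] herm_bas_right[OF v] by simp
  qed (use FS_outside[OF v] in blast)
  then show ?thesis by (simp add: fun_eq_iff pointwise)
qed

lemma Cv_inj: "inj_on (Cv m n d) (FS (wds m n d))"
proof (rule inj_onI)
  fix u v assume a: "u \<in> FS (wds m n d)" "v \<in> FS (wds m n d)" "Cv m n d u = Cv m n d v"
  then have "Cv m n d (u - v) = 0" using lin_diff[OF Cv_lin] by simp
  then have "u - v = 0" using a by (intro Cv_definite[of _ m n d]) auto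
  then show "u = v" by simp
qed

text \<open>The difference between \<open>u\<close> and its projection to the image is orthogonal to
  the image, in particular to its own value under \<open>Cv\<close>, and so vanishes by
  definiteness.\<close>

lemma Cv_surj: "Cv m n d ` FS (wds m n d) = FS (wds m n d)"
proof (rule antisym)
  let ?V = "FS (wds m n d)"
  show "Cv m n d ` ?V \<subseteq> ?V" using linD(1)[OF Cv_lin] by blast
  show "?V \<subseteq> Cv m n d ` ?V"
  proof
    fix u assume u: "u \<in> ?V"
    have sub: "kv.subspace (Cv m n d ` ?V)"
      unfolding kv.subspace_def using linD(2,3)[OF Cv_lin[of m n d], symmetric] lin_zero[OF Cv_lin[of m n d], symmetric]
      by (auto intro!: imageI intro: rev_image_eqI)
    have "Cv m n d ` ?V \<subseteq> ?V" using linD(1)[OF Cv_lin] by blast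
    from projection[OF finite_wds this u]
    obtain p where p: "p \<in> kspan (Cv m n d ` ?V)" "\<forall>x\<in>kspan (Cv m n d ` ?V). herm (u - p) x = 0" by blast
    have k: "kspan (Cv m n d ` ?V) = Cv m n d ` ?V" using sub by (simp add: kspan_eq_span kv.span_eq_iff)
    have up: "u - p \<in> ?V" using p(1) u linD(1)[OF Cv_lin] unfolding k by auto
    have "herm (u - p) (Cv m n d (u - p)) = 0" using p(2) up unfolding k by blast
    then have "u - p = 0" using up by (intro Cv_definite[of _ m n d])
    then show "u \<in> Cv m n d ` ?V" using p(1) unfolding k by simp
  qed
qed

text \<open>Write v as \<open>Cv\<close> of its preimage \<open>th v\<close>. Each
  \<open>PhiJ\<close> after \<open>th\<close> is linear over H_d with values in H_d, hence a
  combination of the maps \<open>Ew m P\<close>.\<close>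

lemma Cv_dual_basis:
  "\<exists>a. \<forall>v\<in>FS (wds m n d). v = (\<Sum>J\<in>wds m n d. ract (vRb m) (bas J)
      (\<Sum>P\<in>wds m n d. smul (a J P) (Ew m P (tens v (bas id)))))"
proof -
  let ?V = "FS (wds m n d)" and ?C = "Cv m n d"
  define th where "th = inv_into ?V ?C"
  have th: "th v \<in> ?V" "?C (th v) = v" if "v \<in> ?V" for v
    using that Cv_surj inv_into_into[of v ?C ?V] f_inv_into_f[of v ?C ?V] by (auto simp: th_def)
  have un: "th v = u" if "u \<in> ?V" "?C u = v" for u v
    using that Cv_inj by (auto simp: th_def inv_into_f_f)
  have tl: "lin (wds m n d) (wds m n d) th"
    unfolding lin_def using th linD(2,3)[OF Cv_lin[of m n d]] by (auto intro!: un)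
  have te: "th (lext (vRb m i) v) = lext (vRb m i) (th v)" if "v \<in> ?V" "1 \<le> i" "i < d" for v i
    by (rule un) (use th that ten.op_in[of i d _ m n] in \<open>auto simp: Cv_gen\<close>)
  have "\<forall>J\<in>wds m n d. \<exists>a. \<forall>v\<in>?V.
      PhiJ m d J (th v) = (\<Sum>P\<in>wds m n d. smul (a P) (Ew m P (tens v (bas id))))"
    by (intro ballI equivariant_maps_spanned[OF lin_comp[OF tl PhiJ_lin]]) (use te th PhiJ_gen in auto)
  from bchoice[OF this] obtain a where a: "\<forall>J\<in>wds m n d. \<forall>v\<in>?V.
      PhiJ m d J (th v) = (\<Sum>P\<in>wds m n d. smul (a J P) (Ew m P (tens v (bas id))))" ..
  have "v = (\<Sum>J\<in>wds m n d. ract (vRb m) (bas J) (\<Sum>P\<in>wds m n d. smul (a J P) (Ew m P (tens v (bas id)))))"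
    if "v \<in> ?V" for v
  proof -
    have "v = ?C (th v)" using th that by simp
    also have "\<dots> = (\<Sum>J\<in>wds m n d. ract (vRb m) (bas J) (\<Sum>P\<in>wds m n d. smul (a J P) (Ew m P (tens v (bas id)))))"
      unfolding Cv_def by (rule sum.cong) (use a that in auto)
    finally show ?thesis .
  qed
  then show ?thesis by (intro exI[of _ a]) blast
qed

lemma tens_sum_right: "tens v (\<Sum>i\<in>S. f i) = (\<Sum>i\<in>S. tens v (f i))"
  by (induction S rule: infinite_finite_induct) (auto simp: tens_add_right)

lemma tens_sum_left: "tens (\<Sum>i\<in>S. f i) x = (\<Sum>i\<in>S. tens (f i) x)"
  by (induction S rule: infinite_finite_induct) (auto simp: tens_add_left)

text \<open>Extension of scalars from H_d to H_N: the identity on tensor space is tensored with T_w,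
  and the elements of H_d in it cross the tensor sign at the cost of relations.\<close>

lemma dual_basis:
  assumes "d \<le> N"
  shows "\<exists>a. \<forall>f\<in>FS (wds m n d \<times> SS N).
    f - (\<Sum>J\<in>wds m n d. \<Sum>P\<in>wds m n d. smul (a J P) (tens (bas J) (Ew m P f))) \<in> Nall m n"
proof -
  let ?A = "wds m n d"
  obtain a where a: "\<And>v. v \<in> FS ?A \<Longrightarrow> v = (\<Sum>J\<in>?A. ract (vRb m) (bas J)
      (\<Sum>P\<in>?A. smul (a J P) (Ew m P (tens v (bas id)))))" using Cv_dual_basis by blast
  have len: "length P = d" if "P \<in> ?A" for P using that by (simp add: wds_def)
  let ?F = "\<lambda>f. f - (\<Sum>J\<in>?A. \<Sum>P\<in>?A. smul (a J P) (tens (bas J) (Ew m P f)))"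
  have Fl: "lin (?A \<times> SS N) (?A \<times> SS N) ?F"
    by (intro lin_minus lin_id order_refl lin_setsum lin_smul lin_comp[OF Ew_lin_graded tens_lin_right] assms len) auto
  have "?F f \<in> Nall m n" if "f \<in> FS (?A \<times> SS N)" for f
  proof (rule lin_in_subspace[OF Fl Nall_subspace _ that])
    fix p assume "p \<in> ?A \<times> SS N"
    then obtain I w where p: "p = (I, w)" and I: "I \<in> ?A" and w: "w \<in> SS N" by blast
    have wP: "bas w \<in> FS PP" using w SS_fperm by simp
    have bI: "bas I \<in> FS ?A" using I by simp
    have E: "Ew m P (bas (I, id)) \<in> FS (SS d)" if "P \<in> ?A" for P
      using linD(1)[OF Ew_word_lin[OF len[OF that]] bI] by (simp add: tens_bas)
    let ?h = "\<lambda>J. \<Sum>P\<in>?A. smul (a J P) (Ew m P (bas (I, id)))"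
    have h: "?h J \<in> FS (SS d)" for J using E by simp
    have Ew: "Ew m P (bas p) = Hmul (Ew m P (bas (I, id))) (bas w)" if "P \<in> ?A" for P
    proof -
      have "RM (bas w) (bas (I, id)) = bas p"
        using RM_tens_bas[OF wP, of "bas id" I] wP by (simp add: tens_bas p)
      then show ?thesis
        using Ew_RM[OF assms len[OF that], of "bas (I, id)" m n "bas w"] I w by simp
    qed
    have hw: "Hmul (?h J) (bas w) = (\<Sum>P\<in>?A. smul (a J P) (Ew m P (bas p)))" for J
      using lin_sum[OF Hmul_lin_left[OF wP], of ?A "\<lambda>P. smul (a J P) (Ew m P (bas (I, id)))"]
        FS_SS_PP[OF E] wP by (simp add: Ew Hmul_smul_left)
    have "(\<Sum>J\<in>?A. tens (ract (vRb m) (bas J) (?h J)) (bas w)) = bas p"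
      unfolding tens_sum_left[symmetric] using a[OF bI, symmetric] by (simp add: tens_bas p)
    moreover have "(\<Sum>J\<in>?A. tens (bas J) (Hmul (?h J) (bas w)))
        = (\<Sum>J\<in>?A. \<Sum>P\<in>?A. smul (a J P) (tens (bas J) (Ew m P (bas p))))"
      by (simp add: hw tens_sum_right tens_smul_right)
    moreover have "(\<Sum>J\<in>?A. tens (ract (vRb m) (bas J) (?h J)) (bas w) - tens (bas J) (Hmul (?h J) (bas w))) \<in> Nall m n"
      using N_rel[OF _ h wP] by (intro N_sum) (simp add: vact_ract)
    ultimately show "?F (bas p) \<in> Nall m n" by (simp add: sum_subtractf)
  qed
  then show ?thesis by blast
qed

section \<open>The quotient\<close>

lemma cos_eq: "cos m n f = cos m n g \<longleftrightarrow> f - g \<in> Nall m n"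
proof
  assume "cos m n f = cos m n g"
  moreover have "f \<in> cos m n f" using N_zero by (force simp: cos_def)
  ultimately obtain h where "h \<in> Nall m n" "f = g + h" by (auto simp: cos_def)
  then show "f - g \<in> Nall m n" by simp
next
  assume a: "f - g \<in> Nall m n"
  have "f + h = g + ((f - g) + h)" "g + h = f + (h - (f - g))" for h by (auto simp: algebra_simps)
  then show "cos m n f = cos m n g"
    unfolding cos_def using N_add[OF a] N_diff[OF _ a] by blast
qed

lemma rep_cos: "rep (cos m n f) - f \<in> Nall m n"
proof -
  have "f \<in> cos m n f" using N_zero by (force simp: cos_def)
  then have "rep (cos m n f) \<in> cos m n f" unfolding rep_def by (rule someI[where P = "\<lambda>g. g \<in> cos m n f"])
  then show ?thesis by (auto simp: cos_def)
qed

lemma rep_cos_in: "f \<in> FS (LW m n \<times> PP) \<Longrightarrow> rep (cos m n f) \<in> FS (LW m n \<times> PP)"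
  using FS_add[of "rep (cos m n f) - f" "LW m n \<times> PP" f] rep_cos[of m n f] Nall_Bsp by auto

text \<open>\<open>rep\<close> picks an arbitrary member of a class; a linear map that preserves the
  relations gives the same class for every choice.\<close>

lemma cos_lin_rep:
  assumes "lin (LW m n \<times> PP) (LW m n \<times> PP) F" "\<And>g. g \<in> Nall m n \<Longrightarrow> F g \<in> Nall m n"
    and "f \<in> FS (LW m n \<times> PP)"
  shows "cos m n (F (rep (cos m n f))) = cos m n (F f)"
  unfolding cos_eq using lin_diff[OF assms(1) rep_cos_in[OF assms(3)] assms(3)] assms(2)[OF rep_cos, of f]
  by simp

lemma qadd_cos: "qadd m n (cos m n f) (cos m n g) = cos m n (f + g)"
  unfolding qadd_def cos_eq using N_add[OF rep_cos[of m n f] rep_cos[of m n g]] by (simp add: algebra_simps)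

lemma qsmul_cos: "qsmul m n c (cos m n f) = cos m n (smul c f)"
  unfolding qsmul_def cos_eq using N_smul[OF rep_cos[of m n f], of c] by (simp add: smul_diff)

lemma tprod_degree_0: "f \<in> FS (LW m n \<times> PP) \<Longrightarrow> s \<in> FS PP \<Longrightarrow> tprod (tens (bas []) s) f = SL s f"
proof -
  assume f: "f \<in> FS (LW m n \<times> PP)" and s: "s \<in> FS PP"
  have t: "tprodb ([], t) (I, w) = tens (bas I) (Hmul (hshift (length I) (bas t)) (bas w))" for t I w
    by (simp add: tprodb_def)
  have tin: "tprodb p r \<in> FS (UNIV \<times> PP)" if "p \<in> {[]} \<times> PP" "r \<in> LW m n \<times> PP" for p r
    using that linD(1)[OF hshift_lin] by (auto simp: tprodb_def intro!: tens_in Hmul_PP)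
  show ?thesis
  proof (rule lin_eqI[of "LW m n \<times> PP" "UNIV \<times> PP" _ "LW m n \<times> PP" _ f, OF _ SL_lin[OF s] _ f])
    show "lin (LW m n \<times> PP) (UNIV \<times> PP) (tprod (tens (bas []) s))"
      unfolding tprod_def by (rule lin_lext_param[of _ "{[]} \<times> PP"]) (use s tin in \<open>auto intro!: lin_lext\<close>)
    fix r assume r: "r \<in> LW m n \<times> PP"
    then obtain I w where I: "r = (I, w)" "fperm w" by auto
    have "tprod (tens (bas []) s) (bas r) = lext (\<lambda>p. tprodb p r) (tens (bas []) s)" by (simp add: tprod_def)
    also have "\<dots> = tens (bas I) (Hmul (hshift (length I) s) (bas w))"
      by (rule lext_tens_bas[OF lin_comp[OF lin_comp[OF hshift_lin Hmul_lin_left] tens_lin_right[of _ UNIV]] _ s])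
        (use I t in auto)
    also have "\<dots> = SL s (bas r)" using SL_tens_bas[OF s, of "bas w" I] I by (simp add: tens_bas)
    finally show "tprod (tens (bas []) s) (bas r) = SL s (bas r)" .
  qed
qed

lemma tprod_scalar: "f \<in> FS (LW m n \<times> PP) \<Longrightarrow> h \<in> FS PP \<Longrightarrow> tprod f (tens (bas []) h) = RM h f"
  unfolding tprod_def RM_def
proof (rule lext_cong, assumption)
  fix p assume h: "h \<in> FS PP" and p: "p \<in> LW m n \<times> PP"
  then obtain J t where J: "p = (J, t)" "fperm t" by auto
  show "lext (tprodb p) (tens (bas []) h) = (case p of (I, w) \<Rightarrow> tens (bas I) (Hmul (bas w) h))"
    unfolding J prod.case
    by (rule lext_tens_bas[OF lin_comp[OF Hmul_lin_right tens_lin_right[of _ UNIV]] _ h])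
      (use J in \<open>auto simp: tprodb_def hshift_0\<close>)
qed

lemma tprod_vector:
  assumes f: "f \<in> FS (LW m n \<times> PP)" and v: "v \<in> Vvec m n"
  shows "tprod (tens (\<lambda>I. case I of [r] \<Rightarrow> v r | _ \<Rightarrow> 0) (bas id)) f = (\<Sum>r\<in>{1..m+n}. smul (v r) (App r f))"
proof -
  let ?t = "tens (\<lambda>I. case I of [r] \<Rightarrow> v r | _ \<Rightarrow> 0) (bas id)"
  let ?j = "\<lambda>r. ([r], id)"
  have "{p. ?t p \<noteq> 0} \<subseteq> ?j ` {1..m+n}"
    using v by (auto simp: tens_def bas_def Vvec_def split: list.splits if_splits)
  then have "tprod ?t f = (\<Sum>p\<in>?j ` {1..m+n}. smul (?t p) (lext (tprodb p) f))"
    unfolding tprod_def by (intro lext_alt_on) auto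
  also have "\<dots> = (\<Sum>r\<in>{1..m+n}. smul (?t (?j r)) (lext (tprodb (?j r)) f))"
    by (subst sum.reindex) (auto simp: inj_on_def comp_apply)
  also have "\<dots> = (\<Sum>r\<in>{1..m+n}. smul (v r) (App r f))"
  proof (rule sum.cong[OF refl])
    fix r
    have "?t (?j r) = v r" by (simp add: tens_def bas_def)
    then show "smul (?t (?j r)) (lext (tprodb (?j r)) f) = smul (v r) (App r f)"
      using tprod_letter[OF f, of r] by (simp add: tprod_bas)
  qed
  finally show ?thesis .
qed

section \<open>Descent of the operators to the quotient\<close>

lemma Lv_cos:
  assumes "f \<in> FS (LW m n \<times> PP)" "v \<in> Vvec m n"
  shows "Lv m n v (cos m n f) = cos m n (\<Sum>r\<in>{1..m+n}. smul (v r) (App r f))"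
  unfolding Lv_def tprod_vector[OF rep_cos_in[OF assms(1)] assms(2)]
  by (rule cos_lin_rep[OF _ _ assms(1)]) (auto intro!: lin_setsum lin_smul App_lin N_sum N_smul App_N simp del: One_nat_def)

lemma Ls_cos:
  assumes "f \<in> FS (LW m n \<times> PP)" "s \<in> FS PP"
  shows "Ls m n s (cos m n f) = cos m n (SL s f)"
  unfolding Ls_def tprod_degree_0[OF rep_cos_in[OF assms(1)] assms(2)]
  by (rule cos_lin_rep[OF SL_lin SL_N assms(1)]) (use assms in auto)

lemma Rop_cos:
  assumes "f \<in> FS (LW m n \<times> PP)" "h \<in> FS PP"
  shows "Rop m n h (cos m n f) = cos m n (RM h f)"
  unfolding Rop_def tprod_scalar[OF rep_cos_in[OF assms(1)] assms(2)]
  by (rule cos_lin_rep[OF RM_lin RM_N assms(1)]) (use assms in auto)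

lemma Ld_cos:
  assumes "f \<in> FS (LW m n \<times> PP)"
  shows "Ld m n v (cos m n f) = cos m n (\<Sum>j\<in>{1..m+n}. smul (v j) (Dop m j f))"
  unfolding Ld_def lext_Ldb[OF rep_cos_in[OF assms]]
  by (rule cos_lin_rep[OF _ _ assms]) (auto intro!: lin_setsum lin_smul Dop_lin N_sum N_smul Dop_N simp del: One_nat_def)

abbreviation Wb :: "nat \<Rightarrow> nat \<Rightarrow> nat \<Rightarrow> nat \<Rightarrow> bk set" where
  "Wb m n a N \<equiv> FS (wds m n a \<times> SS N)"

lemma Wsp_cos: "Wsp m n d k = cos m n ` Wb m n d (d + k)"
proof -
  have "{f \<in> Bsp m n. \<forall>I w. f (I, w) \<noteq> 0 \<longrightarrow> length I = d \<and> (\<forall>x>d+k. w x = x)} = Wb m n d (d + k)"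
    by (auto simp: Bsp_def FS_def wds_def SS_def)
  then show ?thesis unfolding Wsp_def by simp
qed

lemma Wb_in: "f \<in> Wb m n a N \<Longrightarrow> f \<in> FS (LW m n \<times> PP)"
  by (rule FS_mono[OF _ wds_LW_PP])

text \<open>The operator on classes has a linear lift \<open>F\<close> from degree \<open>a\<close>
  to degree \<open>b\<close> that commutes with right multiplication exactly, not merely modulo
  relations. In this form the property survives composition and linear combination.\<close>

definition induced :: "nat \<Rightarrow> nat \<Rightarrow> nat \<Rightarrow> nat \<Rightarrow> nat \<Rightarrow> (bk set \<Rightarrow> bk set) \<Rightarrow> (bk \<Rightarrow> bk) \<Rightarrow> bool" where
  "induced m n N a b op F \<longleftrightarrow> lin (wds m n a \<times> SS N) (wds m n b \<times> SS N) F
     \<and> (\<forall>f\<in>Wb m n a N. op (cos m n f) = cos m n (F f))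
     \<and> (\<forall>h\<in>FS (SS N). \<forall>f\<in>Wb m n a N. F (RM h f) = RM h (F f))"

lemma induced_comp:
  assumes "induced m n N a b op F" "induced m n N b c op' F'"
  shows "induced m n N a c (\<lambda>x. op' (op x)) (\<lambda>f. F' (F f))"
  using assms lin_comp[of _ _ F _ F'] linD(1)[of "wds m n a \<times> SS N" "wds m n b \<times> SS N" F]
  unfolding induced_def by auto

lemma induced_id: "induced m n N a a (\<lambda>x. x) (\<lambda>f. f)"
  by (auto simp: induced_def lin_id)

lemma RM_sum_smul:
  assumes "h \<in> FS PP" "\<And>i. i \<in> S \<Longrightarrow> f i \<in> FS (A \<times> PP)"
  shows "RM h (\<Sum>i\<in>S. smul (c i) (f i)) = (\<Sum>i\<in>S. smul (c i) (RM h (f i)))"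
  using lin_sum[OF RM_lin[OF assms(1)], of S "\<lambda>i. smul (c i) (f i)" A] assms(2)
  by (simp add: linD(3)[OF RM_lin[OF assms(1)], of _ A])

lemma induced_Lv:
  assumes "v \<in> Vvec m n"
  shows "induced m n N a (Suc a) (Lv m n v) (\<lambda>f. \<Sum>r\<in>{1..m+n}. smul (v r) (App r f))"
  unfolding induced_def
proof (intro conjI ballI)
  show "lin (wds m n a \<times> SS N) (wds m n (Suc a) \<times> SS N) (\<lambda>f. \<Sum>r\<in>{1..m+n}. smul (v r) (App r f))"
    by (intro lin_setsum lin_smul App_lin_graded)
  fix f assume f: "f \<in> Wb m n a N"
  show "Lv m n v (cos m n f) = cos m n (\<Sum>r\<in>{1..m+n}. smul (v r) (App r f))"
    by (rule Lv_cos[OF Wb_in[OF f] assms])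
  fix h assume h: "h \<in> FS (SS N)"
  show "(\<Sum>r\<in>{1..m+n}. smul (v r) (App r (RM h f))) = RM h (\<Sum>r\<in>{1..m+n}. smul (v r) (App r f))"
    using RM_sum_smul[OF FS_SS_PP[OF h], of "{1..m+n}" "\<lambda>r. App r f" "LW m n"]
      linD(1)[OF App_lin Wb_in[OF f]] App_RM[OF FS_SS_PP[OF h] Wb_in[OF f]] by simp
qed

lemma induced_Ld:
  assumes "a \<le> N"
  shows "induced m n N a (a - 1) (Ld m n v) (\<lambda>f. \<Sum>j\<in>{1..m+n}. smul (v j) (Dop m j f))"
  unfolding induced_def
proof (intro conjI ballI)
  show "lin (wds m n a \<times> SS N) (wds m n (a - 1) \<times> SS N) (\<lambda>f. \<Sum>j\<in>{1..m+n}. smul (v j) (Dop m j f))"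
    by (intro lin_setsum lin_smul Dop_lin_graded assms)
  fix f assume f: "f \<in> Wb m n a N"
  show "Ld m n v (cos m n f) = cos m n (\<Sum>j\<in>{1..m+n}. smul (v j) (Dop m j f))"
    by (rule Ld_cos[OF Wb_in[OF f]])
  fix h assume h: "h \<in> FS (SS N)"
  show "(\<Sum>j\<in>{1..m+n}. smul (v j) (Dop m j (RM h f))) = RM h (\<Sum>j\<in>{1..m+n}. smul (v j) (Dop m j f))"
    using RM_sum_smul[OF FS_SS_PP[OF h], of "{1..m+n}" "\<lambda>j. Dop m j f" "LW m n"]
      linD(1)[OF Dop_lin Wb_in[OF f]] Dop_RM[OF FS_SS_PP[OF h] Wb_in[OF f]] by simp
qed

text \<open>In degree zero the shift is trivial, so multiplication by \<open>s\<close> stays inside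
  H_N. The generators of the operator algebra apply L(s) in this degree only.\<close>

lemma induced_Ls:
  assumes "s \<in> FS (SS N)"
  shows "induced m n N 0 0 (Ls m n s) (SL s)"
  unfolding induced_def
proof (intro conjI ballI)
  show "lin (wds m n 0 \<times> SS N) (wds m n 0 \<times> SS N) (SL s)"
    unfolding SL_def
    by (rule lin_lext) (use assms hshift_0[OF FS_SS_PP[OF assms]] in \<open>auto simp: wds_def intro!: tens_in Hmul_SS\<close>)
  fix f assume f: "f \<in> Wb m n 0 N"
  show "Ls m n s (cos m n f) = cos m n (SL s f)"
    by (rule Ls_cos[OF Wb_in[OF f] FS_SS_PP[OF assms]])
  fix h assume h: "h \<in> FS (SS N)"
  show "SL s (RM h f) = RM h (SL s f)"
    by (rule SL_RM[OF FS_SS_PP[OF h] Wb_in[OF f] FS_SS_PP[OF assms]])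
qed

section \<open>The operator algebra\<close>

definition AF :: "nat \<Rightarrow> nat \<Rightarrow> (nat \<Rightarrow> K) \<Rightarrow> bk \<Rightarrow> bk" where
  "AF m n v f = (\<Sum>r\<in>{1..m+n}. smul (v r) (App r f))"

definition DF :: "nat \<Rightarrow> nat \<Rightarrow> (nat \<Rightarrow> K) \<Rightarrow> bk \<Rightarrow> bk" where
  "DF m n v f = (\<Sum>j\<in>{1..m+n}. smul (v j) (Dop m j f))"

lemma sum_smul_bas: "finite S \<Longrightarrow> r \<in> S \<Longrightarrow> (\<Sum>i\<in>S. smul (bas r i) (f i)) = f r"
proof -
  assume a: "finite S" "r \<in> S"
  have "(\<Sum>i\<in>S. smul (bas r i) (f i)) = (\<Sum>i\<in>S. if i = r then f i else 0)"
    by (rule sum.cong) (auto simp: bas_def)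
  then show ?thesis using a by simp
qed

lemma AF_bas: "r \<in> {1..m+n} \<Longrightarrow> AF m n (bas r) f = App r f"
  unfolding AF_def by (rule sum_smul_bas) auto

lemma DF_bas: "j \<in> {1..m+n} \<Longrightarrow> DF m n (bas j) f = Dop m j f"
  unfolding DF_def by (rule sum_smul_bas) auto

lemma induced_fold_Lv:
  "set ws \<subseteq> Vvec m n \<Longrightarrow> induced m n N a (a + length ws) (fold (Lv m n) ws) (fold (AF m n) ws)"
proof (induction ws arbitrary: a)
  case Nil
  show ?case using induced_id[of m n N a] by (simp add: id_def)
next
  case (Cons w ws)
  have "induced m n N a (Suc a) (Lv m n w) (AF m n w)"
    using induced_Lv[of w m n N a] Cons.prems by (simp add: AF_def[abs_def])
  from induced_comp[OF this Cons.IH[of "Suc a"]] show ?case using Cons.prems by (simp add: comp_def)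
qed

lemma induced_foldr_Ld:
  "a \<le> N \<Longrightarrow> induced m n N a (a - length vs) (foldr (Ld m n) vs) (foldr (DF m n) vs)"
proof (induction vs)
  case Nil
  show ?case using induced_id[of m n N a] by (simp add: id_def)
next
  case (Cons v vs)
  have "induced m n N (a - length vs) (a - length vs - 1) (Ld m n v) (DF m n v)"
    using induced_Ld[of "a - length vs" N m n v] Cons.prems by (simp add: DF_def[abs_def])
  from induced_comp[OF Cons.IH this] show ?case using Cons.prems by (simp add: comp_def)
qed

lemma induced_gen:
  assumes "length ws = d" "set ws \<subseteq> Vvec m n" "s \<in> FS (SS N)" "length vs = d" "d \<le> N"
  shows "induced m n N d d (\<lambda>x. fold (\<lambda>w y. Lv m n w y) ws (Ls m n s (foldr (\<lambda>v y. Ld m n v y) vs x)))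
    (\<lambda>f. fold (AF m n) ws (SL s (foldr (DF m n) vs f)))"
proof -
  have "induced m n N d 0 (foldr (Ld m n) vs) (foldr (DF m n) vs)"
    using induced_foldr_Ld[of d N m n vs] assms by simp
  from induced_comp[OF induced_comp[OF this induced_Ls[OF assms(3)]]] induced_fold_Lv[OF assms(2), of N 0]
  show ?thesis using assms(1) by simp
qed

lemma Agen_induced: "op \<in> Agen m n d k \<Longrightarrow> \<exists>F. induced m n (d + k) d d op F"
  unfolding Agen_def Hsub_FS using induced_gen[of _ d m n _ "d + k"] by auto

lemma induced_smul_add:
  assumes "induced m n N a b op F" "induced m n N a b op' F'"
  shows "induced m n N a b (\<lambda>x. qadd m n (qsmul m n c (op x)) (op' x)) (\<lambda>f. smul c (F f) + F' f)"
proof -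
  have l: "lin (wds m n a \<times> SS N) (wds m n b \<times> SS N) F" "lin (wds m n a \<times> SS N) (wds m n b \<times> SS N) F'"
    using assms by (auto simp: induced_def)
  have "RM h (smul c (F f) + F' f) = smul c (RM h (F f)) + RM h (F' f)"
    if "h \<in> FS (SS N)" "f \<in> Wb m n a N" for h f
    using linD(2,3)[OF RM_lin_SS[OF that(1), of "wds m n b"]] linD(1)[OF l(1) that(2)] linD(1)[OF l(2) that(2)] by simp
  then show ?thesis
    using assms lin_add[OF lin_smul[OF l(1)] l(2)] by (auto simp: induced_def qadd_cos qsmul_cos)
qed

lemma Aspan_induced:
  assumes "\<psi> \<in> Aspan m n d k"
  shows "\<exists>F. induced m n (d + k) d d \<psi> F"
proof -
  have "\<exists>F. induced m n (d + k) d d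
      (\<lambda>x. foldr (\<lambda>(c, op) acc. qadd m n (qsmul m n c (op x)) acc) (zip cs os) (qzero m n)) F"
    if "length cs = length os" "set os \<subseteq> Agen m n d k" for cs os
    using that
  proof (induction cs os rule: list_induct2)
    case Nil
    have "induced m n (d + k) d d (\<lambda>x. qzero m n) (\<lambda>f. 0)"
      by (auto simp: induced_def qzero_def lin_0)
    then show ?case by (auto simp: id_apply)
  next
    case (Cons c cs op os)
    then obtain F' where F': "induced m n (d + k) d d
      (\<lambda>x. foldr (\<lambda>(c, op) acc. qadd m n (qsmul m n c (op x)) acc) (zip cs os) (qzero m n)) F'" by auto
    obtain F where F: "induced m n (d + k) d d op F" using Agen_induced[of op m n d k] Cons.prems by auto
    show ?case using induced_smul_add[OF F F', of c] by (auto simp: comp_apply)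
  qed
  then show ?thesis using assms unfolding Aspan_def by auto
qed

lemma Aspan_sum:
  assumes "finite S" "\<And>i. i \<in> S \<Longrightarrow> \<exists>op\<in>Agen m n d k. \<forall>f\<in>Wb m n d (d + k). op (cos m n f) = cos m n (F i f)"
  shows "\<exists>\<psi>\<in>Aspan m n d k. \<forall>f\<in>Wb m n d (d + k). \<psi> (cos m n f) = cos m n (\<Sum>i\<in>S. smul (c i) (F i f))"
  using assms
proof (induction S rule: finite_induct)
  case empty
  have "(\<lambda>x. qzero m n) \<in> Aspan m n d k"
    unfolding Aspan_def by (rule CollectI, rule exI[of _ "[]"], rule exI[of _ "[]"]) (simp add: id_apply)
  then show ?case by (rule rev_bexI) (simp add: qzero_def)
next
  case (insert i S)
  obtain \<psi> where \<psi>: "\<psi> \<in> Aspan m n d k"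
    "\<forall>f\<in>Wb m n d (d + k). \<psi> (cos m n f) = cos m n (\<Sum>i\<in>S. smul (c i) (F i f))"
    using insert by auto
  obtain op where op: "op \<in> Agen m n d k" "\<forall>f\<in>Wb m n d (d + k). op (cos m n f) = cos m n (F i f)"
    using insert.prems[of i] by auto
  obtain os cs where os: "set os \<subseteq> Agen m n d k" "length cs = length os"
    "\<psi> = (\<lambda>x. foldr (\<lambda>(c, op) acc. qadd m n (qsmul m n c (op x)) acc) (zip cs os) (qzero m n))"
    using \<psi>(1) unfolding Aspan_def by blast
  have "(\<lambda>x. qadd m n (qsmul m n (c i) (op x)) (\<psi> x)) \<in> Aspan m n d k"
    unfolding Aspan_def
    by (rule CollectI, rule exI[of _ "op # os"], rule exI[of _ "c i # cs"]) (use os op in \<open>simp add: comp_apply\<close>)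
  then show ?case
    by (rule rev_bexI) (use insert.hyps \<psi>(2) op(2) in \<open>simp add: qadd_cos qsmul_cos\<close>)
qed

lemma fold_AF:
  "I \<in> LW m n \<Longrightarrow> x \<in> FS PP \<Longrightarrow> fold (AF m n) (map bas I) (tens (bas J) x) = tens (bas (J @ I)) x"
proof (induction I arbitrary: J)
  case (Cons r I)
  then have "AF m n (bas r) (tens (bas J) x) = tens (bas (J @ [r])) x"
    using AF_bas[of r m n] by (simp add: App_tens_bas)
  then show ?case using Cons by (simp add: comp_apply)
qed (simp add: id_apply)

lemma foldr_DF: "P \<in> LW m n \<Longrightarrow> foldr (DF m n) (map bas P) f = EE m P f"
  by (induction P) (auto simp: EE_def comp_apply id_apply DF_bas)

text \<open>With basis vectors as entries, a generator removes letters according to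
  \<open>P\<close>, multiplies the resulting Hecke element by \<open>z\<close> from the left and
  then attaches the word \<open>I\<close>.\<close>

lemma rank_one_Agen:
  assumes I: "I \<in> wds m n d" and P: "P \<in> wds m n d" and z: "z \<in> FS (SS (d + k))"
  shows "\<exists>op\<in>Agen m n d k. \<forall>f\<in>Wb m n d (d + k). op (cos m n f) = cos m n (tens (bas I) (Hmul z (Ew m P f)))"
proof -
  let ?N = "d + k"
  define op where "op = (\<lambda>x. fold (\<lambda>w y. Lv m n w y) (map bas I) (Ls m n z (foldr (\<lambda>v y. Ld m n v y) (map bas P) x)))"
  have V: "set (map bas I) \<subseteq> Vvec m n" "set (map bas P) \<subseteq> Vvec m n"
    using I P by (auto simp: wds_def Vvec_def bas_def split: if_splits)
  have "op \<in> Agen m n d k"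
    unfolding op_def Agen_def Hsub_FS
    by (rule CollectI, rule exI[of _ "map bas I"], rule exI[of _ z], rule exI[of _ "map bas P"])
      (use V I P z in \<open>auto simp: wds_def\<close>)
  moreover have "op (cos m n f) = cos m n (tens (bas I) (Hmul z (Ew m P f)))" if f: "f \<in> Wb m n d ?N" for f
  proof -
    have "induced m n ?N d d op (\<lambda>f. fold (AF m n) (map bas I) (SL z (foldr (DF m n) (map bas P) f)))"
      unfolding op_def by (rule induced_gen) (use V I P z in \<open>auto simp: wds_def\<close>)
    then have "op (cos m n f) = cos m n (fold (AF m n) (map bas I) (SL z (foldr (DF m n) (map bas P) f)))"
      using f by (simp add: induced_def)
    also have "foldr (DF m n) (map bas P) f = tens (bas []) (Ew m P f)"
      using foldr_DF[of P m n f] EE_Ew[of d ?N P f m n] P f by (simp add: wds_def)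
    also have "SL z \<dots> = tens (bas []) (Hmul z (Ew m P f))"
      using SL_tens_bas[OF FS_SS_PP[OF z] linD(1)[OF Ew_lin Wb_in[OF f]]] hshift_0[OF FS_SS_PP[OF z]] by simp
    also have "fold (AF m n) (map bas I) \<dots> = tens (bas I) (Hmul z (Ew m P f))"
      using fold_AF[of I m n "Hmul z (Ew m P f)" "[]"] I Hmul_PP[OF FS_SS_PP[OF z] linD(1)[OF Ew_lin Wb_in[OF f]]]
      by (simp add: wds_def)
    finally show ?thesis .
  qed
  ultimately show ?thesis by blast
qed

text \<open>Expand \<open>w i\<close> in the elements e_I \<otimes> T_u and absorb T_u into the
  Hecke element: then f \<mapsto> w z E_P(f) lies in the span for an arbitrary \<open>w\<close>, not
  only for a basis word.\<close>

lemma rank_one_Aspan: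
  assumes S: "finite S" and P: "\<And>i. i \<in> S \<Longrightarrow> P i \<in> wds m n d"
    and z: "\<And>i. i \<in> S \<Longrightarrow> z i \<in> FS (SS (d + k))" and w: "\<And>i. i \<in> S \<Longrightarrow> w i \<in> Wb m n d (d + k)"
  shows "\<exists>\<psi>\<in>Aspan m n d k. \<forall>f\<in>Wb m n d (d + k).
     \<psi> (cos m n f) = cos m n (\<Sum>i\<in>S. smul (c i) (RM (Hmul (z i) (Ew m (P i) f)) (w i)))"
proof -
  let ?N = "d + k"
  let ?B = "wds m n d \<times> SS ?N"
  have B: "finite ?B" using finite_wds finite_SS by blast
  let ?c = "\<lambda>j. case j of (i, p) \<Rightarrow> c i * w i p"
  let ?F = "\<lambda>j f. case j of (i, I, u) \<Rightarrow> tens (bas I) (Hmul (Hmul (bas u) (z i)) (Ew m (P i) f))"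
  have "\<exists>\<psi>\<in>Aspan m n d k. \<forall>f\<in>Wb m n d ?N. \<psi> (cos m n f) = cos m n (\<Sum>j\<in>S \<times> ?B. smul (?c j) (?F j f))"
  proof (rule Aspan_sum)
    show "finite (S \<times> ?B)" using S B by blast
    fix j assume "j \<in> S \<times> ?B"
    then obtain i I u where i: "j = (i, I, u)" "i \<in> S" "I \<in> wds m n d" "u \<in> SS ?N" by auto
    then show "\<exists>op\<in>Agen m n d k. \<forall>f\<in>Wb m n d ?N. op (cos m n f) = cos m n (?F j f)"
      using rank_one_Agen[OF i(3) P[OF i(2)], of "Hmul (bas u) (z i)"] z by simp
  qed
  then obtain \<psi> where \<psi>: "\<psi> \<in> Aspan m n d k"
    "\<forall>f\<in>Wb m n d ?N. \<psi> (cos m n f) = cos m n (\<Sum>j\<in>S \<times> ?B. smul (?c j) (?F j f))" by (rule bexE)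
  have "(\<Sum>j\<in>S \<times> ?B. smul (?c j) (?F j f)) = (\<Sum>i\<in>S. smul (c i) (RM (Hmul (z i) (Ew m (P i) f)) (w i)))" if f: "f \<in> Wb m n d ?N" for f
  proof -
    have E: "Ew m Q f \<in> FS PP" for Q using linD(1)[OF Ew_lin Wb_in[OF f]] .
    have "RM (Hmul (z i) (Ew m (P i) f)) (w i)
       = (\<Sum>p\<in>?B. smul (w i p) (case p of (I, u) \<Rightarrow> tens (bas I) (Hmul (Hmul (bas u) (z i)) (Ew m (P i) f))))"
      if i: "i \<in> S" for i
    proof -
      have "RM (Hmul (z i) (Ew m (P i) f)) (w i)
        = (\<Sum>p\<in>?B. smul (w i p) (case p of (I, u) \<Rightarrow> tens (bas I) (Hmul (bas u) (Hmul (z i) (Ew m (P i) f)))))"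
        unfolding RM_def by (rule lext_alt_on[OF B]) (use w[OF i] in \<open>auto simp: FS_def\<close>)
      also have "\<dots> = (\<Sum>p\<in>?B. smul (w i p) (case p of (I, u) \<Rightarrow> tens (bas I) (Hmul (Hmul (bas u) (z i)) (Ew m (P i) f))))"
        by (rule sum.cong) (use FS_SS_PP[OF z[OF i]] E SS_fperm in \<open>auto simp: Hmul_assoc\<close>)
      finally show ?thesis .
    qed
    then show ?thesis by (simp add: smul_sum sum.cartesian_product split_def)
  qed
  then show ?thesis using \<psi> by (intro bexI[OF _ \<psi>(1)]) simp
qed

section \<open>The commutant of the Hecke algebra\<close>

lemma linW_sum:
  assumes \<phi>: "linW m n d k \<phi>" and S: "finite S"
    and f: "\<And>i. i \<in> S \<Longrightarrow> f i \<in> Wb m n d (d + k)" and f': "\<And>i. i \<in> S \<Longrightarrow> \<phi> (cos m n (f i)) = cos m n (f' i)"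
  shows "\<phi> (cos m n (\<Sum>i\<in>S. smul (c i) (f i))) = cos m n (\<Sum>i\<in>S. smul (c i) (f' i))"
  using S f f'
proof (induction S rule: finite_induct)
  case empty
  have z: "cos m n 0 \<in> Wsp m n d k" unfolding Wsp_cos by simp
  then obtain g where "\<phi> (cos m n 0) = cos m n g" using \<phi> unfolding linW_def Wsp_cos by blast
  moreover have "\<phi> (qsmul m n 0 (cos m n 0)) = qsmul m n 0 (\<phi> (cos m n 0))"
    using \<phi> z unfolding linW_def by blast
  ultimately show ?case by (simp add: qsmul_cos)
next
  case (insert i S)
  let ?g = "\<Sum>i\<in>S. smul (c i) (f i)"
  have W: "cos m n (f i) \<in> Wsp m n d k" "cos m n (smul (c i) (f i)) \<in> Wsp m n d k" "cos m n ?g \<in> Wsp m n d k"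
    using insert.prems unfolding Wsp_cos by auto
  have "\<phi> (qadd m n (cos m n (smul (c i) (f i))) (cos m n ?g))
      = qadd m n (\<phi> (cos m n (smul (c i) (f i)))) (\<phi> (cos m n ?g))"
    using \<phi> W unfolding linW_def by blast
  moreover have "\<phi> (qsmul m n (c i) (cos m n (f i))) = qsmul m n (c i) (\<phi> (cos m n (f i)))"
    using \<phi> W unfolding linW_def by blast
  ultimately show ?case using insert by (simp add: qadd_cos qsmul_cos)
qed

lemma linW_cos: "linW m n d k \<phi> \<Longrightarrow> f \<in> Wb m n d (d + k) \<Longrightarrow> \<exists>g\<in>Wb m n d (d + k). \<phi> (cos m n f) = cos m n g"
  unfolding linW_def Wsp_cos by blast

lemma linW_induced:
  assumes "induced m n (d + k) d d \<psi> F" "\<And>x. x \<in> Wsp m n d k \<Longrightarrow> \<phi> x = \<psi> x"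
  shows "linW m n d k \<phi>"
proof -
  have l: "lin (wds m n d \<times> SS (d + k)) (wds m n d \<times> SS (d + k)) F"
    and e: "\<And>f. f \<in> Wb m n d (d + k) \<Longrightarrow> \<phi> (cos m n f) = cos m n (F f)"
    using assms by (auto simp: induced_def Wsp_cos)
  show ?thesis unfolding linW_def Wsp_cos
    using linD[OF l] e by (auto simp: qadd_cos qsmul_cos)
qed

lemma Aspan_EndH:
  assumes "\<psi> \<in> Aspan m n d k" "\<forall>x\<in>Wsp m n d k. \<phi> x = \<psi> x"
  shows "EndH m n d k \<phi>"
proof -
  obtain F where F: "induced m n (d + k) d d \<psi> F" using Aspan_induced[OF assms(1)] by blast
  have l: "lin (wds m n d \<times> SS (d + k)) (wds m n d \<times> SS (d + k)) F"
    and e: "\<And>f. f \<in> Wb m n d (d + k) \<Longrightarrow> \<phi> (cos m n f) = cos m n (F f)"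
    and r: "\<And>h f. h \<in> FS (SS (d + k)) \<Longrightarrow> f \<in> Wb m n d (d + k) \<Longrightarrow> F (RM h f) = RM h (F f)"
    using F assms(2) by (auto simp: induced_def Wsp_cos)
  have "\<phi> (Rop m n h (cos m n f)) = Rop m n h (\<phi> (cos m n f))"
    if h: "h \<in> FS (SS (d + k))" and f: "f \<in> Wb m n d (d + k)" for h f
    using Rop_cos[OF Wb_in[OF f] FS_SS_PP[OF h]] Rop_cos[OF Wb_in[OF linD(1)[OF l f]] FS_SS_PP[OF h]]
      e[OF f] e[OF linD(1)[OF RM_lin_SS[OF h] f]] r[OF h f] by simp
  then show ?thesis unfolding EndH_def Hsub_FS Wsp_cos[of m n d k]
    using linW_induced[OF F] assms(2) by auto
qed

lemma EndH_Aspan: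
  assumes "EndH m n d k \<phi>"
  shows "\<exists>\<psi>\<in>Aspan m n d k. \<forall>x\<in>Wsp m n d k. \<phi> x = \<psi> x"
proof -
  let ?A = "wds m n d" and ?N = "d + k"
  have \<phi>: "linW m n d k \<phi>" using assms by (simp add: EndH_def)
  have R: "\<phi> (Rop m n h (cos m n f)) = Rop m n h (\<phi> (cos m n f))"
    if "h \<in> FS (SS ?N)" "f \<in> Wb m n d ?N" for h f
    using assms that by (auto simp: EndH_def Hsub_FS Wsp_cos)
  obtain a where a: "\<And>f. f \<in> Wb m n d ?N \<Longrightarrow>
      f - (\<Sum>J\<in>?A. \<Sum>P\<in>?A. smul (a J P) (tens (bas J) (Ew m P f))) \<in> Nall m n"
    using dual_basis[of d ?N m n] by auto
  have "\<forall>J\<in>?A. \<exists>g. g \<in> Wb m n d ?N \<and> \<phi> (cos m n (bas (J, id))) = cos m n g"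
    using linW_cos[OF \<phi>] by (intro ballI) (auto simp: Bex_def)
  from bchoice[OF this] obtain g where
    g: "\<forall>J\<in>?A. g J \<in> Wb m n d ?N \<and> \<phi> (cos m n (bas (J, id))) = cos m n (g J)" ..
  let ?S = "?A \<times> ?A"
  \<comment> \<open>The vectors of the rank one operators are representatives \<open>g J\<close> of
    the images of e_J \<otimes> 1 under \<open>\<phi>\<close>, with the scalars of the dual basis
    identity.\<close>
  obtain \<psi> where \<psi>: "\<psi> \<in> Aspan m n d k" "\<forall>f\<in>Wb m n d ?N. \<psi> (cos m n f) = cos m n
      (\<Sum>i\<in>?S. smul (a (fst i) (snd i)) (RM (Hmul (bas id) (Ew m (snd i) f)) (g (fst i))))"
    using rank_one_Aspan[of ?S snd m n d "\<lambda>i. bas id" k "\<lambda>i. g (fst i)" "\<lambda>i. a (fst i) (snd i)"] g finite_wds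
    by auto
  have "\<phi> (cos m n f) = \<psi> (cos m n f)" if f: "f \<in> Wb m n d ?N" for f
  proof -
    have E: "Ew m P f \<in> FS (SS ?N)" if "P \<in> ?A" for P
      using linD(1)[OF Ew_lin_graded[of d ?N P m n] f] that by (simp add: wds_def)
    have "cos m n f = cos m n (\<Sum>i\<in>?S. smul (a (fst i) (snd i)) (tens (bas (fst i)) (Ew m (snd i) f)))"
      unfolding cos_eq using a[OF f] by (simp add: sum.cartesian_product split_def)
    also have "\<phi> \<dots> = cos m n (\<Sum>i\<in>?S. smul (a (fst i) (snd i)) (RM (Ew m (snd i) f) (g (fst i))))"
    proof (rule linW_sum[OF \<phi>])
      show "finite ?S" using finite_wds by blast
      fix i assume i: "i \<in> ?S"
      then show "tens (bas (fst i)) (Ew m (snd i) f) \<in> Wb m n d ?N" using E by auto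
      have e: "Ew m (snd i) f \<in> FS (SS ?N)" and J: "fst i \<in> ?A" using i E by auto
      have b: "bas (fst i, id) \<in> Wb m n d ?N" using J by simp
      have "tens (bas (fst i)) (Ew m (snd i) f) = RM (Ew m (snd i) f) (bas (fst i, id))"
        using RM_tens_bas[OF FS_SS_PP[OF e], of "bas id" "fst i"] FS_SS_PP[OF e] by (simp add: tens_bas)
      then show "\<phi> (cos m n (tens (bas (fst i)) (Ew m (snd i) f))) = cos m n (RM (Ew m (snd i) f) (g (fst i)))"
        using R[OF e b] Rop_cos[OF Wb_in[OF b] FS_SS_PP[OF e]] g J Rop_cos[OF Wb_in FS_SS_PP[OF e], of "g (fst i)" m n d ?N]
        by simp
    qed
    also have "\<dots> = \<psi> (cos m n f)"
    proof -
      have "(\<Sum>i\<in>?S. smul (a (fst i) (snd i)) (RM (Ew m (snd i) f) (g (fst i))))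
        = (\<Sum>i\<in>?S. smul (a (fst i) (snd i)) (RM (Hmul (bas id) (Ew m (snd i) f)) (g (fst i))))"
        by (rule sum.cong) (use FS_SS_PP[OF E] in auto)
      then show ?thesis using \<psi>(2) f by simp
    qed
    finally show ?thesis .
  qed
  then show ?thesis using \<psi>(1) unfolding Wsp_cos by blast
qed
section \<open>The commutant of the operator algebra\<close>

lemma lin_kspan:
  assumes "lin B B F" "S \<subseteq> FS B" "F ` S \<subseteq> kspan S" "x \<in> kspan S"
  shows "F x \<in> kspan S"
proof -
  obtain G c where G: "finite G" "G \<subseteq> S" and x: "x = (\<Sum>g\<in>G. smul (c g) g)"
    using assms(4) unfolding kspan_def by blast
  have "g \<in> FS B" if "g \<in> G" for g using G assms(2) that by blast
  then have "F x = (\<Sum>g\<in>G. smul (c g) (F g))"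
    unfolding x using lin_sum[OF assms(1), of G "\<lambda>g. smul (c g) g"] by (simp add: linD(3)[OF assms(1)])
  then show ?thesis
    using G assms(3) unfolding kspan_eq_span by (auto intro!: kv.span_sum kv.span_scale)
qed

text \<open>The form makes the Hecke algebra closed under adjoints, so \<open>y\<close> vanishes because \<open>y y* y\<close> does.\<close>
lemma Hecke_semiprime:
  assumes y: "y \<in> FS (SS N)" and z: "\<And>h. h \<in> FS (SS N) \<Longrightarrow> Hmul (Hmul y h) y = 0"
  shows "y = 0"
proof -
  obtain y' where y': "y' \<in> FS (SS N)"
    and adj: "\<And>v u. v \<in> FS (SS N) \<Longrightarrow> u \<in> FS (SS N) \<Longrightarrow> herm (Hmul v y) u = herm v (Hmul u y')"
    using reg.adjoint[OF y] unfolding Hmul_ract by blast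
  have yy: "Hmul y y' \<in> FS (SS N)" using y y' by simp
  have "herm (Hmul y y') (Hmul y y') = 0" using adj[OF yy y] z[OF y'] by simp
  then have "Hmul y y' = 0" using herm_definite[OF yy] by blast
  then have "herm y y = 0" using adj[of "bas id" y] y FS_SS_PP[OF y] by simp
  then show ?thesis using herm_definite[OF y] by blast
qed

text \<open>Left multiples of all values of the maps E_P on W; they span the trace ideal of
  W.\<close>

definition trace_gens :: "nat \<Rightarrow> nat \<Rightarrow> nat \<Rightarrow> nat \<Rightarrow> hk set" where
  "trace_gens m n d N = {Hmul y (Ew m P x) | y P x. y \<in> FS (SS N) \<and> P \<in> wds m n d \<and> x \<in> Wb m n d N}"

lemma trace_gens_SS:
  assumes "d \<le> N"
  shows "trace_gens m n d N \<subseteq> FS (SS N)"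
proof
  fix g assume "g \<in> trace_gens m n d N"
  then obtain y P x where g: "g = Hmul y (Ew m P x)" "y \<in> FS (SS N)" "P \<in> wds m n d" "x \<in> Wb m n d N"
    unfolding trace_gens_def by blast
  have "Ew m P x \<in> FS (SS N)"
    using linD(1)[OF Ew_lin_graded[OF assms] g(4)] g(3) by (simp add: wds_def)
  then show "g \<in> FS (SS N)" using g by simp
qed

text \<open>A left factor is absorbed by \<open>y\<close>, a right factor by \<open>x\<close>, since
  \<open>Ew m P\<close> commutes with right multiplication.\<close>

lemma trace_ideal:
  assumes d: "d \<le> N" and y: "y \<in> kspan (trace_gens m n d N)" and h: "h \<in> FS (SS N)"
  shows "Hmul h y \<in> kspan (trace_gens m n d N)" "Hmul y h \<in> kspan (trace_gens m n d N)"
proof -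
  let ?G = "trace_gens m n d N"
  have E: "Ew m P x \<in> FS (SS N)" if "P \<in> wds m n d" "x \<in> Wb m n d N" for P x
    using linD(1)[OF Ew_lin_graded[OF d]] that by (simp add: wds_def)
  have 1: "Hmul h g \<in> ?G" "Hmul g h \<in> ?G" if g: "g \<in> ?G" for g
  proof -
    obtain z P x where z: "z \<in> FS (SS N)" "P \<in> wds m n d" "x \<in> Wb m n d N" and g: "g = Hmul z (Ew m P x)"
      using g unfolding trace_gens_def by blast
    note e = E[OF z(2,3)]
    have "Hmul h g = Hmul (Hmul h z) (Ew m P x)"
      unfolding g using Hmul_assoc[OF FS_SS_PP[OF h] FS_SS_PP[OF z(1)] FS_SS_PP[OF e]] by simp
    then show "Hmul h g \<in> ?G" unfolding trace_gens_def using z h Hmul_SS[OF h z(1)] by blast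
    have "Ew m P (RM h x) = Hmul (Ew m P x) h"
      using Ew_RM[OF d _ z(3) h] z(2) by (simp add: wds_def)
    then have "Hmul g h = Hmul z (Ew m P (RM h x))"
      unfolding g using Hmul_assoc[OF FS_SS_PP[OF z(1)] FS_SS_PP[OF e] FS_SS_PP[OF h]] by simp
    then show "Hmul g h \<in> ?G" unfolding trace_gens_def using z linD(1)[OF RM_lin_SS[OF h] z(3)] by blast
  qed
  have l: "lin (SS N) (SS N) (\<lambda>y. Hmul h y)" "lin (SS N) (SS N) (\<lambda>y. Hmul y h)"
    using reg.ract_lin_right[OF h] reg.ract_lin_left[OF h] by (simp_all add: Hmul_ract)
  have base: "?G \<subseteq> kspan ?G" unfolding kspan_eq_span by (rule kv.span_superset)
  show "Hmul h y \<in> kspan ?G"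
    by (rule lin_kspan[OF l(1) trace_gens_SS[OF d] _ y]) (use 1 base in blast)
  show "Hmul y h \<in> kspan ?G"
    by (rule lin_kspan[OF l(2) trace_gens_SS[OF d] _ y]) (use 1 base in blast)
qed

text \<open>Let z = (1 - e) y and let y' be the adjoint of y. Then \<open>herm z z\<close> equals
  the form of 1 - e with z y', which lies in the ideal, and 1 - e is orthogonal to the ideal. So z =
  0.\<close>

lemma trace_ideal_unit:
  assumes d: "d \<le> N"
  shows "\<exists>e\<in>kspan (trace_gens m n d N). \<forall>y\<in>kspan (trace_gens m n d N). Hmul e y = y"
proof -
  let ?I = "kspan (trace_gens m n d N)"
  have I: "?I \<subseteq> FS (SS N)" by (rule kspan_sub_FS[OF trace_gens_SS[OF d]])
  have one: "bas id \<in> FS (SS N)" by simp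
  from projection[OF finite_SS trace_gens_SS[OF d] one]
  obtain e where e: "e \<in> ?I" "\<forall>u\<in>?I. herm (bas id - e) u = 0" by blast
  have eS: "e \<in> FS (SS N)" using e I by blast
  have "Hmul e y = y" if y: "y \<in> ?I" for y
  proof -
    have yS: "y \<in> FS (SS N)" using y I by blast
    obtain y' where y': "y' \<in> FS (SS N)"
      and adj: "\<And>v u. v \<in> FS (SS N) \<Longrightarrow> u \<in> FS (SS N) \<Longrightarrow> herm (Hmul v y) u = herm v (Hmul u y')"
      using reg.adjoint[OF yS] unfolding Hmul_ract by blast
    let ?z = "Hmul (bas id - e) y"
    have f: "bas id - e \<in> FS (SS N)" using eS by simp
    have zI: "?z \<in> ?I" by (rule trace_ideal(1)[OF d y f])
    then have zS: "?z \<in> FS (SS N)" using I by blast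
    have "herm ?z ?z = herm (bas id - e) (Hmul ?z y')" by (rule adj[OF f zS])
    also have "\<dots> = 0" using e(2) trace_ideal(2)[OF d zI y'] by blast
    finally have "?z = 0" using herm_definite[OF zS] by blast
    then show ?thesis
      using Hmul_diff_left[of "bas id" e y] FS_SS_PP[OF eS] FS_SS_PP[OF yS] by simp
  qed
  then show ?thesis using e(1) by blast
qed

text \<open>Put w' = w - w e. Every y in the ideal gives w' y = w y - w (e y) = 0. The element Y =
  E_P(w') lies in the ideal, hence Y h Y = E_P(w' h Y) = 0 for all h, and
  \<open>Hecke_semiprime\<close> yields Y = 0. The dual basis identity then makes w' a
  relation.\<close>

lemma trace_unit_acts:
  assumes d: "d \<le> N" and e: "e \<in> kspan (trace_gens m n d N)"
    and unit: "\<forall>y\<in>kspan (trace_gens m n d N). Hmul e y = y" and w: "w \<in> Wb m n d N"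
  shows "w - RM e w \<in> Nall m n"
proof -
  let ?I = "kspan (trace_gens m n d N)" and ?A = "wds m n d"
  have I: "?I \<subseteq> FS (SS N)" by (rule kspan_sub_FS[OF trace_gens_SS[OF d]])
  have eS: "e \<in> FS (SS N)" using e I by blast
  let ?w = "w - RM e w"
  have w': "?w \<in> Wb m n d N" using w linD(1)[OF RM_lin_SS[OF eS] w] by simp
  have kill: "RM y ?w = 0" if y: "y \<in> ?I" for y
  proof -
    have yS: "y \<in> FS (SS N)" using y I by blast
    have "RM y ?w = RM y w - RM y (RM e w)"
      by (rule lin_diff[OF RM_lin_SS[OF yS] w linD(1)[OF RM_lin_SS[OF eS] w]])
    also have "RM y (RM e w) = RM (Hmul e y) w"
      by (rule RM_RM[OF FS_SS_PP[OF yS] FS_SS_PP[OF eS] Wb_in[OF w]])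
    finally show ?thesis using unit y by simp
  qed
  have E0: "Ew m P ?w = 0" if P: "P \<in> ?A" for P
  proof (rule Hecke_semiprime[of _ N])
    have lP: "length P = d" using P by (simp add: wds_def)
    let ?y = "Ew m P ?w"
    show yS: "?y \<in> FS (SS N)" using linD(1)[OF Ew_lin_graded[OF d lP] w'] .
    fix h assume h: "h \<in> FS (SS N)"
    have "Hmul (bas id) ?y \<in> trace_gens m n d N" unfolding trace_gens_def using P w' id_SS by (auto intro!: exI)
    then have "Hmul (bas id) ?y \<in> ?I" unfolding kspan_eq_span by (rule kv.span_base)
    then have "?y \<in> ?I" using FS_SS_PP[OF yS] by simp
    then have hy: "Hmul h ?y \<in> ?I" by (rule trace_ideal(1)[OF d _ h])
    have "Hmul (Hmul ?y h) ?y = Hmul ?y (Hmul h ?y)"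
      using Hmul_assoc[OF FS_SS_PP[OF yS] FS_SS_PP[OF h] FS_SS_PP[OF yS]] .
    also have "\<dots> = Ew m P (RM (Hmul h ?y) ?w)"
      by (rule Ew_RM[OF d lP w', symmetric]) (use hy I in blast)
    also have "\<dots> = 0" unfolding kill[OF hy] by (rule lin_zero[OF Ew_lin_graded[OF d lP]])
    finally show "Hmul (Hmul ?y h) ?y = 0" .
  qed
  obtain a where "?w - (\<Sum>J\<in>?A. \<Sum>P\<in>?A. smul (a J P) (tens (bas J) (Ew m P ?w))) \<in> Nall m n"
    using dual_basis[OF d, of m n] w' by blast
  then show ?thesis using E0 by simp
qed

lemma EndA_Rop:
  assumes "EndA m n d k \<phi>"
  shows "\<exists>h\<in>Hsub (d + k). \<forall>x\<in>Wsp m n d k. \<phi> x = Rop m n h x"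
proof -
  let ?N = "d + k" and ?A = "wds m n d"
  have d: "d \<le> ?N" by simp
  have \<phi>: "linW m n d k \<phi>" using assms by (simp add: EndA_def)
  obtain e where e: "e \<in> kspan (trace_gens m n d ?N)"
    and unit: "\<forall>y\<in>kspan (trace_gens m n d ?N). Hmul e y = y" using trace_ideal_unit[OF d] by blast
  obtain G c where G: "finite G" "G \<subseteq> trace_gens m n d ?N" and eG: "e = (\<Sum>g\<in>G. smul (c g) g)"
    using e unfolding kspan_def by blast
  have GS: "g \<in> FS (SS ?N)" if "g \<in> G" for g using that G(2) trace_gens_SS[OF d] by blast
  have "\<forall>g\<in>G. \<exists>t. case t of (y, P, x) \<Rightarrow> g = Hmul y (Ew m P x) \<and> y \<in> FS (SS ?N) \<and> P \<in> ?A \<and> x \<in> Wb m n d ?N"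
    using G(2) unfolding trace_gens_def by fastforce
  from bchoice[OF this] obtain t where t: "\<forall>g\<in>G. case t g of (y, P, x) \<Rightarrow>
      g = Hmul y (Ew m P x) \<and> y \<in> FS (SS ?N) \<and> P \<in> ?A \<and> x \<in> Wb m n d ?N" ..
  define y P x where "y g = fst (t g)" and "P g = fst (snd (t g))" and "x g = snd (snd (t g))" for g
  have t': "g = Hmul (y g) (Ew m (P g) (x g))" "y g \<in> FS (SS ?N)" "P g \<in> ?A" "x g \<in> Wb m n d ?N"
    if "g \<in> G" for g using t that by (auto simp: y_def P_def x_def split_def)
  have "\<forall>g\<in>G. \<exists>x'. x' \<in> Wb m n d ?N \<and> \<phi> (cos m n (x g)) = cos m n x'"
    using linW_cos[OF \<phi>] t'(4) by (intro ballI) (auto simp: Bex_def)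
  from bchoice[OF this] obtain x' where
    x': "\<forall>g\<in>G. x' g \<in> Wb m n d ?N \<and> \<phi> (cos m n (x g)) = cos m n (x' g)" ..
  define h where "h = (\<Sum>g\<in>G. smul (c g) (Hmul (y g) (Ew m (P g) (x' g))))"
  have s: "Hmul (y g) (Ew m (P g) u) \<in> FS (SS ?N)" if "g \<in> G" "u \<in> Wb m n d ?N" for g u
    using linD(1)[OF Ew_lin_graded[OF d]] that t' by (auto simp: wds_def intro!: Hmul_SS)
  have h: "h \<in> FS (SS ?N)" unfolding h_def using s x' by auto
  have Rsum: "RM (\<Sum>g\<in>G. smul (c g) (f g)) w = (\<Sum>g\<in>G. smul (c g) (RM (f g) w))"
    if w: "w \<in> Wb m n d ?N" and f: "\<And>g. g \<in> G \<Longrightarrow> f g \<in> FS (SS ?N)" for w f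
  proof -
    note l = RM_lin_elem[OF Wb_in[OF w]]
    have "RM (\<Sum>g\<in>G. smul (c g) (f g)) w = (\<Sum>g\<in>G. RM (smul (c g) (f g)) w)"
      by (rule lin_sum[OF l]) (use FS_SS_PP[OF f] in simp)
    also have "\<dots> = (\<Sum>g\<in>G. smul (c g) (RM (f g) w))"
      by (rule sum.cong) (use linD(3)[OF l] FS_SS_PP[OF f] in auto)
    finally show ?thesis .
  qed
  have "\<phi> (cos m n w) = Rop m n h (cos m n w)" if w: "w \<in> Wb m n d ?N" for w
  proof -
    have r: "\<phi> (cos m n (RM g w)) = cos m n (RM (Hmul (y g) (Ew m (P g) (x' g))) w)" if g: "g \<in> G" for g
    proof -
      \<comment> \<open>The operator f \<mapsto> w y E_P(f) sends \<open>x g\<close> to w g;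
        commuting with it replaces the value of \<open>\<phi>\<close> at w g by its value at
        \<open>x g\<close>, in which w does not occur.\<close>
      obtain \<psi> where \<psi>: "\<psi> \<in> Aspan m n d k" "\<forall>f\<in>Wb m n d ?N. \<psi> (cos m n f)
          = cos m n (\<Sum>i\<in>{g}. smul 1 (RM (Hmul (y i) (Ew m (P i) f)) w))"
        using rank_one_Aspan[of "{g}" P m n d y k "\<lambda>_. w" "\<lambda>_. 1"] t' g w by auto
      have xW: "cos m n (x g) \<in> Wsp m n d k" using t'(4)[OF g] unfolding Wsp_cos by blast
      have "RM g w = RM (Hmul (y g) (Ew m (P g) (x g))) w" using t'(1)[OF g] by simp
      then have "cos m n (RM g w) = \<psi> (cos m n (x g))" using \<psi>(2) t'(4)[OF g] by simp
      then have "\<phi> (cos m n (RM g w)) = \<psi> (\<phi> (cos m n (x g)))"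
        using assms \<psi>(1) xW unfolding EndA_def by simp
      then show ?thesis using \<psi>(2) x' g by simp
    qed
    have "cos m n w = cos m n (RM e w)" unfolding cos_eq by (rule trace_unit_acts[OF d e unit w])
    also have "RM e w = (\<Sum>g\<in>G. smul (c g) (RM g w))" unfolding eG by (rule Rsum[OF w GS])
    also have "\<phi> (cos m n \<dots>) = cos m n (\<Sum>g\<in>G. smul (c g) (RM (Hmul (y g) (Ew m (P g) (x' g))) w))"
      by (rule linW_sum[OF \<phi> G(1) _ r]) (use linD(1)[OF RM_lin_SS[OF GS] w] in auto)
    also have "\<dots> = cos m n (RM h w)" unfolding h_def using Rsum[OF w, of "\<lambda>g. Hmul (y g) (Ew m (P g) (x' g))"] s x' by simp
    also have "\<dots> = Rop m n h (cos m n w)" using Rop_cos[OF Wb_in[OF w] FS_SS_PP[OF h]] by simp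
    finally show ?thesis .
  qed
  then show ?thesis using h unfolding Hsub_FS Wsp_cos by blast
qed

text \<open>The operators in the span have lifts that commute exactly with \<open>RM h\<close>, and
  this descends to classes.\<close>

lemma Rop_EndA:
  assumes "h \<in> Hsub (d + k)" "\<forall>x\<in>Wsp m n d k. \<phi> x = Rop m n h x"
  shows "EndA m n d k \<phi>"
proof -
  let ?N = "d + k"
  have h: "h \<in> FS (SS ?N)" using assms(1) by (simp add: Hsub_FS)
  have l: "lin (wds m n d \<times> SS ?N) (wds m n d \<times> SS ?N) (RM h)" by (rule RM_lin_SS[OF h])
  have e: "\<phi> (cos m n f) = cos m n (RM h f)" if "f \<in> Wb m n d ?N" for f
    using assms(2) that Rop_cos[OF Wb_in[OF that] FS_SS_PP[OF h]] by (auto simp: Wsp_cos)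
  have "linW m n d k \<phi>"
    unfolding linW_def Wsp_cos using linD[OF l] e by (auto simp: qadd_cos qsmul_cos)
  moreover have "\<phi> (\<psi> (cos m n f)) = \<psi> (\<phi> (cos m n f))" if \<psi>: "\<psi> \<in> Aspan m n d k" and f: "f \<in> Wb m n d ?N" for \<psi> f
  proof -
    obtain F where F: "lin (wds m n d \<times> SS ?N) (wds m n d \<times> SS ?N) F"
      "\<And>f. f \<in> Wb m n d ?N \<Longrightarrow> \<psi> (cos m n f) = cos m n (F f)"
      "\<And>h f. h \<in> FS (SS ?N) \<Longrightarrow> f \<in> Wb m n d ?N \<Longrightarrow> F (RM h f) = RM h (F f)"
      using Aspan_induced[OF \<psi>] unfolding induced_def by blast
    show ?thesis using e[OF f] e[OF linD(1)[OF F(1) f]] F(2)[OF f] F(2)[OF linD(1)[OF l f]] F(3)[OF h f] by simp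
  qed
  ultimately show ?thesis unfolding EndA_def Wsp_cos by auto
qed

theorem theorem7p2:
  fixes m n d k :: nat
  assumes "1 \<le> m" and "1 \<le> n" and "1 \<le> d" and "k \<le> d" and "qfact d \<noteq> 0"
  shows "(\<forall>\<phi>. EndH m n d k \<phi> \<longleftrightarrow>
            (\<exists>\<psi>\<in>Aspan m n d k. \<forall>x\<in>Wsp m n d k. \<phi> x = \<psi> x))
       \<and> (\<forall>\<phi>. EndA m n d k \<phi> \<longleftrightarrow>
            (\<exists>h\<in>Hsub (d + k). \<forall>x\<in>Wsp m n d k. \<phi> x = Rop m n h x))"
proof (intro conjI allI iffI)
  fix \<phi>
  show "\<exists>\<psi>\<in>Aspan m n d k. \<forall>x\<in>Wsp m n d k. \<phi> x = \<psi> x" if "EndH m n d k \<phi>"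
    using that by (rule EndH_Aspan)
  show "EndH m n d k \<phi>" if "\<exists>\<psi>\<in>Aspan m n d k. \<forall>x\<in>Wsp m n d k. \<phi> x = \<psi> x"
    using that by (elim bexE) (rule Aspan_EndH)
  show "\<exists>h\<in>Hsub (d + k). \<forall>x\<in>Wsp m n d k. \<phi> x = Rop m n h x" if "EndA m n d k \<phi>"
    using that by (rule EndA_Rop)
  show "EndA m n d k \<phi>" if "\<exists>h\<in>Hsub (d + k). \<forall>x\<in>Wsp m n d k. \<phi> x = Rop m n h x"
    using that by (elim bexE) (rule Rop_EndA)
qed

end
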